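(* Any local family $P_\epsilon$ of Poisson structures on $\mathbb{R}^3$ such that $P_0$ has a $V$ singularity at the origin is equivalent to a family of the form $$\frac{\partial}{\partial y}\wedge v_\epsilon,\qquad v_\epsilon=\alpha_\epsilon(x,z)\frac{\partial}{\partial x}+\beta_\epsilon(x,z)\frac{\partial}{\partial z},$$ where the sum of the eigenvalues of the linearization at the origin of the vector field $v_0$ is different from zero.
   Context: All objects are of class $C^\infty$ and all families depend smoothly on the parameter $\epsilon$, which varies near $0\in\mathbb{R}^l$; local families are considered near the origin of $\mathbb{R}^3$ and $\epsilon=0$. A Poisson structure in coordinates $x,y,z$ is identified with the bivector field $P=\{x,y\}\,\partial_x\wedge\partial_y+\{y,z\}\,\partial_y\wedge\partial_z+\{z,x\}\,\partial_z\wedge\partial_x$. Two local families $P_\epsilon$ and $\tilde P_\epsilon$ are equivalent if there is a family of local diffeomorphisms $\phi_\epsilon$ (smooth in $\epsilon$) with $\phi_0(0)=0$ and $(\phi_\epsilon)_*P_\epsilon=\tilde P_\epsilon$ for all small $\epsilon$ (it is not required that $\phi_\epsilon(0)=0$ for $\epsilon\neq0$). Definition of $V$ singularity. Suppose $P(0)=0$ and $j^1_0P\neq0$. Isomorphism of 1-jets means equivalence of linear Poisson structures under linear changes of coordinates. If $j^1_0P$ is not isomorphic to the linear Poisson structure (L): $\{x,y\}=0,\ \{y,z\}=y,\ \{z,x\}=-x$, then there are smooth local coordinates followed by a formal change of coordinates, preserving the origin, in which (the Taylor series of) $P$ has the form $$\{x,y\}=z,\quad \{y,z\}=\frac{\partial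 \hat f}{\partial x}+z\frac{\partial \hat g}{\partial x},\quad \{z,x\}=\frac{\partial \hat f}{\partial y}+z\frac{\partial \hat g}{\partial y},$$ with formal power series $\hat f=\hat f(x,y)$, $\hat g=\hat g(x,y)$, $\hat f(0)=\hat g(0)=0$, $d\hat f\wedge d\hat g\equiv0$. The structure $P$ has a $V$ singularity at the origin if $P(0)=0$, $j^1_0P\neq 0$ and either $j^1_0P$ is isomorphic to (L), or $j^1_0\hat g\neq0$ in this normal form. *)

theory Defs
  imports
    "HOL-Analysis.Analysis"
    "HOL-Computational_Algebra.Computational_Algebra"
begin

section \<open>Smooth maps and diffeomorphisms\<close>

primrec Ck_on ::
  "nat \<Rightarrow> 'a::real_normed_vector set \<Rightarrow> ('a \<Rightarrow> 'b::real_normed_vector) \<Rightarrow> bool"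
where
  "Ck_on 0 = (\<lambda>S f. continuous_on S f)"
| "Ck_on (Suc k) = (\<lambda>S f. (\<forall>x\<in>S. f differentiable (at x)) \<and>
     (\<forall>v. Ck_on k S (\<lambda>x. frechet_derivative f (at x) v)))"

text \<open>Only meant for open \<open>S\<close> and finite-dimensional spaces.\<close>

definition smooth_on ::
  "'a::real_normed_vector set \<Rightarrow> ('a \<Rightarrow> 'b::real_normed_vector) \<Rightarrow> bool" where
  "smooth_on S f \<longleftrightarrow> (\<forall>k. Ck_on k S f)"

definition smooth_near ::
  "'a::real_normed_vector \<Rightarrow> ('a \<Rightarrow> 'b::real_normed_vector) \<Rightarrow> bool" where
  "smooth_near p f \<longleftrightarrow> (\<exists>U. open U \<and> p \<in> U \<and> smooth_on U f)"

definition diffeo ::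
  "'a::real_normed_vector set \<Rightarrow> 'b::real_normed_vector set \<Rightarrow> ('a \<Rightarrow> 'b) \<Rightarrow> bool" where
  "diffeo U V f \<longleftrightarrow> open U \<and> open V \<and> bij_betw f U V \<and>
     smooth_on U f \<and> smooth_on V (inv_into U f)"

definition pderiv_at :: "'n::finite \<Rightarrow> (real^'n \<Rightarrow> real) \<Rightarrow> real^'n \<Rightarrow> real" where
  "pderiv_at i f p = frechet_derivative f (at p) (axis i 1)"

section \<open>Bivector fields and Poisson structures on three-space\<close>

text \<open>
  The coordinates \<open>x, y, z\<close> of a point \<open>p\<close> are \<open>p$1, p$2, p$3\<close>.  A bivector is represented by
  the skew-symmetric matrix of its pairings with the coordinate differentials, so that
  the entry \<open>P p $ i $ j\<close> of a Poisson structure \<open>P\<close> is the bracket of the \<open>i\<close>-th and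
  \<open>j\<close>-th coordinates at \<open>p\<close>.
\<close>

definition wedge :: "'a::comm_ring_1^3 \<Rightarrow> 'a^3 \<Rightarrow> 'a^3^3" where
  "wedge u v = (\<chi> i j. u $ i * v $ j - u $ j * v $ i)"

text \<open>
  \<open>bivector a b c\<close> is the structure with brackets \<open>{x,y} = a\<close>, \<open>{y,z} = b\<close>, \<open>{z,x} = c\<close>.
  The entries may be real numbers or formal power series.
\<close>

definition bivector :: "'a::comm_ring_1 \<Rightarrow> 'a \<Rightarrow> 'a \<Rightarrow> 'a^3^3" where
  "bivector a b c = vector [vector [0, a, -c], vector [-a, 0, b], vector [c, -b, 0]]"

lemma bivector_eq_wedge:
  "bivector a b c = a *\<^sub>R wedge (axis 1 1) (axis 2 1) + b *\<^sub>R wedge (axis 2 1) (axis 3 1)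
     + c *\<^sub>R wedge (axis 3 1) (axis 1 (1::real))"
  by (simp add: bivector_def wedge_def vec_eq_iff forall_3 axis_def)

text \<open>The last condition is the vanishing of the Schouten bracket \<open>[P, P]\<close> at \<open>p\<close>.\<close>

definition poisson_at :: "(real^3 \<Rightarrow> real^3^3) \<Rightarrow> real^3 \<Rightarrow> bool" where
  "poisson_at P p \<longleftrightarrow> transpose (P p) = - P p \<and>
     (\<forall>i j k. (\<Sum>l\<in>UNIV. P p $ i $ l * pderiv_at l (\<lambda>q. P q $ j $ k) p
                     + P p $ j $ l * pderiv_at l (\<lambda>q. P q $ k $ i) p
                     + P p $ k $ l * pderiv_at l (\<lambda>q. P q $ i $ j) p) = 0)"

text \<open>
  Local families are represented by total functions; only their values near
  \<open>\<epsilon> = 0\<close> and the origin matter.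
\<close>

definition local_poisson_family :: "(real^'l \<Rightarrow> real^3 \<Rightarrow> real^3^3) \<Rightarrow> bool" where
  "local_poisson_family P \<longleftrightarrow> (\<exists>U. open U \<and> (0, 0) \<in> U \<and>
     smooth_on U (\<lambda>(\<epsilon>, p). P \<epsilon> p) \<and> (\<forall>(\<epsilon>, p)\<in>U. poisson_at (P \<epsilon>) p))"

text \<open>\<open>pushes_to U \<phi> P Q\<close>: on \<open>\<phi> ` U\<close>, the push-forward of \<open>P\<close> by \<open>\<phi>\<close> is \<open>Q\<close>.\<close>

definition pushes_to ::
  "(real^3) set \<Rightarrow> (real^3 \<Rightarrow> real^3) \<Rightarrow> (real^3 \<Rightarrow> real^3^3) \<Rightarrow> (real^3 \<Rightarrow> real^3^3) \<Rightarrow> bool" where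
  "pushes_to U \<phi> P Q \<longleftrightarrow>
     (\<forall>p\<in>U. Q (\<phi> p) = jacobian \<phi> (at p) ** P p ** transpose (jacobian \<phi> (at p)))"

text \<open>The slices of \<open>U\<close> at parameters away from \<open>0\<close> may be empty.\<close>

definition families_equivalent ::
  "(real^'l \<Rightarrow> real^3 \<Rightarrow> real^3^3) \<Rightarrow> (real^'l \<Rightarrow> real^3 \<Rightarrow> real^3^3) \<Rightarrow> bool" where
  "families_equivalent P Q \<longleftrightarrow> (\<exists>U \<phi>. open U \<and> (0, 0) \<in> U \<and>
     smooth_on U (\<lambda>(\<epsilon>, p). \<phi> \<epsilon> p) \<and> \<phi> 0 0 = 0 \<and>
     (\<forall>\<epsilon>. let U\<^sub>\<epsilon> = {p. (\<epsilon>, p) \<in> U} in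
        diffeo U\<^sub>\<epsilon> (\<phi> \<epsilon> ` U\<^sub>\<epsilon>) (\<phi> \<epsilon>) \<and> pushes_to U\<^sub>\<epsilon> (\<phi> \<epsilon>) (P \<epsilon>) (Q \<epsilon>)))"

section \<open>One-jets\<close>

text \<open>
  For \<open>P 0 = 0\<close> the one-jet of \<open>P\<close> at the origin is its linear part, regarded as a
  linear Poisson structure.
\<close>

definition linear_part :: "(real^3 \<Rightarrow> real^3^3) \<Rightarrow> real^3 \<Rightarrow> real^3^3" where
  "linear_part P = frechet_derivative P (at 0)"

definition linear_poisson_iso :: "(real^3 \<Rightarrow> real^3^3) \<Rightarrow> (real^3 \<Rightarrow> real^3^3) \<Rightarrow> bool" where
  "linear_poisson_iso P Q \<longleftrightarrow>
     (\<exists>A. invertible A \<and> (\<forall>p. Q (A *v p) = A ** P p ** transpose A))"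

definition L_structure :: "real^3 \<Rightarrow> real^3^3" where
  "L_structure p = bivector 0 (p $ 2) (- (p $ 1))"

section \<open>Formal power series in three variables\<close>

text \<open>
  The outermost series variable is \<open>z\<close>, the next one \<open>y\<close>, and the innermost one \<open>x\<close>.
  Thus a series in \<open>x\<close> and \<open>y\<close> has type \<^typ>\<open>real fps fps\<close> and becomes a series in
  \<open>x, y, z\<close> by means of \<^const>\<open>fps_const\<close>.
\<close>

type_synonym fps2 = "real fps fps"
type_synonym fps3 = "real fps fps fps"

definition coeff2 :: "fps2 \<Rightarrow> nat \<Rightarrow> nat \<Rightarrow> real" where
  "coeff2 F i j = fps_nth (fps_nth F j) i"

definition coeff3 :: "fps3 \<Rightarrow> nat \<Rightarrow> nat \<Rightarrow> nat \<Rightarrow> real" where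
  "coeff3 F i j k = fps_nth (fps_nth (fps_nth F k) j) i"

definition series3 :: "(nat \<Rightarrow> nat \<Rightarrow> nat \<Rightarrow> real) \<Rightarrow> fps3" where
  "series3 c = Abs_fps (\<lambda>k. Abs_fps (\<lambda>j. Abs_fps (\<lambda>i. c i j k)))"

definition series_z :: fps3 where
  "series_z = fps_X"

definition series_deriv :: "3 \<Rightarrow> fps3 \<Rightarrow> fps3" where
  "series_deriv m F =
     (if m = 1 then series3 (\<lambda>i j k. real (Suc i) * coeff3 F (Suc i) j k)
      else if m = 2 then series3 (\<lambda>i j k. real (Suc j) * coeff3 F i (Suc j) k)
      else series3 (\<lambda>i j k. real (Suc k) * coeff3 F i j (Suc k)))"

definition taylor3 :: "(real^3 \<Rightarrow> real) \<Rightarrow> fps3" where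
  "taylor3 h = series3 (\<lambda>i j k.
     ((pderiv_at 1 ^^ i) ((pderiv_at 2 ^^ j) ((pderiv_at 3 ^^ k) h))) 0
       / (fact i * fact j * fact k))"

text \<open>
  Substitution of series without constant term: a monomial of degree \<open>d\<close> contributes
  only in degrees at least \<open>d\<close>, so the truncated sum loses nothing.
\<close>

definition series_subst :: "fps3 \<Rightarrow> fps3^3 \<Rightarrow> fps3" where
  "series_subst F A = series3 (\<lambda>i j k.
     (\<Sum>a\<le>i+j+k. \<Sum>b\<le>i+j+k. \<Sum>c\<le>i+j+k.
        coeff3 F a b c * coeff3 ((A $ 1)^a * (A $ 2)^b * (A $ 3)^c) i j k))"

definition series_jacobian :: "fps3^3 \<Rightarrow> fps3^3^3" where
  "series_jacobian A = (\<chi> i j. series_deriv j (A $ i))"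

definition formal_coordinate_change :: "fps3^3 \<Rightarrow> bool" where
  "formal_coordinate_change A \<longleftrightarrow> (\<forall>i. coeff3 (A $ i) 0 0 0 = 0) \<and>
     invertible (\<chi> i j. coeff3 (series_jacobian A $ i $ j) 0 0 0)"

text \<open>The formal counterpart of \<^const>\<open>pushes_to\<close>.\<close>

definition formally_pushes_to :: "fps3^3 \<Rightarrow> fps3^3^3 \<Rightarrow> fps3^3^3 \<Rightarrow> bool" where
  "formally_pushes_to A P Q \<longleftrightarrow>
     (\<chi> i j. series_subst (Q $ i $ j) A)
       = series_jacobian A ** P ** transpose (series_jacobian A)"

section \<open>V singularities\<close>

definition normal_form_pair :: "fps2 \<Rightarrow> fps2 \<Rightarrow> bool" where
  "normal_form_pair f g \<longleftrightarrow> coeff2 f 0 0 = 0 \<and> coeff2 g 0 0 = 0 \<and>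
     series_deriv 1 (fps_const f) * series_deriv 2 (fps_const g)
       - series_deriv 2 (fps_const f) * series_deriv 1 (fps_const g) = 0"

definition normal_form :: "fps2 \<Rightarrow> fps2 \<Rightarrow> fps3^3^3" where
  "normal_form f g = bivector series_z
     (series_deriv 1 (fps_const f) + series_z * series_deriv 1 (fps_const g))
     (series_deriv 2 (fps_const f) + series_z * series_deriv 2 (fps_const g))"

definition has_normal_form :: "(real^3 \<Rightarrow> real^3^3) \<Rightarrow> fps2 \<Rightarrow> fps2 \<Rightarrow> bool" where
  "has_normal_form P f g \<longleftrightarrow> normal_form_pair f g \<and>
     (\<exists>U V \<phi> Q A. diffeo U V \<phi> \<and> 0 \<in> U \<and> \<phi> 0 = 0 \<and> pushes_to U \<phi> P Q \<and>
        formal_coordinate_change A \<and>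
        formally_pushes_to A (\<chi> i j. taylor3 (\<lambda>p. Q p $ i $ j)) (normal_form f g))"

definition jet1_nonzero :: "fps2 \<Rightarrow> bool" where
  "jet1_nonzero g \<longleftrightarrow> coeff2 g 0 0 \<noteq> 0 \<or> coeff2 g 1 0 \<noteq> 0 \<or> coeff2 g 0 1 \<noteq> 0"

definition V_singularity :: "(real^3 \<Rightarrow> real^3^3) \<Rightarrow> bool" where
  "V_singularity P \<longleftrightarrow> P 0 = 0 \<and> linear_part P \<noteq> (\<lambda>_. 0) \<and>
     (linear_poisson_iso (linear_part P) L_structure \<or>
      (\<exists>f g. has_normal_form P f g \<and> jet1_nonzero g))"

section \<open>The model families\<close>

definition model_field :: "(real \<Rightarrow> real \<Rightarrow> real) \<Rightarrow> (real \<Rightarrow> real \<Rightarrow> real) \<Rightarrow> real^3 \<Rightarrow> real^3" where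
  "model_field a b p = vector [a (p $ 1) (p $ 3), 0, b (p $ 1) (p $ 3)]"

text \<open>Complex eigenvalues, counted with algebraic multiplicity.\<close>

definition charpoly :: "real^'n^'n \<Rightarrow> complex poly" where
  "charpoly A = det (\<chi> i j. (if i = j then [:0, 1:] else 0) - [:complex_of_real (A $ i $ j):])"

definition sum_eigenvalues :: "real^'n^'n \<Rightarrow> complex" where
  "sum_eigenvalues A = sum_mset (proots (charpoly A))"

end

theory Submission
  imports Defs
begin

text \<open>
  Contraction with the coordinate volume turns a bivector field on three-space into a one-form
  \<open>b\<close> with components \<open>({y,z}, {z,x}, {x,y})\<close>.  In these terms the Jacobi identity says that \<open>b\<close>
  annihilates its own curl.  The curl \<open>X\<close> is the modular vector field of the Poisson structure.
  Since \<open>X\<close> is divergence free and \<open>b\<close> annihilates it, Cartan's formula shows that the flow of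
  \<open>X\<close> preserves both \<open>b\<close> and the volume, hence the Poisson structure.  In coordinates in which
  \<open>X\<close> becomes \<open>\<partial>/\<partial>y\<close>, the coefficients of the structure therefore do not depend on \<open>y\<close>, and
  \<open>X \<and> P = 0\<close> (another form of \<open>b(X) = 0\<close>) says that \<open>P = \<partial>/\<partial>y \<and> v\<close>.  In the file this is the
  locale \<open>straightened_curl\<close>.

  The straightening is possible, for all small parameters at once, as soon as \<open>X\<close> does not vanish
  at the origin for \<open>\<epsilon> = 0\<close>.  This is the meaning of the V condition.  Where \<open>P\<close> vanishes, the vector
  \<open>X\<close> depends only on the one-jet of \<open>P\<close>, as the trace of the adjoint representation of a Lie
  algebra, and it transforms as a vector under smooth and under formal coordinate changes.  It equals
  \<open>(0, 0, -2)\<close> for the structure (L) and \<open>(-\<partial>g/\<partial>y, \<partial>g/\<partial>x, 0)\<close> for the other normal form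
  (\<open>V_singularity_modular_vector\<close>).  The same invariance, applied to the final coordinates, where
  \<open>X\<close> is \<open>\<partial>/\<partial>y\<close> and the \<open>y\<close>-component of the curl is the divergence of \<open>v\<close>, gives that the
  eigenvalues of the linear part of \<open>v\<^sub>0\<close> sum to one.

  The analytic input is a flow that is smooth jointly in time, initial point and parameter
  (\<open>parametrized_solution_Ck\<close>, \<open>local_flow\<close>).  Solutions come from a contraction on bounded
  continuous functions.  Their smoothness follows by induction on the order: the derivative of a
  solution in a parameter solves the linearized equation, whose coefficients are as smooth as the
  solution is already known to be.  The inverse function theorem then provides the charts, and
  Cramer's rule shows that they are smooth in both directions (\<open>flow_chart\<close>,
  \<open>smooth_inverse_chart\<close>).
\<close>

section \<open>Calculus of finitely often differentiable maps\<close>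

lemma Ck_on_cong:
  assumes "open S" "\<And>x. x \<in> S \<Longrightarrow> f x = g x" "Ck_on k S f"
  shows "Ck_on k S g"
  using assms(2,3)
proof (induction k arbitrary: f g)
  case 0
  then show ?case using continuous_on_cong[OF refl, of S f g] by simp
next
  case (Suc k)
  have D: "(g has_derivative frechet_derivative f (at x)) (at x)" if "x \<in> S" for x
  proof (rule has_derivative_transform_within_open[OF _ assms(1) that])
    show "(f has_derivative frechet_derivative f (at x)) (at x)"
      using Suc.prems(2) that by (simp flip: frechet_derivative_works)
  qed (use Suc.prems in auto)
  have E: "frechet_derivative g (at x) = frechet_derivative f (at x)" if "x \<in> S" for x
    using frechet_derivative_at[OF D[OF that]] by simp
  have "Ck_on k S (\<lambda>x. frechet_derivative g (at x) v)" for v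
    by (rule Suc.IH[of "\<lambda>x. frechet_derivative f (at x) v"]) (use E Suc.prems(2) in auto)
  moreover have "g differentiable (at x)" if "x \<in> S" for x
    using D[OF that] by (rule differentiableI)
  ultimately show ?case by simp
qed

text \<open>
  The working characterization: any candidate for the derivative may be used, so that
  \<^const>\<open>frechet_derivative\<close> need not be computed.
\<close>

lemma Ck_on_SucI:
  assumes "open S" "\<And>x. x \<in> S \<Longrightarrow> (f has_derivative f' x) (at x)"
    "\<And>v. Ck_on k S (\<lambda>x. f' x v)"
  shows "Ck_on (Suc k) S f"
proof -
  have E: "frechet_derivative f (at x) = f' x" if "x \<in> S" for x
    using frechet_derivative_at[OF assms(2)[OF that]] by simp
  have "Ck_on k S (\<lambda>x. frechet_derivative f (at x) v)" for v
    by (rule Ck_on_cong[OF assms(1) _ assms(3)[of v]]) (simp add: E)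
  moreover have "f differentiable (at x)" if "x \<in> S" for x
    using assms(2)[OF that] by (rule differentiableI)
  ultimately show ?thesis by (simp only: Ck_on.simps) blast
qed

lemma Ck_on_Suc_has_derivative:
  "Ck_on (Suc k) S f \<Longrightarrow> x \<in> S \<Longrightarrow> (f has_derivative frechet_derivative f (at x)) (at x)"
  by (simp flip: frechet_derivative_works)

lemma Ck_on_SucD: "Ck_on (Suc k) S f \<Longrightarrow> Ck_on k S f"
proof (induction k arbitrary: f)
  case 0
  then show ?case
    by (auto intro!: continuous_at_imp_continuous_on differentiable_imp_continuous_within)
next
  case (Suc k)
  then show ?case by (metis Ck_on.simps(2))
qed

lemma Ck_on_imp_continuous_on: "Ck_on k S f \<Longrightarrow> continuous_on S f"
  by (induction k) (use Ck_on_SucD in auto)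

lemma Ck_on_subset: "Ck_on k S f \<Longrightarrow> T \<subseteq> S \<Longrightarrow> Ck_on k T f"
  by (induction k arbitrary: f) (auto intro: continuous_on_subset)

lemma Ck_on_const: "Ck_on k S (\<lambda>_. c)"
  by (induction k arbitrary: c) auto

lemma Ck_on_bounded_linear:
  assumes "bounded_linear L" "open S"
  shows "Ck_on k S L"
proof (cases k)
  case 0 then show ?thesis using assms by (auto intro: linear_continuous_on)
next
  case (Suc j)
  show ?thesis unfolding Suc
    by (rule Ck_on_SucI[OF assms(2), where f' = "\<lambda>_. L"])
      (use assms Ck_on_const in \<open>auto intro: bounded_linear_imp_has_derivative\<close>)
qed

lemma Ck_on_compose_bounded_linear:
  assumes "bounded_linear L" "open S" "Ck_on k S f"
  shows "Ck_on k S (\<lambda>x. L (f x))"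
  using assms(3)
proof (induction k arbitrary: f)
  case 0 then show ?case
    using assms by (auto intro: bounded_linear.continuous_on)
next
  case (Suc k)
  show ?case
  proof (rule Ck_on_SucI[OF assms(2)])
    show "((\<lambda>x. L (f x)) has_derivative (\<lambda>v. L (frechet_derivative f (at x) v))) (at x)" if "x \<in> S" for x
      using bounded_linear.has_derivative[OF assms(1) Ck_on_Suc_has_derivative[OF Suc.prems that]] .
  qed (use Suc in auto)
qed

lemma Ck_on_add:
  assumes "open S" "Ck_on k S f" "Ck_on k S g"
  shows "Ck_on k S (\<lambda>x. f x + g x)"
  using assms(2,3)
proof (induction k arbitrary: f g)
  case 0 then show ?case by (simp add: continuous_on_add continuous_on_Pair)
next
  case (Suc k)
  show ?case
  proof (rule Ck_on_SucI[OF assms(1)])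
    show "((\<lambda>x. f x + g x) has_derivative
        (\<lambda>v. frechet_derivative f (at x) v + frechet_derivative g (at x) v)) (at x)" if "x \<in> S" for x
      using has_derivative_add Ck_on_Suc_has_derivative Suc.prems that by blast
  qed (use Suc in auto)
qed

lemma Ck_on_sum:
  assumes "open S" "\<And>i. i \<in> I \<Longrightarrow> Ck_on k S (f i)"
  shows "Ck_on k S (\<lambda>x. \<Sum>i\<in>I. f i x)"
  using assms(2)
  by (induction I rule: infinite_finite_induct) (auto intro: Ck_on_const Ck_on_add assms(1))

lemma Ck_on_bilinear:
  assumes "bounded_bilinear B" "open S" "Ck_on k S f" "Ck_on k S g"
  shows "Ck_on k S (\<lambda>x. B (f x) (g x))"
  using assms(3,4)
proof (induction k arbitrary: f g)
  case 0 then show ?case using bounded_bilinear.continuous_on[OF assms(1)] by auto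
next
  case (Suc k)
  show ?case
  proof (rule Ck_on_SucI[OF assms(2)])
    show "((\<lambda>x. B (f x) (g x)) has_derivative
        (\<lambda>v. B (f x) (frechet_derivative g (at x) v) + B (frechet_derivative f (at x) v) (g x))) (at x)"
      if "x \<in> S" for x
      using Suc.prems that by (intro bounded_bilinear.FDERIV[OF assms(1)] Ck_on_Suc_has_derivative)
    show "Ck_on k S (\<lambda>x. B (f x) (frechet_derivative g (at x) v) + B (frechet_derivative f (at x) v) (g x))" for v
      by (intro Ck_on_add assms Suc.IH Ck_on_SucD[OF Suc.prems(1)] Ck_on_SucD[OF Suc.prems(2)])
        (use Suc.prems in simp_all)
  qed
qed

lemma Ck_on_Pair:
  assumes "open S" "Ck_on k S f" "Ck_on k S g"
  shows "Ck_on k S (\<lambda>x. (f x, g x))"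
  using assms(2,3)
proof (induction k arbitrary: f g)
  case 0 then show ?case by (simp add: continuous_on_add continuous_on_Pair)
next
  case (Suc k)
  show ?case
  proof (rule Ck_on_SucI[OF assms(1)])
    show "((\<lambda>x. (f x, g x)) has_derivative
        (\<lambda>v. (frechet_derivative f (at x) v, frechet_derivative g (at x) v))) (at x)" if "x \<in> S" for x
      using Suc.prems that by (intro has_derivative_Pair Ck_on_Suc_has_derivative)
  qed (use Suc in auto)
qed

lemma has_derivative_basis_expansion:
  fixes f :: "'a::euclidean_space \<Rightarrow> 'b::real_normed_vector"
  assumes "(f has_derivative D) (at x)"
  shows "D v = (\<Sum>b\<in>Basis. (v \<bullet> b) *\<^sub>R D b)"
proof -
  have "linear D" using assms has_derivative_linear by blast
  then show ?thesis
    by (metis (no_types, lifting) euclidean_representation linear_sum linear_cmul sum.cong)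
qed

text \<open>
  By the chain rule, the derivative of \<open>g \<circ> f\<close> evaluates \<open>g'\<close> in a direction that varies with the
  point.  Expanding this direction in a basis leaves only directional derivatives of \<open>g\<close> in fixed
  directions, to which the induction hypothesis applies.
\<close>

lemma Ck_on_compose:
  fixes f :: "'a::real_normed_vector \<Rightarrow> 'b::euclidean_space" and g :: "'b \<Rightarrow> 'c::real_normed_vector"
  assumes "open S" "open T" "f ` S \<subseteq> T" "Ck_on k S f" "Ck_on k T g"
  shows "Ck_on k S (\<lambda>x. g (f x))"
  using assms(4,5)
proof (induction k arbitrary: g)
  case 0 then show ?case using assms(3) by (auto intro: continuous_on_compose2)
next
  case (Suc k)
  let ?Df = "\<lambda>x. frechet_derivative f (at x)" and ?Dg = "\<lambda>x. frechet_derivative g (at x)"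
  show ?case
  proof (rule Ck_on_SucI[OF assms(1)])
    fix x assume x: "x \<in> S"
    have f: "(f has_derivative ?Df x) (at x)" and g: "(g has_derivative ?Dg (f x)) (at (f x))"
      using Ck_on_Suc_has_derivative Suc.prems x assms(3) by blast+
    have "((\<lambda>x. g (f x)) has_derivative (\<lambda>v. ?Dg (f x) (?Df x v))) (at x)"
      using has_derivative_compose[OF f g] .
    also have "(\<lambda>v. ?Dg (f x) (?Df x v)) = (\<lambda>v. \<Sum>b\<in>Basis. (?Df x v \<bullet> b) *\<^sub>R ?Dg (f x) b)"
      by (rule ext) (rule has_derivative_basis_expansion[OF g])
    finally show "((\<lambda>x. g (f x)) has_derivative (\<lambda>v. \<Sum>b\<in>Basis. (?Df x v \<bullet> b) *\<^sub>R ?Dg (f x) b)) (at x)" .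
  next
    fix v
    have *: "Ck_on k S (\<lambda>x. ?Dg (f x) b)" for b
      by (rule Suc.IH[of "\<lambda>y. ?Dg y b", OF Ck_on_SucD[OF Suc.prems(1)]]) (use Suc.prems(2) in simp)
    have "Ck_on k S (\<lambda>x. ?Df x v \<bullet> b)" for b
      using Suc.prems(1) by (auto intro!: Ck_on_compose_bounded_linear[OF bounded_linear_inner_left assms(1)])
    then show "Ck_on k S (\<lambda>x. \<Sum>b\<in>Basis. (?Df x v \<bullet> b) *\<^sub>R ?Dg (f x) b)"
      by (intro Ck_on_sum Ck_on_bilinear[OF bounded_bilinear_scaleR] assms(1) *)
  qed
qed

lemma Ck_on_inverse:
  fixes f :: "'a::real_normed_vector \<Rightarrow> real"
  assumes "open S" "Ck_on k S f" "\<And>x. x \<in> S \<Longrightarrow> f x \<noteq> 0"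
  shows "Ck_on k S (\<lambda>x. inverse (f x))"
  using assms(2)
proof (induction k)
  case 0 then show ?case using assms(3) by (simp add: continuous_on_inverse)
next
  case (Suc k)
  note I = Suc.IH[OF Ck_on_SucD[OF Suc.prems]]
  show ?case
  proof (rule Ck_on_SucI[OF assms(1)])
    show "((\<lambda>x. inverse (f x)) has_derivative
        (\<lambda>v. - (inverse (f x) * frechet_derivative f (at x) v * inverse (f x)))) (at x)" if "x \<in> S" for x
      using that by (intro Deriv.has_derivative_inverse assms(3) Ck_on_Suc_has_derivative[OF Suc.prems])
    show "Ck_on k S (\<lambda>x. - (inverse (f x) * frechet_derivative f (at x) v * inverse (f x)))" for v
      by (intro Ck_on_compose_bounded_linear[OF bounded_linear_minus[OF bounded_linear_ident]]
          Ck_on_bilinear[OF bounded_bilinear_mult] I assms(1)) (use Suc.prems in auto)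
  qed
qed

lemma Ck_on_directional_derivative:
  "Ck_on (Suc k) S f \<Longrightarrow> Ck_on k S (\<lambda>x. frechet_derivative f (at x) v)"
  by simp

lemma Ck_on_mono: "Ck_on k S f \<Longrightarrow> j \<le> k \<Longrightarrow> Ck_on j S f"
proof (induction k)
  case (Suc k)
  then show ?case using Ck_on_SucD[OF Suc.prems(1)] by (cases "j = Suc k") (simp_all only: le_Suc_eq, auto)
qed simp

lemma Ck_on_id: "open S \<Longrightarrow> Ck_on k S (\<lambda>x. x)"
  by (rule Ck_on_bounded_linear[OF bounded_linear_ident])

lemma Ck_on_fst: "open S \<Longrightarrow> Ck_on k S f \<Longrightarrow> Ck_on k S (\<lambda>x. fst (f x))"
  by (rule Ck_on_compose_bounded_linear[OF bounded_linear_fst])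

lemma Ck_on_snd: "open S \<Longrightarrow> Ck_on k S f \<Longrightarrow> Ck_on k S (\<lambda>x. snd (f x))"
  by (rule Ck_on_compose_bounded_linear[OF bounded_linear_snd])

lemma Ck_on_inner_left: "open S \<Longrightarrow> Ck_on k S f \<Longrightarrow> Ck_on k S (\<lambda>x. f x \<bullet> c)"
  by (rule Ck_on_compose_bounded_linear[OF bounded_linear_inner_left])

lemma Ck_on_scaleR_const: "open S \<Longrightarrow> Ck_on k S f \<Longrightarrow> Ck_on k S (\<lambda>x. c *\<^sub>R f x)"
  by (rule Ck_on_compose_bounded_linear[OF bounded_linear_scaleR_right])

lemma smooth_onD: "smooth_on S f \<Longrightarrow> Ck_on k S f"
  by (simp add: smooth_on_def)

lemma bounded_bilinear_cross3: "bounded_bilinear cross3"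
  using bilinear_cross bilinear_conv_bounded_bilinear by blast

lemma Ck_on_cross3:
  "open S \<Longrightarrow> Ck_on k S f \<Longrightarrow> Ck_on k S g \<Longrightarrow> Ck_on k S (\<lambda>x. cross3 (f x) (g x))"
  by (rule Ck_on_bilinear[OF bounded_bilinear_cross3])

lemma Ck_on_inner:
  "open S \<Longrightarrow> Ck_on k S f \<Longrightarrow> Ck_on k S g \<Longrightarrow> Ck_on k S (\<lambda>x. f x \<bullet> g x)"
  by (rule Ck_on_bilinear[OF bounded_bilinear_inner])

lemma Ck_on_nth: "open S \<Longrightarrow> Ck_on k S f \<Longrightarrow> Ck_on k S (\<lambda>x. f x $ i)"
  by (rule Ck_on_compose_bounded_linear[OF bounded_linear_vec_nth])

section \<open>Uniform linearization and symmetry of second derivatives\<close>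

text \<open>
  On a compact set the error of linearization is uniform: the derivative is uniformly continuous on
  a slightly larger compact set, and the mean value inequality on segments converts this into a bound
  for the error.
\<close>

lemma Ck_on_uniform_linearization:
  fixes f :: "'a::euclidean_space \<Rightarrow> 'b::real_normed_vector"
  assumes "open S" "Ck_on (Suc 0) S f" "compact K" "K \<subseteq> S" "e > 0"
  obtains d where "d > 0"
    "\<And>x h. x \<in> K \<Longrightarrow> norm h < d \<Longrightarrow>
      norm (f (x + h) - f x - frechet_derivative f (at x) h) \<le> e * norm h"
proof -
  let ?D = "\<lambda>x. frechet_derivative f (at x)"
  obtain d0 where d0: "d0 > 0" "{x + y |x y. x \<in> K \<and> y \<in> cball 0 d0} \<subseteq> S"
  proof (cases "K = {}")
    case False
    have "closed (-S)" "K \<inter> -S = {}" using assms(1,4) by auto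
    then obtain d where d: "d > 0" "\<And>x y. x \<in> K \<Longrightarrow> y \<in> -S \<Longrightarrow> d \<le> dist x y"
      using separate_compact_closed[OF assms(3), of "-S"] by blast
    have "x + y \<in> S" if "x \<in> K" "norm y \<le> d/2" for x y
    proof (rule ccontr)
      assume "x + y \<notin> S"
      then have "d \<le> dist x (x + y)"
        using d(2) that(1) by blast
      then show False using that(2) d(1) by (simp add: dist_norm)
    qed
    then have "{x + y |x y. x \<in> K \<and> y \<in> cball 0 (d/2)} \<subseteq> S" by auto
    then show ?thesis using that[of "d/2"] d(1) by simp
  qed (use that[of 1] in auto)
  define K' where "K' = {x + y |x y. x \<in> K \<and> y \<in> cball 0 d0}"
  have K': "compact K'" "K' \<subseteq> S"
    unfolding K'_def using compact_sums[OF assms(3) compact_cball] d0(2) by blast+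
  define c where "c = e / (real DIM('a))"
  have c: "c > 0" using assms(5) by (simp add: c_def)
  have "\<exists>d>0. \<forall>x\<in>K'. \<forall>y\<in>K'. dist y x < d \<longrightarrow> dist (?D y b) (?D x b) < c" for b
  proof -
    have "continuous_on K' (\<lambda>x. ?D x b)"
      using assms(2) K'(2) by (auto intro: continuous_on_subset)
    then show ?thesis
      using compact_uniformly_continuous[OF _ K'(1)] c unfolding uniformly_continuous_on_def by blast
  qed
  then obtain dd where dd: "\<And>b. dd b > 0"
    "\<And>b x y. x \<in> K' \<Longrightarrow> y \<in> K' \<Longrightarrow> dist y x < dd b \<Longrightarrow> dist (?D y b) (?D x b) < c"
    by metis
  define d where "d = min d0 (Min (dd ` (Basis :: 'a set)))"
  have d: "d > 0" "d \<le> d0" "\<And>b. b \<in> Basis \<Longrightarrow> d \<le> dd b"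
    using dd(1) d0(1) by (auto simp: d_def min_le_iff_disj)
  show ?thesis
  proof (rule that[OF d(1)])
    fix x h :: 'a assume x: "x \<in> K" and h: "norm h < d"
    define T where "T = (\<lambda>t. x + t *\<^sub>R h) ` {0..1}"
    have TK: "T \<subseteq> K'"
    proof
      fix y assume "y \<in> T"
      then obtain t where "y = x + t *\<^sub>R h" "t \<in> {0..1}" unfolding T_def by (rule imageE)
      then have t: "y = x + t *\<^sub>R h" "0 \<le> t" "t \<le> 1" by simp_all
      have "norm (t *\<^sub>R h) \<le> norm h" using t by (simp add: mult_left_le_one_le)
      then have "norm (t *\<^sub>R h) \<le> d0" using h d(2) by linarith
      then have "t *\<^sub>R h \<in> cball 0 d0" by simp
      then show "y \<in> K'" unfolding K'_def t(1) using x
        by (intro CollectI exI[of _ x] exI[of _ "t *\<^sub>R h"]) simp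
    qed
    have xT: "x \<in> T" unfolding T_def by (rule image_eqI[of _ _ 0]) auto
    have on: "onorm (?D y - ?D x) \<le> e" if "y \<in> T" for y
    proof (rule onorm_le)
      fix v
      have y: "y \<in> K'" "x \<in> K'" using TK that xT by blast+
      have "dist y x < d"
        unfolding dist_norm
      proof -
        from \<open>y \<in> T\<close> obtain t where "y = x + t *\<^sub>R h" "t \<in> {0..1}"
          unfolding T_def by (rule imageE)
        then show "norm (y - x) < d" using h mult_left_le_one_le[of "norm h" t] by simp
      qed
      then have *: "norm (?D y b - ?D x b) \<le> c" if "b \<in> Basis" for b
        using dd(2)[OF y(2) y(1), of b] d(3)[OF that] by (simp add: dist_norm)
      have hd: "(f has_derivative ?D y) (at y)" "(f has_derivative ?D x) (at x)"
        using y K' by (auto intro: Ck_on_Suc_has_derivative[OF assms(2)])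
      have "(?D y - ?D x) v = (\<Sum>b\<in>Basis. (v \<bullet> b) *\<^sub>R (?D y b - ?D x b))"
        unfolding minus_apply scaleR_diff_right sum_subtractf
        by (intro arg_cong2[of _ _ _ _ "(-)"] has_derivative_basis_expansion[OF hd(1)]
            has_derivative_basis_expansion[OF hd(2)])
      also have "norm \<dots> \<le> (\<Sum>b\<in>(Basis::'a set). norm v * c)"
      proof (rule order_trans[OF norm_sum sum_mono])
        fix b :: 'a assume b: "b \<in> Basis"
        show "norm ((v \<bullet> b) *\<^sub>R (?D y b - ?D x b)) \<le> norm v * c"
          unfolding norm_scaleR using Basis_le_norm[OF b] *[OF b] by (intro mult_mono) auto
      qed
      also have "\<dots> = e * norm v" by (simp add: c_def)
      finally show "norm ((?D y - ?D x) v) \<le> e * norm v" .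
    qed
    have seg: "x + t *\<^sub>R (x + h - x) \<in> T" if "t \<in> {0..1}" for t
      using that unfolding T_def add_diff_cancel_left' by (rule imageI)
    have der: "(f has_derivative ?D y) (at y within T)" if "y \<in> T" for y
    proof (rule has_derivative_at_withinI[OF Ck_on_Suc_has_derivative[OF assms(2)]])
      show "y \<in> S" using TK K'(2) that by blast
    qed
    show "norm (f (x + h) - f x - ?D x h) \<le> e * norm h"
      using differentiable_bound_linearization[OF seg der on xT] by (simp only: add_diff_cancel_left' mult.commute)
  qed
qed

text \<open>
  The second difference of \<open>f\<close> over a small parallelogram is symmetric in its two sides.  Two
  applications of the mean value theorem show that it equals \<open>h\<^sup>2\<close> times either mixed derivative,
  at nearby points; continuity does the rest.
\<close>

lemma Ck_on_second_derivative_symmetric_real: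
  fixes f :: "'a::euclidean_space \<Rightarrow> real"
  assumes "open S" "Ck_on (Suc (Suc 0)) S f" "p \<in> S"
  shows "frechet_derivative (\<lambda>x. frechet_derivative f (at x) u) (at p) v
       = frechet_derivative (\<lambda>x. frechet_derivative f (at x) v) (at p) u"
proof -
  define D where "D u x = frechet_derivative f (at x) u" for u x
  define DD where "DD u v x = frechet_derivative (D u) (at x) v" for u v x
  have f: "(f has_derivative (\<lambda>u. D u x)) (at x)" if "x \<in> S" for x
    unfolding D_def using Ck_on_Suc_has_derivative[OF assms(2) that] by simp
  have Df: "(D u has_derivative (\<lambda>v. DD u v x)) (at x)" if "x \<in> S" for u x
  proof -
    have "Ck_on (Suc 0) S (D u)" using assms(2) unfolding D_def by auto
    from Ck_on_Suc_has_derivative[OF this that] show ?thesis unfolding DD_def by simp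
  qed
  have cont: "continuous_on S (DD u v)" for u v
    using assms(2) unfolding DD_def D_def by auto
  have mv: "\<exists>s t. 0 < s \<and> s < h \<and> 0 < t \<and> t < h \<and>
      f (p + h *\<^sub>R u + h *\<^sub>R v) - f (p + h *\<^sub>R u) - f (p + h *\<^sub>R v) + f p
        = h * h * DD u v (p + s *\<^sub>R u + t *\<^sub>R v)"
    if h: "h > 0" and sub: "\<And>s t. 0 \<le> s \<Longrightarrow> s \<le> h \<Longrightarrow> 0 \<le> t \<Longrightarrow> t \<le> h \<Longrightarrow> p + s *\<^sub>R u + t *\<^sub>R v \<in> S"
    for u v h
  proof -
    define g where "g s = f (p + s *\<^sub>R u + h *\<^sub>R v) - f (p + s *\<^sub>R u)" for s
    have g: "(g has_derivative (\<lambda>k. k * (D u (p + s *\<^sub>R u + h *\<^sub>R v) - D u (p + s *\<^sub>R u)))) (at s)"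
      if "0 \<le> s" "s \<le> h" for s
    proof -
      have 1: "((\<lambda>s. p + s *\<^sub>R u + h *\<^sub>R v) has_derivative (\<lambda>k. k *\<^sub>R u)) (at s)"
        "((\<lambda>s. p + s *\<^sub>R u) has_derivative (\<lambda>k. k *\<^sub>R u)) (at s)"
        by (auto intro!: derivative_eq_intros)
      have 2: "p + s *\<^sub>R u + h *\<^sub>R v \<in> S" "p + s *\<^sub>R u \<in> S"
        using sub[of s h] sub[of s 0] that h by auto
      have lin: "D (k *\<^sub>R u) x = k * D u x" if "x \<in> S" for k x
        using linear_cmul[OF has_derivative_linear[OF f[OF that]]] by simp
      show ?thesis unfolding g_def
        by (rule has_derivative_eq_rhs[OF has_derivative_diff[OF
              has_derivative_compose[OF 1(1) f[OF 2(1)]] has_derivative_compose[OF 1(2) f[OF 2(2)]]]])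
          (simp add: lin 2 right_diff_distrib)
    qed
    have "continuous_on {0..h} g"
      by (rule continuous_at_imp_continuous_on) (use g has_derivative_continuous in force)
    from mvt[OF h this g] obtain s where s: "0 < s" "s < h"
      "g h - g 0 = h * (D u (p + s *\<^sub>R u + h *\<^sub>R v) - D u (p + s *\<^sub>R u))"
      by (metis diff_zero less_imp_le)
    define k where "k t = D u (p + s *\<^sub>R u + t *\<^sub>R v)" for t
    have k: "(k has_derivative (\<lambda>l. l * DD u v (p + s *\<^sub>R u + t *\<^sub>R v))) (at t)"
      if "0 \<le> t" "t \<le> h" for t
    proof -
      have 1: "((\<lambda>t. p + s *\<^sub>R u + t *\<^sub>R v) has_derivative (\<lambda>k. k *\<^sub>R v)) (at t)"
        by (auto intro!: derivative_eq_intros)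
      have 2: "p + s *\<^sub>R u + t *\<^sub>R v \<in> S" using sub[of s t] that s by auto
      show ?thesis unfolding k_def
        by (rule has_derivative_eq_rhs[OF has_derivative_compose[OF 1 Df[OF 2]]])
          (use linear_cmul[OF has_derivative_linear[OF Df[OF 2]]] in simp)
    qed
    have "continuous_on {0..h} k"
      by (rule continuous_at_imp_continuous_on) (use k has_derivative_continuous in force)
    from mvt[OF h this k] obtain t where t: "0 < t" "t < h"
      "k h - k 0 = h * DD u v (p + s *\<^sub>R u + t *\<^sub>R v)"
      by (metis diff_zero less_imp_le)
    have "f (p + h *\<^sub>R u + h *\<^sub>R v) - f (p + h *\<^sub>R u) - f (p + h *\<^sub>R v) + f p = g h - g 0"
      by (simp add: g_def)
    also have "\<dots> = h * (k h - k 0)" using s(3) by (simp add: k_def)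
    finally show ?thesis using s t by auto
  qed
  have "\<bar>DD u v p - DD v u p\<bar> \<le> 0 + e" if e: "e > 0" for e
  proof -
    obtain d where d: "d > 0" "ball p d \<subseteq> S"
      "\<And>x. x \<in> ball p d \<Longrightarrow> \<bar>DD u v x - DD u v p\<bar> < e/2"
      "\<And>x. x \<in> ball p d \<Longrightarrow> \<bar>DD v u x - DD v u p\<bar> < e/2"
    proof -
      obtain d0 where "d0 > 0" "ball p d0 \<subseteq> S" using assms(1,3) openE by blast
      moreover have "\<exists>d1>0. \<forall>x\<in>S. dist x p < d1 \<longrightarrow> dist (DD a b x) (DD a b p) < e/2" for a b
        using cont[of a b] assms(3) e unfolding continuous_on_iff by (meson half_gt_zero)
      then obtain d1 d2 where "d1 > 0" "d2 > 0"
        "\<forall>x\<in>S. dist x p < d1 \<longrightarrow> dist (DD u v x) (DD u v p) < e/2"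
        "\<forall>x\<in>S. dist x p < d2 \<longrightarrow> dist (DD v u x) (DD v u p) < e/2" by metis
      ultimately show ?thesis
        by (intro that[of "min d0 (min d1 d2)"]) (auto simp: dist_commute dist_real_def subset_iff)
    qed
    define h where "h = d / (2 * (norm u + norm v + 1))"
    have h: "h > 0" using d(1) by (auto simp: h_def add_nonneg_pos intro!: divide_pos_pos)
    have near: "p + s *\<^sub>R a + t *\<^sub>R b \<in> ball p d"
      if "0 \<le> s" "s \<le> h" "0 \<le> t" "t \<le> h" "norm a + norm b = norm u + norm v" for s t a b
    proof -
      have "norm (s *\<^sub>R a + t *\<^sub>R b) \<le> s * norm a + t * norm b"
        using norm_triangle_ineq[of "s *\<^sub>R a" "t *\<^sub>R b"] that by simp
      also have "\<dots> \<le> h * norm a + h * norm b"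
        using that by (intro add_mono mult_right_mono) auto
      also have "\<dots> = h * (norm u + norm v)" using that by (metis distrib_left)
      also have "\<dots> < h * (2 * (norm u + norm v + 1))"
        using h norm_ge_zero[of u] norm_ge_zero[of v]
        by (intro mult_strict_left_mono) (simp_all add: add_nonneg_pos)
      also have "\<dots> = d"
      proof -
        have "2 * (norm u + norm v + 1) > 0" by (simp add: add_nonneg_pos)
        then show ?thesis unfolding h_def by simp
      qed
      finally show ?thesis by (simp add: dist_norm add.assoc norm_minus_cancel[of "s *\<^sub>R a + t *\<^sub>R b", symmetric]
            del: norm_minus_cancel)
    qed
    obtain s t where st: "0 < s" "s < h" "0 < t" "t < h"
      "f (p + h *\<^sub>R u + h *\<^sub>R v) - f (p + h *\<^sub>R u) - f (p + h *\<^sub>R v) + f p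
        = h * h * DD u v (p + s *\<^sub>R u + t *\<^sub>R v)"
      using mv[OF h, of u v] near[of _ _ u v] d(2) by blast
    obtain s' t' where st': "0 < s'" "s' < h" "0 < t'" "t' < h"
      "f (p + h *\<^sub>R v + h *\<^sub>R u) - f (p + h *\<^sub>R v) - f (p + h *\<^sub>R u) + f p
        = h * h * DD v u (p + s' *\<^sub>R v + t' *\<^sub>R u)"
      using mv[OF h, of v u] near[of _ _ v u, OF _ _ _ _ add.commute] d(2) by blast
    have "h * h * DD u v (p + s *\<^sub>R u + t *\<^sub>R v) = h * h * DD v u (p + s' *\<^sub>R v + t' *\<^sub>R u)"
      using st(5) st'(5) by (simp add: algebra_simps)
    then have "DD u v (p + s *\<^sub>R u + t *\<^sub>R v) = DD v u (p + s' *\<^sub>R v + t' *\<^sub>R u)" using h by simp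
    moreover have "\<bar>DD u v (p + s *\<^sub>R u + t *\<^sub>R v) - DD u v p\<bar> < e/2"
      using d(3)[OF near[of s t u v]] st by auto
    moreover have "\<bar>DD v u (p + s' *\<^sub>R v + t' *\<^sub>R u) - DD v u p\<bar> < e/2"
      using d(4)[OF near[of s' t' v u]] st' by auto
    ultimately show ?thesis by linarith
  qed
  then have "\<bar>DD u v p - DD v u p\<bar> \<le> 0" by (rule field_le_epsilon)
  then show ?thesis by (simp add: DD_def D_def[abs_def])
qed

lemma directional_derivative_component:
  fixes f :: "'a::euclidean_space \<Rightarrow> 'b::euclidean_space"
  assumes "open S" "Ck_on (Suc 0) S f" "x \<in> S"
  shows "frechet_derivative (\<lambda>x. f x \<bullet> c) (at x) v = frechet_derivative f (at x) v \<bullet> c"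
  using frechet_derivative_at[OF has_derivative_inner_left[OF Ck_on_Suc_has_derivative[OF assms(2,3)], of c]]
  by metis

lemma Ck_on_second_derivative_symmetric:
  fixes f :: "'a::euclidean_space \<Rightarrow> 'b::euclidean_space"
  assumes S: "open S" "Ck_on (Suc (Suc 0)) S f" "p \<in> S"
  shows "frechet_derivative (\<lambda>x. frechet_derivative f (at x) u) (at p) v
       = frechet_derivative (\<lambda>x. frechet_derivative f (at x) v) (at p) u"
proof (rule euclidean_eqI)
  fix c :: 'b
  let ?D = "\<lambda>u x. frechet_derivative f (at x) u" and ?d = "\<lambda>u x. frechet_derivative (\<lambda>x. f x \<bullet> c) (at x) u"
  have 1: "frechet_derivative (?D u) (at p) v \<bullet> c = frechet_derivative (?d u) (at p) v" for u v
  proof -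
    have D: "Ck_on (Suc 0) S (?D u)" by (rule Ck_on_directional_derivative[OF S(2)])
    have "((\<lambda>x. ?D u x \<bullet> c) has_derivative (\<lambda>v. frechet_derivative (?D u) (at p) v \<bullet> c)) (at p)"
      by (rule has_derivative_inner_left[OF Ck_on_Suc_has_derivative[OF D S(3)]])
    then have "(?d u has_derivative (\<lambda>v. frechet_derivative (?D u) (at p) v \<bullet> c)) (at p)"
      by (rule has_derivative_transform_within_open[OF _ S(1,3)])
        (simp add: directional_derivative_component[OF S(1) Ck_on_SucD[OF S(2)]])
    from frechet_derivative_at[OF this] show ?thesis by metis
  qed
  have "Ck_on (Suc (Suc 0)) S (\<lambda>x. f x \<bullet> c)" by (rule Ck_on_inner_left[OF S(1,2)])
  from Ck_on_second_derivative_symmetric_real[OF S(1) this S(3), of u v]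
  show "frechet_derivative (?D u) (at p) v \<bullet> c = frechet_derivative (?D v) (at p) u \<bullet> c"
    by (simp only: 1)
qed

lemma compact_Ck_derivative_bound:
  fixes f :: "'a::euclidean_space \<Rightarrow> 'b::real_normed_vector"
  assumes "Ck_on (Suc 0) S f" "compact K" "K \<subseteq> S"
  obtains L where "L \<ge> 0" "\<And>y v. y \<in> K \<Longrightarrow> norm (frechet_derivative f (at y) v) \<le> L * norm v"
proof -
  let ?D = "\<lambda>y. frechet_derivative f (at y)"
  have "\<exists>c\<ge>0. \<forall>y\<in>K. norm (?D y b) \<le> c" for b
  proof -
    have "continuous_on K (\<lambda>y. ?D y b)"
      by (rule continuous_on_subset[OF Ck_on_imp_continuous_on[OF Ck_on_directional_derivative[OF assms(1)]] assms(3)])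
    then have "bounded ((\<lambda>y. ?D y b) ` K)" by (intro compact_imp_bounded compact_continuous_image assms(2))
    then show ?thesis unfolding bounded_pos by (metis imageI less_imp_le)
  qed
  then obtain c where c: "\<And>b. c b \<ge> 0" "\<And>b y. y \<in> K \<Longrightarrow> norm (?D y b) \<le> c b" by metis
  show ?thesis
  proof (rule that)
    show "(\<Sum>b\<in>(Basis::'a set). c b) \<ge> 0" by (intro sum_nonneg c(1))
    fix y v assume y: "y \<in> K"
    have hd: "(f has_derivative ?D y) (at y)"
      by (rule Ck_on_Suc_has_derivative[OF assms(1)]) (use y assms(3) in blast)
    have "?D y v = (\<Sum>b\<in>Basis. (v \<bullet> b) *\<^sub>R ?D y b)" by (rule has_derivative_basis_expansion[OF hd])
    also have "norm \<dots> \<le> (\<Sum>b\<in>(Basis::'a set). norm v * c b)"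
    proof (rule order_trans[OF norm_sum sum_mono])
      fix b :: 'a assume "b \<in> Basis"
      then show "norm ((v \<bullet> b) *\<^sub>R ?D y b) \<le> norm v * c b"
        unfolding norm_scaleR using Basis_le_norm c(2)[OF y, of b] by (intro mult_mono) auto
    qed
    also have "\<dots> = (\<Sum>b\<in>Basis. c b) * norm v" by (simp add: sum_distrib_left mult.commute)
    finally show "norm (?D y v) \<le> (\<Sum>b\<in>Basis. c b) * norm v" .
  qed
qed

section \<open>Smooth dependence of differential equations on parameters\<close>

text \<open>
  Time is rescaled to the unit interval: the solution is the fixed point of
  \<open>w (p, t) \<mapsto> t \<integral>\<^sub>0\<^sup>1 F ((p, t s), w (p, t s)) ds\<close>.  A fixed domain of integration makes
  joint continuity in \<open>(p, t)\<close> immediate and treats positive and negative times alike.  Clamping \<open>t\<close> to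
  \<open>[-T, T]\<close> turns this into a contraction of the bounded continuous functions on the whole space.
\<close>

lemma ODE_solution_exists:
  fixes F :: "('p::euclidean_space \<times> real) \<times> 'u::euclidean_space \<Rightarrow> 'u"
  assumes cont: "continuous_on UNIV F"
    and lip: "\<And>q u v. norm (F (q, u) - F (q, v)) \<le> L * norm (u - v)"
    and bd: "\<And>q. norm (F (q, 0)) \<le> C"
    and T: "T > 0" "L \<ge> 0" "T * L < 1"
  obtains w :: "'p \<times> real \<Rightarrow> 'u" where "continuous_on UNIV w" "\<And>p. w (p, 0) = 0"
    "\<And>p t. \<bar>t\<bar> < T \<Longrightarrow> ((\<lambda>t. w (p, t)) has_vector_derivative F ((p, t), w (p, t))) (at t)"
proof -
  define \<tau> where "\<tau> t = max (-T) (min T t)" for t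
  have \<tau>: "\<bar>\<tau> t\<bar> \<le> T" for t using T by (auto simp: \<tau>_def)
  have \<tau>_cont: "continuous_on S \<tau>" for S unfolding \<tau>_def[abs_def] by (intro continuous_intros)
  have \<tau>_id: "\<tau> t = t" if "\<bar>t\<bar> \<le> T" for t using that by (auto simp: \<tau>_def)
  define I where "I w q s = F ((fst q, \<tau> (snd q) * s), w (fst q, \<tau> (snd q) * s))"
    for w :: "'p \<times> real \<Rightarrow> 'u" and q :: "'p \<times> real" and s
  define \<Phi> where "\<Phi> w q = \<tau> (snd q) *\<^sub>R integral {0..1} (I w q)" for w and q :: "'p \<times> real"
  have I_cont2: "continuous_on UNIV (\<lambda>(q, s). I w q s)" if w: "continuous_on UNIV w" for w
  proof -
    have 1: "continuous_on UNIV (\<lambda>x::('p \<times> real) \<times> real. (fst (fst x), \<tau> (snd (fst x)) * snd x))"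
      by (intro continuous_intros continuous_on_compose2[OF \<tau>_cont[of UNIV]]) auto
    show ?thesis unfolding I_def split_beta
      by (intro continuous_on_compose2[OF cont] continuous_on_Pair 1
          continuous_on_compose2[OF w 1]) auto
  qed
  have I_int: "I w q integrable_on {0..1}" if w: "continuous_on UNIV w" for w q
  proof (rule integrable_continuous_real)
    have "continuous_on {0..1} (\<lambda>s. (\<lambda>(q, s). I w q s) (q, s))"
      by (rule continuous_on_compose2[OF I_cont2[OF w]]) (auto intro: continuous_intros)
    then show "continuous_on {0..1} (I w q)" by simp
  qed
  have \<Phi>_cont: "continuous_on UNIV (\<Phi> w)" if w: "continuous_on UNIV w" for w
  proof -
    have "continuous_on UNIV (\<lambda>q. integral (cbox 0 1) (I w q))"
      by (rule integral_continuous_on_param) (rule continuous_on_subset[OF I_cont2[OF w]], auto)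
    then show ?thesis unfolding \<Phi>_def[abs_def]
      by (intro continuous_intros continuous_on_compose2[OF \<tau>_cont[of UNIV]]) auto
  qed
  have \<Phi>_bd: "norm (\<Phi> w q) \<le> T * (C + L * B)"
    if w: "continuous_on UNIV w" and B: "\<And>q. norm (w q) \<le> B" for w q B
  proof -
    have "norm (I w q s) \<le> C + L * B" for s
    proof -
      let ?q = "(fst q, \<tau> (snd q) * s)"
      have "norm (F (?q, w ?q) - F (?q, 0)) \<le> L * norm (w ?q - 0)" by (rule lip)
      also have "\<dots> \<le> L * B" using B T by (auto intro: mult_left_mono)
      finally show ?thesis unfolding I_def
        using bd[of ?q] norm_triangle_sub[of "F (?q, w ?q)" "F (?q, 0)"] by linarith
    qed
    then have "norm (integral {0..1} (I w q)) \<le> integral {0..1} (\<lambda>s::real. C + L * B)"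
      by (intro integral_norm_bound_integral I_int w) auto
    then have "norm (integral {0..1} (I w q)) \<le> C + L * B" by simp
    then show ?thesis unfolding \<Phi>_def norm_scaleR using \<tau>[of "snd q"] T(1)
      by (intro mult_mono) auto
  qed
  define \<Psi> where "\<Psi> w = Bcontfun (\<Phi> (apply_bcontfun w))" for w :: "('p \<times> real) \<Rightarrow>\<^sub>C 'u"
  have \<Psi>: "apply_bcontfun (\<Psi> w) = \<Phi> (apply_bcontfun w)" for w
    unfolding \<Psi>_def
    by (rule Bcontfun_inverse, rule bcontfun_normI[OF \<Phi>_cont \<Phi>_bd[of _ "norm w"]])
      (auto intro: norm_bounded)
  have "\<exists>!w. \<Psi> w = w"
  proof (rule banach_fix_type[of "T * L"])
    show "\<forall>v w. dist (\<Psi> v) (\<Psi> w) \<le> T * L * dist v w"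
    proof (intro allI dist_bound)
      fix v w :: "('p \<times> real) \<Rightarrow>\<^sub>C 'u" and q
      let ?v = "apply_bcontfun v" and ?w = "apply_bcontfun w"
      have int: "I (apply_bcontfun w) q integrable_on {0..1}" for w :: "('p \<times> real) \<Rightarrow>\<^sub>C 'u"
        by (rule I_int) simp
      have "norm (integral {0..1} (\<lambda>s. I ?v q s - I ?w q s)) \<le> integral {0..1} (\<lambda>s::real. L * dist v w)"
      proof (intro integral_norm_bound_integral integrable_diff int)
        fix s :: real
        let ?q = "(fst q, \<tau> (snd q) * s)"
        have "norm (I ?v q s - I ?w q s) \<le> L * norm (?v ?q - ?w ?q)" unfolding I_def by (rule lip)
        also have "\<dots> \<le> L * dist v w"
          using dist_bounded[of v ?q w] T by (auto simp: dist_norm intro: mult_left_mono)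
        finally show "norm (I ?v q s - I ?w q s) \<le> L * dist v w" .
      qed auto
      then have *: "norm (integral {0..1} (I ?v q) - integral {0..1} (I ?w q)) \<le> L * dist v w"
        by (simp add: integral_diff[OF int int])
      have "dist (\<Psi> v q) (\<Psi> w q) = \<bar>\<tau> (snd q)\<bar> * norm (integral {0..1} (I ?v q) - integral {0..1} (I ?w q))"
        unfolding \<Psi> \<Phi>_def dist_norm by (simp flip: scaleR_diff_right)
      also have "\<dots> \<le> T * (L * dist v w)" using T by (intro mult_mono \<tau> *) auto
      finally show "dist (\<Psi> v q) (\<Psi> w q) \<le> T * L * dist v w" by simp
    qed
  qed (use T in auto)
  then obtain w where w: "\<Phi> (apply_bcontfun w) = apply_bcontfun w" using \<Psi> by metis
  let ?w = "apply_bcontfun w"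
  show ?thesis
  proof (rule that[of ?w])
    show "?w (p, 0) = 0" for p
      by (subst w[symmetric]) (simp add: \<Phi>_def \<tau>_id T less_imp_le)
    fix p t assume t: "\<bar>t\<bar> < T"
    let ?g = "\<lambda>s. F ((p, s), ?w (p, s))"
    have gc: "continuous_on {-T..T} ?g"
    proof -
      have "continuous_on {-T..T} (\<lambda>s. (p, s))" by (intro continuous_intros)
      then show ?thesis
        by (intro continuous_on_compose2[OF cont] continuous_on_Pair
            continuous_on_compose2[OF continuous_on_apply_bcontfun[of UNIV]]) auto
    qed
    obtain G where G: "\<And>s. s \<in> {-T..T} \<Longrightarrow> (G has_vector_derivative ?g s) (at s within {-T..T})"
      using antiderivative_continuous[OF gc] by blast
    have eq: "?w (p, s) = G s - G 0" if s: "\<bar>s\<bar> \<le> T" for s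
    proof -
      have sub: "(\<lambda>r. s * r) ` {0..1} \<subseteq> {-T..T}"
      proof clarsimp
        fix r :: real assume "0 \<le> r" "r \<le> 1"
        then have "\<bar>s * r\<bar> \<le> \<bar>s\<bar>" by (simp add: abs_mult mult_right_le_one_le)
        then show "- T \<le> s * r \<and> s * r \<le> T" using s by linarith
      qed
      have "((\<lambda>r. s *\<^sub>R ?g (s * r)) has_integral (G \<circ> (\<lambda>r. s * r)) 1 - (G \<circ> (\<lambda>r. s * r)) 0) {0..1}"
      proof (rule fundamental_theorem_of_calculus)
        fix r :: real assume r: "r \<in> {0..1}"
        show "(G \<circ> (\<lambda>r. s * r) has_vector_derivative s *\<^sub>R ?g (s * r)) (at r within {0..1})"
        proof (rule vector_diff_chain_within)
          show "((\<lambda>r. s * r) has_vector_derivative s) (at r within {0..1})"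
            by (auto intro!: derivative_eq_intros)
          show "(G has_vector_derivative ?g (s * r)) (at (s * r) within (\<lambda>r. s * r) ` {0..1})"
            by (rule has_vector_derivative_within_subset[OF G sub]) (use r sub in blast)
        qed
      qed simp
      from integral_unique[OF this]
      have "integral {0..1} (\<lambda>r. s *\<^sub>R ?g (s * r)) = G s - G 0" by (simp only: o_def mult_1_right mult_zero_right)
      moreover have "?w (p, s) = integral {0..1} (\<lambda>r. s *\<^sub>R ?g (s * r))"
        by (subst w[symmetric]) (simp add: \<Phi>_def I_def[abs_def] \<tau>_id s)
      ultimately show ?thesis by simp
    qed
    have "(G has_vector_derivative ?g t) (at t)"
      using G[of t] t by (simp add: at_within_Icc_at abs_less_iff)
    then have "((\<lambda>s. G s - G 0) has_vector_derivative ?g t) (at t)"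
      by (auto intro!: derivative_eq_intros)
    then show "((\<lambda>t. ?w (p, t)) has_vector_derivative ?g t) (at t)"
      by (rule has_vector_derivative_transform_within_open[of _ _ _ "{-T<..<T}"])
        (use t eq in auto)
  qed simp
qed

text \<open>
  A solution is normalized to vanish at time zero; initial values belong to the parameter \<open>p\<close>.
\<close>

definition parametrized_solution ::
  "'p set \<Rightarrow> real \<Rightarrow> (('p::real_normed_vector \<times> real) \<times> 'u::real_normed_vector \<Rightarrow> 'u) \<Rightarrow> ('p \<times> real \<Rightarrow> 'u) \<Rightarrow> bool"
where
  "parametrized_solution U T F u \<longleftrightarrow> continuous_on (U \<times> {-T<..<T}) u \<and> (\<forall>p\<in>U. u (p, 0) = 0) \<and>
     (\<forall>p\<in>U. \<forall>t\<in>{-T<..<T}. ((\<lambda>t. u (p, t)) has_vector_derivative F ((p, t), u (p, t))) (at t))"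

text \<open>
  The right-hand side of the linearized equation along \<open>u\<close>, solved by the derivative of \<open>u\<close> in the
  parameter direction \<open>b\<close>.
\<close>

definition variational_field ::
  "(('p::real_normed_vector \<times> real) \<times> 'u::real_normed_vector \<Rightarrow> 'u) \<Rightarrow> ('p \<times> real \<Rightarrow> 'u) \<Rightarrow> 'p
    \<Rightarrow> ('p \<times> real) \<times> 'u \<Rightarrow> 'u" where
  "variational_field F u b = (\<lambda>(q, w). frechet_derivative F (at (q, u q)) ((b, 0), w))"

lemma variational_field_expand:
  fixes F :: "('p::euclidean_space \<times> real) \<times> 'u::euclidean_space \<Rightarrow> 'u"
  assumes "(F has_derivative D) (at (q, u q))"
  shows "variational_field F u b (q, w) = D ((b, 0), 0) + (\<Sum>c\<in>Basis. (w \<bullet> c) *\<^sub>R D (0, c))"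
proof -
  have D: "frechet_derivative F (at (q, u q)) = D" using frechet_derivative_at[OF assms] by simp
  have lin: "linear D" using assms has_derivative_linear by blast
  have "D ((b, 0), w) = D ((b, 0), 0) + D (0, w)"
    using linear_add[OF lin, of "((b, 0), 0)" "(0, w)"] by simp
  moreover have "D (0, w) = (\<Sum>c\<in>Basis. (w \<bullet> c) *\<^sub>R D (0, c))"
  proof -
    have l2: "linear (\<lambda>w. D (0, w))"
      using linear_compose[of "\<lambda>w. (0, w)" D] lin
      by (simp add: o_def linear_iff)
    have "D (0, \<Sum>c\<in>Basis. (w \<bullet> c) *\<^sub>R c) = (\<Sum>c\<in>Basis. (w \<bullet> c) *\<^sub>R D (0, c))"
      using linear_sum[OF l2, of "\<lambda>c. (w \<bullet> c) *\<^sub>R c" Basis] linear_cmul[OF l2] by simp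
    then show ?thesis by (simp add: euclidean_representation)
  qed
  ultimately show ?thesis by (simp add: variational_field_def D)
qed

text \<open>
  The coefficients of the linear equation are only known near the given solution.  Composing them with
  a projection onto a compact box makes them global and bounded without changing them on the box.
\<close>

lemma variational_solution_exists:
  fixes F :: "('p::euclidean_space \<times> real) \<times> 'u::euclidean_space \<Rightarrow> 'u"
  assumes U: "cbox a c \<subseteq> U" "cbox a c \<noteq> {}" and T: "0 < T0" "T0 < T" "T * M < 1" "M \<ge> 0"
    and \<Omega>: "Ck_on (Suc 0) \<Omega> F" and sol: "parametrized_solution U T F u"
    and graph: "\<And>q. q \<in> U \<times> {-T<..<T} \<Longrightarrow> (q, u q) \<in> \<Omega>"
    and M: "\<And>q \<eta>. q \<in> U \<times> {-T<..<T} \<Longrightarrow> norm (frechet_derivative F (at (q, u q)) (0, \<eta>)) \<le> M * norm \<eta>"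
  obtains w where "parametrized_solution (box a c) T0 (variational_field F u b) w"
proof -
  let ?S = "U \<times> {-T<..<T}"
  \<comment> \<open>Continuous retraction of everything onto the compact set on which the coefficients are controlled.\<close>
  define \<kappa> :: "'p \<times> real \<Rightarrow> 'p \<times> real" where "\<kappa> q = (clamp a c (fst q), clamp (-T0) T0 (snd q))" for q
  let ?K = "cbox a c \<times> {-T0..T0}"
  have cl: "clamp a c x \<in> cbox a c" "clamp (-T0) T0 t \<in> {-T0..T0}" for x t
    using U(2) T clamp_in_interval[of a c x] clamp_in_interval[of "-T0" T0 t] box_ne_empty(1)[of a c]
    by auto
  have \<kappa>: "\<kappa> q \<in> ?K" for q using cl by (simp add: \<kappa>_def)
  have KS: "?K \<subseteq> ?S" using U T by auto
  have \<kappa>S: "\<kappa> q \<in> ?S" for q using \<kappa> KS by blast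
  have clc: "continuous_on UNIV (clamp a c)" "continuous_on UNIV (clamp (-T0) T0)"
    using clamp_continuous_on[OF continuous_on_id] by auto
  have \<kappa>_cont: "continuous_on UNIV \<kappa>" unfolding \<kappa>_def[abs_def]
    by (intro continuous_intros continuous_on_compose2[OF clc(1)] continuous_on_compose2[OF clc(2)]) auto
  have \<kappa>_id: "\<kappa> q = q" if "q \<in> ?K" for q using that T by (auto simp: \<kappa>_def clamp_cancel_cbox)
  let ?D = "\<lambda>q. frechet_derivative F (at (q, u q))"
  have D: "(F has_derivative ?D q) (at (q, u q))" if "q \<in> ?S" for q
    by (rule Ck_on_Suc_has_derivative[OF \<Omega> graph[OF that]])
  have D_cont: "continuous_on ?S (\<lambda>q. ?D q \<xi>)" for \<xi>
  proof -
    have "continuous_on \<Omega> (\<lambda>x. frechet_derivative F (at x) \<xi>)"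
      by (rule Ck_on_imp_continuous_on[OF Ck_on_directional_derivative[OF \<Omega>]])
    then show ?thesis
      by (rule continuous_on_compose2) (use sol graph in \<open>auto simp: parametrized_solution_def intro!: continuous_intros\<close>)
  qed
  define G where "G x = variational_field F u b (\<kappa> (fst x), snd x)" for x
  have G: "G (q, w) = ?D (\<kappa> q) ((b, 0), 0) + (\<Sum>c\<in>Basis. (w \<bullet> c) *\<^sub>R ?D (\<kappa> q) (0, c))" for q w
    unfolding G_def fst_conv snd_conv by (rule variational_field_expand) (rule D[OF \<kappa>S])
  have D\<kappa>: "continuous_on UNIV (\<lambda>x::('p \<times> real) \<times> 'u. ?D (\<kappa> (fst x)) \<xi>)" for \<xi>
  proof (rule continuous_on_compose2[OF D_cont[of \<xi>]])
    show "continuous_on UNIV (\<lambda>x::('p \<times> real) \<times> 'u. \<kappa> (fst x))"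
      by (rule continuous_on_compose2[OF \<kappa>_cont continuous_on_fst[OF continuous_on_id]]) simp
    show "range (\<lambda>x::('p \<times> real) \<times> 'u. \<kappa> (fst x)) \<subseteq> ?S" using \<kappa>S by blast
  qed
  have G_cont: "continuous_on UNIV G"
  proof -
    have "continuous_on UNIV (\<lambda>x. ?D (\<kappa> (fst x)) ((b, 0), 0) + (\<Sum>c\<in>Basis. (snd x \<bullet> c) *\<^sub>R ?D (\<kappa> (fst x)) (0, c)))"
      by (intro continuous_intros D\<kappa>)
    moreover have "G = (\<lambda>x. ?D (\<kappa> (fst x)) ((b, 0), 0) + (\<Sum>c\<in>Basis. (snd x \<bullet> c) *\<^sub>R ?D (\<kappa> (fst x)) (0, c)))"
      using G by (intro ext) (metis prod.collapse)
    ultimately show ?thesis by simp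
  qed
  have G_lip: "norm (G (q, v) - G (q, w)) \<le> M * norm (v - w)" for q v w
  proof -
    have "linear (?D (\<kappa> q))" using D[OF \<kappa>S] has_derivative_linear by blast
    from linear_diff[OF this, of "((b, 0), v)" "((b, 0), w)"]
    have "G (q, v) - G (q, w) = ?D (\<kappa> q) (0, v - w)"
      by (simp add: G_def variational_field_def zero_prod_def)
    then show ?thesis using M[OF \<kappa>S] by simp
  qed
  obtain C where C: "\<And>q. norm (G (q, 0)) \<le> C"
  proof -
    have "compact ?K" by (intro compact_Times compact_cbox compact_Icc)
    then have "bounded ((\<lambda>q. ?D q ((b, 0), 0)) ` ?K)"
      by (intro compact_imp_bounded compact_continuous_image continuous_on_subset[OF D_cont KS])
    then obtain C where C: "\<And>q. q \<in> ?K \<Longrightarrow> norm (?D q ((b, 0), 0)) \<le> C"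
      unfolding bounded_iff by blast
    show ?thesis
    proof (rule that)
      show "norm (G (q, 0)) \<le> C" for q unfolding G using C[OF \<kappa>[of q]] by simp
    qed
  qed
  have "T0 * M \<le> T * M" using T by (intro mult_right_mono) auto
  then have "T0 * M < 1" using T by linarith
  from ODE_solution_exists[OF G_cont G_lip C T(1,4) this]
  obtain w where w: "continuous_on UNIV w" "\<And>p. w (p, 0) = 0"
    "\<And>p t. \<bar>t\<bar> < T0 \<Longrightarrow> ((\<lambda>t. w (p, t)) has_vector_derivative G ((p, t), w (p, t))) (at t)" by blast
  have "G ((p, t), x) = variational_field F u b ((p, t), x)" if "p \<in> box a c" "t \<in> {-T0<..<T0}" for p t x
    using \<kappa>_id[of "(p, t)"] that box_subset_cbox[of a c] by (auto simp: G_def)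
  then have "((\<lambda>t. w (p, t)) has_vector_derivative variational_field F u b ((p, t), w (p, t))) (at t)"
    if "p \<in> box a c" "t \<in> {-T0<..<T0}" for p t
    using w(3)[of t p] that by (simp add: abs_less_iff)
  then have "parametrized_solution (box a c) T0 (variational_field F u b) w"
    unfolding parametrized_solution_def using w(2) continuous_on_subset[OF w(1)] by auto
  then show ?thesis by (rule that)
qed

text \<open>
  Let \<open>E\<close> be the difference between an increment of \<open>u\<close> and its candidate linearization.  The uniform
  linearization of \<open>F\<close> along the solution bounds \<open>E'\<close> by a small multiple of \<open>norm v\<close> plus almost \<open>M\<close>
  times the supremum of \<open>E\<close>.  As \<open>T * M < 1\<close>, the mean value inequality absorbs this supremum, so
  that \<open>E\<close> is \<open>o(norm v)\<close>.
\<close>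

lemma solution_differentiable_in_parameter:
  fixes F :: "('p::euclidean_space \<times> real) \<times> 'u::euclidean_space \<Rightarrow> 'u"
  assumes U: "open U" "V \<subseteq> U" "p \<in> V" and t: "\<bar>t\<bar> < T0" and T: "T0 < T" "T * M < 1" "M \<ge> 0"
    and \<Omega>: "open \<Omega>" "Ck_on (Suc 0) \<Omega> F" and sol: "parametrized_solution U T F u"
    and graph: "\<And>q. q \<in> U \<times> {-T<..<T} \<Longrightarrow> (q, u q) \<in> \<Omega>"
    and M: "\<And>q \<eta>. q \<in> U \<times> {-T<..<T} \<Longrightarrow> norm (frechet_derivative F (at (q, u q)) (0, \<eta>)) \<le> M * norm \<eta>"
    and w: "\<And>b. parametrized_solution V T0 (variational_field F u b) (w b)"
  shows "((\<lambda>p. u (p, t)) has_derivative (\<lambda>v. \<Sum>b\<in>Basis. (v \<bullet> b) *\<^sub>R w b (p, t))) (at p)"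
proof -
  define I where "I = {-\<bar>t\<bar>..\<bar>t\<bar>}"
  have I: "compact I" "0 \<in> I" "t \<in> I" "convex I" "\<And>s. s \<in> I \<Longrightarrow> s \<in> {-T0<..<T0}" "\<And>s. s \<in> I \<Longrightarrow> s \<in> {-T<..<T}"
    using t T by (auto simp: I_def)
  have T0: "T > 0" using t T by linarith
  have pU: "p \<in> U" using U by auto
  let ?D = "\<lambda>s. frechet_derivative F (at ((p, s), u (p, s)))"
  define W where "W s v = (\<Sum>b\<in>Basis. (v \<bullet> b) *\<^sub>R w b (p, s))" for s v
  have D: "(F has_derivative ?D s) (at ((p, s), u (p, s)))" if "s \<in> I" for s
    by (rule Ck_on_Suc_has_derivative[OF \<Omega>(2) graph]) (use that I pU in auto)
  have u_cont: "continuous_on (U \<times> {-T<..<T}) u" using sol by (auto simp: parametrized_solution_def)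
  have us_cont: "continuous_on I (\<lambda>s. u (p, s))"
    by (rule continuous_on_compose2[OF u_cont]) (use I pU in \<open>auto intro!: continuous_intros\<close>)
  have w_cont: "continuous_on I (\<lambda>s. w b (p, s))" for b
  proof (rule continuous_on_compose2[where g = "w b"])
    show "continuous_on (V \<times> {-T0<..<T0}) (w b)" using w by (auto simp: parametrized_solution_def)
  qed (use I U in \<open>auto intro!: continuous_intros\<close>)
  have "\<exists>c\<ge>0. \<forall>s\<in>I. norm (w b (p, s)) \<le> c" for b
  proof -
    have "bounded ((\<lambda>s. w b (p, s)) ` I)" by (intro compact_imp_bounded compact_continuous_image w_cont I)
    then show ?thesis unfolding bounded_pos by (metis imageI less_imp_le)
  qed
  then obtain cb where cb: "\<And>b. cb b \<ge> 0" "\<And>b s. s \<in> I \<Longrightarrow> norm (w b (p, s)) \<le> cb b" by metis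
  define C where "C = (\<Sum>b\<in>(Basis::'p set). cb b)"
  have C0: "C \<ge> 0" unfolding C_def by (intro sum_nonneg cb)
  have C: "norm (W s v) \<le> C * norm v" if "s \<in> I" for s v
  proof -
    have "norm (W s v) \<le> (\<Sum>b\<in>(Basis::'p set). norm v * cb b)"
      unfolding W_def by (rule order_trans[OF norm_sum sum_mono])
        (auto intro!: mult_mono cb that simp: Basis_le_norm)
    then show ?thesis by (simp add: C_def sum_distrib_left mult.commute)
  qed
  define K where "K = (\<lambda>s. ((p, s), u (p, s))) ` I"
  have K: "compact K" "K \<subseteq> \<Omega>"
    unfolding K_def using graph pU I
    by (auto intro!: compact_continuous_image continuous_intros us_cont I)
  obtain r where r: "r > 0" "cball p r \<subseteq> U" using U(1) pU open_contains_cball by blast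
  define m where "m = 1 - T * M"
  have m: "m > 0" using T by (simp add: m_def)
  have bl: "bounded_linear (\<lambda>v. \<Sum>b\<in>Basis. (v \<bullet> b) *\<^sub>R w b (p, t))"
    by (intro bounded_linear_sum bounded_linear_scaleR_const bounded_linear_inner_left)
  have "\<exists>\<delta>>0. \<forall>v. norm v < \<delta> \<longrightarrow> norm (u (p + v, t) - u (p, t) - W t v) \<le> e * norm v" if e: "e > 0" for e
  proof -
    \<comment> \<open>Small enough for \<open>T * (e0 + M) < 1\<close> to persist and for the error to stay below \<open>e\<close>.\<close>
    define e0 where "e0 = min (m / (2 * T)) (e * m / (2 * T * (1 + C)))"
    have e0: "e0 > 0" using m e C0 T0 by (auto simp: e0_def intro!: divide_pos_pos mult_pos_pos)
    have e01: "T * (e0 + M) \<le> 1 - m / 2"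
    proof -
      have "T * e0 \<le> T * (m / (2 * T))" using T0 by (intro mult_left_mono) (auto simp: e0_def)
      moreover have "T * (m / (2 * T)) = m / 2" using T0 by simp
      ultimately have "T * e0 \<le> m / 2" by linarith
      then show ?thesis by (simp add: m_def distrib_left field_simps)
    qed
    have e02: "T * (e0 * (1 + C)) \<le> e * (m / 2)"
    proof -
      have "T * (e0 * (1 + C)) \<le> T * ((e * m / (2 * T * (1 + C))) * (1 + C))"
        using T0 C0 by (intro mult_left_mono mult_right_mono) (auto simp: e0_def)
      also have "\<dots> = e * (m / 2)"
      proof -
        have *: "T * (x / (2 * T * y) * y) = x / 2" if "y \<noteq> 0" for x y :: real
          using that T0 by simp
        have "1 + C \<noteq> 0" using C0 by simp
        from *[OF this, of "e * m"] show ?thesis by (simp only: times_divide_eq_right)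
      qed
      finally show ?thesis .
    qed
    obtain d where d: "d > 0" "\<And>x h. x \<in> K \<Longrightarrow> norm h < d \<Longrightarrow>
        norm (F (x + h) - F x - frechet_derivative F (at x) h) \<le> e0 * norm h"
      using Ck_on_uniform_linearization[OF \<Omega> K e0] by blast
    obtain d2 where d2: "d2 > 0" "\<And>s v. s \<in> I \<Longrightarrow> norm v < d2 \<Longrightarrow> norm v \<le> r \<Longrightarrow> norm (u (p + v, s) - u (p, s)) < d / 2"
    proof -
      have "uniformly_continuous_on (cball p r \<times> I) u"
        using r I by (intro compact_uniformly_continuous continuous_on_subset[OF u_cont] compact_Times) auto
      then obtain d2 where d2: "d2 > 0" "\<And>x x'. x \<in> cball p r \<times> I \<Longrightarrow> x' \<in> cball p r \<times> I \<Longrightarrow> dist x' x < d2 \<Longrightarrow> dist (u x') (u x) < d / 2"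
        unfolding uniformly_continuous_on_def using d(1) by (meson half_gt_zero)
      show ?thesis
      proof (rule that[OF d2(1)])
        fix s and v :: 'p assume "s \<in> I" "norm v < d2" "norm v \<le> r"
        then show "norm (u (p + v, s) - u (p, s)) < d / 2"
          using d2(2)[of "(p, s)" "(p + v, s)"] r by (simp add: dist_norm dist_Pair_Pair)
      qed
    qed
    define \<delta> where "\<delta> = min (d / 2) (min d2 r)"
    have "norm (u (p + v, t) - u (p, t) - W t v) \<le> e * norm v" if v: "norm v < \<delta>" for v
    proof -
      have v': "norm v < d / 2" "norm v < d2" "norm v \<le> r" using v by (auto simp: \<delta>_def)
      have pv: "p + v \<in> U" using r(2) v'(3) by (auto simp: dist_norm subset_iff)
      define \<Delta> where "\<Delta> s = u (p + v, s) - u (p, s)" for s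
      define E :: "real \<Rightarrow> 'u" where "E s = \<Delta> s - W s v" for s
      define E' where "E' s = F ((p + v, s), u (p + v, s)) - F ((p, s), u (p, s)) - ?D s ((v, 0), W s v)" for s
      have E: "(E has_vector_derivative E' s) (at s)" if s: "s \<in> I" for s
      proof -
        have "((\<lambda>s. W s v) has_vector_derivative (\<Sum>b\<in>Basis. (v \<bullet> b) *\<^sub>R variational_field F u b ((p, s), w b (p, s)))) (at s)"
          unfolding W_def using w s I(5)[OF s] U(3)
          by (intro has_vector_derivative_sum) (auto intro!: derivative_eq_intros simp: parametrized_solution_def)
        also have "(\<Sum>b\<in>Basis. (v \<bullet> b) *\<^sub>R variational_field F u b ((p, s), w b (p, s))) = ?D s ((v, 0), W s v)"
        proof -
          have l: "linear (?D s)" using D[OF s] has_derivative_linear by blast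
          have "(\<Sum>b\<in>Basis. (v \<bullet> b) *\<^sub>R ?D s ((b, 0), w b (p, s))) = ?D s (\<Sum>b\<in>Basis. (v \<bullet> b) *\<^sub>R ((b, 0), w b (p, s)))"
            by (simp only: linear_sum[OF l] linear_cmul[OF l])
          also have "(\<Sum>b\<in>Basis. (v \<bullet> b) *\<^sub>R ((b, 0::real), w b (p, s))) = ((v, 0), W s v)"
            by (simp add: W_def prod_eq_iff fst_sum snd_sum euclidean_representation)
          finally show ?thesis by (simp add: variational_field_def)
        qed
        finally have "((\<lambda>s. W s v) has_vector_derivative ?D s ((v, 0), W s v)) (at s)" .
        then show ?thesis unfolding E_def[abs_def] \<Delta>_def E'_def
          using sol pv pU I(6)[OF s]
          by (intro has_vector_derivative_diff) (auto simp: parametrized_solution_def)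
      qed
      have "continuous_on I (\<lambda>s. norm (E s))"
        using E by (intro continuous_on_norm continuous_at_imp_continuous_on)
          (auto intro: has_vector_derivative_continuous)
      then obtain s1 where s1: "s1 \<in> I" "\<And>s. s \<in> I \<Longrightarrow> norm (E s) \<le> norm (E s1)"
        using continuous_attains_sup[OF I(1)] I(2) by (metis empty_iff)
      define R where "R = e0 * (1 + C) * norm v + (e0 + M) * norm (E s1)"
      have E'_bd: "norm (E' s) \<le> R" if s: "s \<in> I" for s
      proof -
        let ?x = "((p, s), u (p, s))" and ?h = "((v, 0 :: real), \<Delta> s)"
        have h: "norm ?h \<le> norm v + norm (\<Delta> s)" using norm_Pair_le[of "(v, 0::real)" "\<Delta> s"] by simp
        have "norm (\<Delta> s) < d / 2" unfolding \<Delta>_def using d2(2)[OF s v'(2,3)] .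
        then have "norm ?h < d" using h v'(1) by linarith
        then have 1: "norm (F (?x + ?h) - F ?x - ?D s ?h) \<le> e0 * norm ?h"
          using s by (intro d(2)) (auto simp: K_def)
        have l: "linear (?D s)" using D[OF s] has_derivative_linear by blast
        have 2: "E' s = (F (?x + ?h) - F ?x - ?D s ?h) + ?D s (0, E s)"
          using linear_diff[OF l, of ?h "((v, 0), W s v)"]
          by (simp add: E'_def \<Delta>_def E_def zero_prod_def)
        have 3: "norm (?D s (0, E s)) \<le> M * norm (E s)" using M[of "(p, s)"] pU I(6)[OF s] by simp
        have "norm (\<Delta> s) \<le> norm (E s) + C * norm v"
          using C[OF s, of v] norm_triangle_ineq[of "E s" "W s v"] by (simp add: E_def)
        then have "norm ?h \<le> (1 + C) * norm v + norm (E s)" using h by (simp add: distrib_right)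
        then have "e0 * norm ?h \<le> e0 * ((1 + C) * norm v + norm (E s))" using e0 by simp
        moreover have "norm (E' s) \<le> norm (F (?x + ?h) - F ?x - ?D s ?h) + norm (?D s (0, E s))"
          unfolding 2 by (rule norm_triangle_ineq)
        ultimately have "norm (E' s) \<le> e0 * ((1 + C) * norm v + norm (E s)) + M * norm (E s)"
          using 1 3 by linarith
        also have "\<dots> = e0 * (1 + C) * norm v + (e0 + M) * norm (E s)" by (simp add: algebra_simps)
        also have "\<dots> \<le> R" unfolding R_def using s1(2)[OF s] e0 T by (auto intro: mult_left_mono)
        finally show ?thesis .
      qed
      have R0: "R \<ge> 0" using E'_bd[OF I(2)] norm_ge_zero order_trans by blast
      have "E 0 = 0" using sol w pv pU U(3) by (auto simp: E_def \<Delta>_def W_def parametrized_solution_def)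
      moreover have "norm (E s1 - E 0) \<le> R * norm (s1 - 0)"
      proof (rule differentiable_bound[OF I(4)])
        show "(E has_derivative (\<lambda>k. k *\<^sub>R E' s)) (at s within I)" if "s \<in> I" for s
          using E[OF that] unfolding has_vector_derivative_def by (rule has_derivative_at_withinI)
        show "onorm (\<lambda>k. k *\<^sub>R E' s) \<le> R" if "s \<in> I" for s
          using E'_bd[OF that] by (intro onorm_le) (simp add: mult.commute[of R] mult_left_mono)
      qed (use s1 I in auto)
      ultimately have "norm (E s1) \<le> R * \<bar>s1\<bar>" by simp
      also have "\<dots> \<le> R * T" using R0 I(6)[OF s1(1)] by (intro mult_left_mono) auto
      also have "\<dots> = T * (e0 * (1 + C)) * norm v + T * (e0 + M) * norm (E s1)"
        by (simp add: R_def algebra_simps)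
      also have "\<dots> \<le> e * (m / 2) * norm v + (1 - m / 2) * norm (E s1)"
        using e01 e02 by (intro add_mono mult_right_mono) auto
      finally have "m / 2 * norm (E s1) \<le> m / 2 * (e * norm v)" by (simp add: algebra_simps)
      then have "norm (E s1) \<le> e * norm v" using m by simp
      then show ?thesis using s1(2)[OF I(3)] by (simp add: E_def \<Delta>_def)
    qed
    moreover have "\<delta> > 0" using d(1) d2(1) r(1) by (simp add: \<delta>_def)
    ultimately show ?thesis by blast
  qed
  then have "\<exists>\<delta>>0. \<forall>y. norm (y - p) < \<delta> \<longrightarrow>
      norm (u (y, t) - u (p, t) - W t (y - p)) \<le> e * norm (y - p)" if "e > 0" for e
    using that by (metis add.commute diff_add_cancel)
  then show ?thesis unfolding has_derivative_at_alt using bl by (simp add: W_def)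
qed

text \<open>
  The linearized equations are solved locally, on boxes in parameter space.  The local solutions agree
  with the partial derivatives of \<open>u\<close>, which are therefore globally defined solutions themselves.
\<close>

lemma solution_has_derivative:
  fixes F :: "('p::euclidean_space \<times> real) \<times> 'u::euclidean_space \<Rightarrow> 'u"
  assumes U: "open U" and T: "T > 0" "T * M < 1" "M \<ge> 0"
    and \<Omega>: "open \<Omega>" "Ck_on (Suc 0) \<Omega> F" and sol: "parametrized_solution U T F u"
    and graph: "\<And>q. q \<in> U \<times> {-T<..<T} \<Longrightarrow> (q, u q) \<in> \<Omega>"
    and M: "\<And>q \<eta>. q \<in> U \<times> {-T<..<T} \<Longrightarrow> norm (frechet_derivative F (at (q, u q)) (0, \<eta>)) \<le> M * norm \<eta>"
  obtains D where "\<And>b. b \<in> Basis \<Longrightarrow> parametrized_solution U T (variational_field F u b) (D b)"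
    "\<And>q. q \<in> U \<times> {-T<..<T} \<Longrightarrow>
       (u has_derivative (\<lambda>(v, \<tau>). (\<Sum>b\<in>Basis. (v \<bullet> b) *\<^sub>R D b q) + \<tau> *\<^sub>R F (q, u q))) (at q)"
proof -
  \<comment> \<open>\<open>good w q\<close>: the functions \<open>w b\<close> are the partial derivatives of \<open>u\<close> at \<open>q\<close>.\<close>
  define good where "good w q \<longleftrightarrow> (u has_derivative (\<lambda>(v, \<tau>). (\<Sum>b\<in>Basis. (v \<bullet> b) *\<^sub>R w b q) + \<tau> *\<^sub>R F (q, u q))) (at q)" for w q
  let ?S = "U \<times> {-T<..<T}"
  have oS: "open ?S" using U by (intro open_Times) auto
  have u_cont: "continuous_on ?S u" using sol by (auto simp: parametrized_solution_def)
  have F_cont: "continuous_on ?S (\<lambda>q. F (q, u q))"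
    by (rule continuous_on_compose2[OF Ck_on_imp_continuous_on[OF \<Omega>(2)]
          continuous_on_Pair[OF continuous_on_id u_cont]]) (use graph in blast)
  have loc: "\<exists>V T0 w. open V \<and> p0 \<in> V \<and> V \<subseteq> U \<and> \<bar>t0\<bar> < T0 \<and> T0 < T \<and>
      (\<forall>b. parametrized_solution V T0 (variational_field F u b) (w b)) \<and>
      (\<forall>q\<in>V \<times> {-T0<..<T0}. good w q)"
    if p0: "p0 \<in> U" and t0: "t0 \<in> {-T<..<T}" for p0 t0
  proof -
    obtain a c where ac: "cbox a c \<subseteq> U" "p0 \<in> box a c"
      by (rule open_contains_cbox[OF U p0])
    have ne: "cbox a c \<noteq> {}" and Vsub: "box a c \<subseteq> U" using ac box_subset_cbox[of a c] by auto
    define T0 where "T0 = (\<bar>t0\<bar> + T) / 2"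
    have T0: "\<bar>t0\<bar> < T0" "T0 < T" "0 < T0" using t0 by (auto simp: T0_def)
    have "\<exists>w. parametrized_solution (box a c) T0 (variational_field F u b) w" for b
      using variational_solution_exists[OF ac(1) ne T0(3,2) T(2,3) \<Omega>(2) sol graph M] by blast
    then obtain w where w: "\<And>b. parametrized_solution (box a c) T0 (variational_field F u b) (w b)" by metis
    have *: "good w q"
      if q: "q \<in> box a c \<times> {-T0<..<T0}" for q
    proof -
      obtain p t where pt: "q = (p, t)" "p \<in> box a c" "t \<in> {-T0<..<T0}" using q by blast
      let ?X = "box a c" and ?Y = "{-T0<..<T0}"
      have sub: "?X \<times> ?Y \<subseteq> ?S" using Vsub T0 by auto
      have "((\<lambda>(p, t). u (p, t)) has_derivative
          (\<lambda>(v, \<tau>). (\<Sum>b\<in>Basis. (v \<bullet> b) *\<^sub>R w b (p, t)) + blinfun_scaleR_left (F ((p, t), u (p, t))) \<tau>))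
          (at (p, t) within ?X \<times> ?Y)"
      proof (rule has_derivative_partialsI)
        show "((\<lambda>p. u (p, t)) has_derivative (\<lambda>v. \<Sum>b\<in>Basis. (v \<bullet> b) *\<^sub>R w b (p, t))) (at p within ?X)"
          by (rule has_derivative_at_withinI[OF solution_differentiable_in_parameter[OF U Vsub pt(2) _ T0(2) T(2,3) \<Omega> sol graph M w]])
            (use pt in auto)
        show "((\<lambda>t. u (p, t)) has_derivative blinfun_apply (blinfun_scaleR_left (F ((p, t), u (p, t))))) (at t within ?Y)"
          if "p \<in> ?X" "t \<in> ?Y" for p t
        proof (rule has_derivative_at_withinI)
          have "p \<in> U" "t \<in> {-T<..<T}" using that Vsub T0 by auto
          then show "((\<lambda>t. u (p, t)) has_derivative blinfun_apply (blinfun_scaleR_left (F ((p, t), u (p, t))))) (at t)"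
            using sol by (simp add: parametrized_solution_def has_vector_derivative_def
                blinfun_scaleR_left.rep_eq[abs_def])
        qed
        have "continuous_on (?X \<times> ?Y) (\<lambda>q. blinfun_scaleR_left (F (q, u q)))"
          by (intro bounded_linear.continuous_on[OF bounded_linear_blinfun_scaleR_left]
              continuous_on_subset[OF F_cont sub])
        then show "continuous (at (p, t) within ?X \<times> ?Y) (\<lambda>(p, t). blinfun_scaleR_left (F ((p, t), u (p, t))))"
          using pt(2,3) by (simp add: continuous_on_eq_continuous_within split_beta')
      qed (use pt in auto)
      moreover have "at (p, t) within ?X \<times> ?Y = at (p, t)"
        using pt by (intro at_within_open) (auto intro: open_Times)
      ultimately show ?thesis by (simp add: good_def pt(1) blinfun_scaleR_left.rep_eq split_beta')
    qed
    show ?thesis using ac(2) Vsub T0(1,2) w * open_box by blast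
  qed
  define D where "D b q = frechet_derivative u (at q) (b, 0)" for b q
  have Dw: "D b q = w b q" if "b \<in> Basis"
    and "good w q" for b q w
    using that(1) by (simp add: D_def frechet_derivative_at[OF that(2)[unfolded good_def], symmetric]
        inner_Basis if_distrib if_distribR cong: if_cong)
  have "parametrized_solution U T (variational_field F u b) (D b)" if b: "b \<in> Basis" for b
    unfolding parametrized_solution_def
  proof (intro conjI ballI)
    show "continuous_on ?S (D b)"
    proof (rule continuous_at_imp_continuous_on, safe)
      fix p t assume "p \<in> U" "t \<in> {-T<..<T}"
      from loc[OF this] obtain V T0 w where *: "open V" "p \<in> V" "\<bar>t\<bar> < T0"
        "parametrized_solution V T0 (variational_field F u b) (w b)"
        "\<forall>q\<in>V \<times> {-T0<..<T0}. good w q"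
        by blast
      have "continuous_on (V \<times> {-T0<..<T0}) (w b)" using *(4) by (auto simp: parametrized_solution_def)
      moreover have "D b x = w b x" if "x \<in> V \<times> {-T0<..<T0}" for x
        using Dw[OF b] *(5) that by blast
      ultimately have "continuous_on (V \<times> {-T0<..<T0}) (D b)"
        using continuous_on_cong[OF refl, of "V \<times> {-T0<..<T0}" "D b" "w b"] by simp
      moreover have "open (V \<times> {-T0<..<T0})" using *(1) by (intro open_Times) auto
      ultimately show "isCont (D b) (p, t)"
        using *(2,3) by (simp add: continuous_on_eq_continuous_at abs_less_iff)
    qed
    show "D b (p, 0) = 0" if "p \<in> U" for p
    proof -
      have "0 \<in> {-T<..<T}" using T by simp
      from loc[OF that this] obtain V T0 w where *: "p \<in> V" "\<bar>0\<bar> < T0"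
        "parametrized_solution V T0 (variational_field F u b) (w b)"
        "\<forall>q\<in>V \<times> {-T0<..<T0}. good w q"
        by blast
      then have "D b (p, 0) = w b (p, 0)" using Dw[OF b, of w "(p, 0)"] by auto
      then show ?thesis using * by (auto simp: parametrized_solution_def)
    qed
    show "((\<lambda>t. D b (p, t)) has_vector_derivative variational_field F u b ((p, t), D b (p, t))) (at t)"
      if "p \<in> U" "t \<in> {-T<..<T}" for p t
    proof -
      from loc[OF that] obtain V T0 w where *: "p \<in> V" "\<bar>t\<bar> < T0"
        "parametrized_solution V T0 (variational_field F u b) (w b)"
        "\<forall>q\<in>V \<times> {-T0<..<T0}. good w q"
        by blast
      have eq: "w b (p, s) = D b (p, s)" if "s \<in> {-T0<..<T0}" for s
        using Dw[OF b, of w "(p, s)"] * that by auto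
      have tT: "t \<in> {-T0<..<T0}" using *(2) by auto
      have "((\<lambda>t. w b (p, t)) has_vector_derivative variational_field F u b ((p, t), w b (p, t))) (at t)"
        using *(1,3) tT by (simp add: parametrized_solution_def)
      then show ?thesis unfolding eq[OF tT]
        by (rule has_vector_derivative_transform_within_open[where S = "{-T0<..<T0}"]) (use tT eq in auto)
    qed
  qed
  moreover have "(u has_derivative (\<lambda>(v, \<tau>). (\<Sum>b\<in>Basis. (v \<bullet> b) *\<^sub>R D b q) + \<tau> *\<^sub>R F (q, u q))) (at q)"
    if "q \<in> ?S" for q
  proof -
    obtain p t where pt: "q = (p, t)" "p \<in> U" "t \<in> {-T<..<T}" using \<open>q \<in> ?S\<close> by blast
    from loc[OF pt(2,3)] obtain V T0 w where *: "p \<in> V" "\<bar>t\<bar> < T0"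
      "\<forall>q\<in>V \<times> {-T0<..<T0}. good w q"
      by blast
    then have d: "good w q"
      using pt(1) by (simp add: abs_less_iff)
    have "(\<lambda>(v, \<tau>). (\<Sum>b\<in>Basis. (v \<bullet> b) *\<^sub>R D b q) + \<tau> *\<^sub>R F (q, u q))
        = (\<lambda>(v, \<tau>). (\<Sum>b\<in>Basis. (v \<bullet> b) *\<^sub>R w b q) + \<tau> *\<^sub>R F (q, u q))"
      using Dw[OF _ d] by (intro ext) (auto intro!: sum.cong)
    then show ?thesis using d by (simp only: good_def)
  qed
  ultimately show ?thesis by (rule that)
qed

text \<open>
  Induction on \<open>k\<close> for all equations at once.  The derivative of a solution in a parameter solves the
  linearized equation, whose right-hand side is \<open>C\<^sup>k\<close> by the induction hypothesis for \<open>u\<close>, and which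
  has the same Lipschitz bound \<open>M\<close>; so the induction hypothesis applies to it too.  The time
  derivative is given by the equation.
\<close>

theorem parametrized_solution_Ck:
  fixes F :: "('p::euclidean_space \<times> real) \<times> 'u::euclidean_space \<Rightarrow> 'u"
  assumes U: "open U" and T: "T > 0" "T * M < 1" "M \<ge> 0"
    and \<Omega>: "open \<Omega>" "Ck_on k \<Omega> F" and sol: "parametrized_solution U T F u"
    and graph: "\<And>q. q \<in> U \<times> {-T<..<T} \<Longrightarrow> (q, u q) \<in> \<Omega>"
    and M: "\<And>q \<eta>. 0 < k \<Longrightarrow> q \<in> U \<times> {-T<..<T} \<Longrightarrow>
      norm (frechet_derivative F (at (q, u q)) (0, \<eta>)) \<le> M * norm \<eta>"
  shows "Ck_on k (U \<times> {-T<..<T}) u"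
  using \<Omega> sol graph M
proof (induction k arbitrary: F u \<Omega>)
  case 0
  then show ?case by (simp add: parametrized_solution_def)
next
  case (Suc k)
  let ?S = "U \<times> {-T<..<T}"
  note \<Omega> = Suc.prems(1,2) and graph = Suc.prems(4) and M = Suc.prems(5)[OF zero_less_Suc]
  have oS: "open ?S" using U by (intro open_Times) auto
  have F1: "Ck_on (Suc 0) \<Omega> F"
    by (rule Ck_on_mono[OF \<Omega>(2)]) simp
  have u: "Ck_on k ?S u"
    by (rule Suc.IH[OF \<Omega>(1) Ck_on_SucD[OF \<Omega>(2)] Suc.prems(3) graph M])
  obtain D where D: "\<And>b. b \<in> Basis \<Longrightarrow> parametrized_solution U T (variational_field F u b) (D b)"
    "\<And>q. q \<in> ?S \<Longrightarrow>
       (u has_derivative (\<lambda>(v, \<tau>). (\<Sum>b\<in>Basis. (v \<bullet> b) *\<^sub>R D b q) + \<tau> *\<^sub>R F (q, u q))) (at q)"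
    using solution_has_derivative[OF U T \<Omega>(1) F1 Suc.prems(3) graph M] by blast
  have hD: "(F has_derivative frechet_derivative F (at (q, u q))) (at (q, u q))" if "q \<in> ?S" for q
    by (rule Ck_on_Suc_has_derivative[OF F1 graph[OF that]])
  have along: "Ck_on k ?S (\<lambda>q. g (q, u q))" if "Ck_on k \<Omega> g" for g :: "_ \<Rightarrow> 'u"
  proof (rule Ck_on_compose[OF oS \<Omega>(1) _ _ that])
    show "Ck_on k ?S (\<lambda>q. (q, u q))"
      by (intro Ck_on_Pair oS u Ck_on_id)
  qed (use graph in auto)
  have Db: "Ck_on k ?S (D b)" if b: "b \<in> Basis" for b
  proof (rule Suc.IH[OF _ _ D(1)[OF b]])
    let ?\<Omega> = "?S \<times> (UNIV :: 'u set)"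
    show o: "open ?\<Omega>" by (rule open_Times[OF oS open_UNIV])
    have fst: "Ck_on k ?\<Omega> (\<lambda>x. frechet_derivative F (at (fst x, u (fst x))) \<xi>)" for \<xi>
      by (rule Ck_on_compose[OF o oS _ Ck_on_fst[OF o Ck_on_id[OF o]]
            along[OF Ck_on_directional_derivative[OF \<Omega>(2)]]]) auto
    have snd: "Ck_on k ?\<Omega> (\<lambda>x. snd x \<bullet> c)" for c
      by (intro Ck_on_inner_left Ck_on_snd Ck_on_id o)
    have "Ck_on k ?\<Omega> (\<lambda>x. frechet_derivative F (at (fst x, u (fst x))) ((b, 0), 0)
        + (\<Sum>c\<in>Basis. (snd x \<bullet> c) *\<^sub>R frechet_derivative F (at (fst x, u (fst x))) (0, c)))"
      by (intro Ck_on_add Ck_on_sum Ck_on_bilinear[OF bounded_bilinear_scaleR] fst snd o)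
    then show "Ck_on k ?\<Omega> (variational_field F u b)"
    proof (rule Ck_on_cong[OF o, rotated])
      fix x assume "x \<in> ?\<Omega>"
      then have x: "fst x \<in> ?S" by auto
      show "frechet_derivative F (at (fst x, u (fst x))) ((b, 0), 0)
        + (\<Sum>c\<in>Basis. (snd x \<bullet> c) *\<^sub>R frechet_derivative F (at (fst x, u (fst x))) (0, c))
        = variational_field F u b x"
        using variational_field_expand[where w = "snd x" and q = "fst x" and u = u and b = b, OF hD[OF x]]
        by simp
    qed
    fix q \<eta> assume k: "0 < k" and q: "q \<in> ?S"
    show "norm (frechet_derivative (variational_field F u b) (at (q, D b q)) (0, \<eta>)) \<le> M * norm \<eta>"
    proof -
      let ?G = "variational_field F u b"
      obtain j where j: "k = Suc j" using k by (cases k) auto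
      have G: "(?G has_derivative frechet_derivative ?G (at (q, D b q))) (at (q, D b q))"
        using Ck_on_Suc_has_derivative[of j ?\<Omega> ?G] \<open>Ck_on k ?\<Omega> ?G\<close> q by (simp add: j)
      have "((\<lambda>w. (q, w)) has_derivative (\<lambda>\<eta>. (0, \<eta>))) (at (D b q))"
        by (auto intro!: derivative_eq_intros)
      from has_derivative_compose[OF this G]
      have "((\<lambda>w. ?G (q, w)) has_derivative (\<lambda>\<eta>. frechet_derivative ?G (at (q, D b q)) (0, \<eta>))) (at (D b q))" .
      moreover have "((\<lambda>w. ?G (q, w)) has_derivative (\<lambda>\<eta>. frechet_derivative F (at (q, u q)) (0, \<eta>))) (at (D b q))"
      proof -
        have "((\<lambda>w. ((b, 0), w)) has_derivative (\<lambda>\<eta>. (0, \<eta>))) (at (D b q))"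
          by (auto intro!: derivative_eq_intros simp: zero_prod_def)
        from has_derivative_compose[OF this bounded_linear_imp_has_derivative[OF has_derivative_bounded_linear[OF hD[OF q]]]]
        show ?thesis by (simp add: variational_field_def)
      qed
      ultimately have "frechet_derivative ?G (at (q, D b q)) (0, \<eta>) = frechet_derivative F (at (q, u q)) (0, \<eta>)"
        by (auto dest: has_derivative_unique fun_cong)
      then show ?thesis using M[OF q] by simp
    qed
  qed (auto)
  show ?case
  proof (rule Ck_on_SucI[OF oS D(2)])
    fix v :: "'p \<times> real"
    have "Ck_on k ?S (\<lambda>q. (\<Sum>b\<in>Basis. (fst v \<bullet> b) *\<^sub>R D b q) + snd v *\<^sub>R F (q, u q))"
      by (intro Ck_on_add Ck_on_sum Ck_on_scaleR_const oS Db
          along Ck_on_SucD[OF \<Omega>(2)])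
    then show "Ck_on k ?S (\<lambda>q. (case v of (v, \<tau>) \<Rightarrow> (\<Sum>b\<in>Basis. (v \<bullet> b) *\<^sub>R D b q) + \<tau> *\<^sub>R F (q, u q)))"
      by (simp add: split_beta')
  qed
qed

section \<open>The local flow of a family of vector fields\<close>

text \<open>
  The point reached from \<open>x\<close> at time \<open>t\<close> is \<open>x + u ((\<epsilon>, x), t)\<close>.  The displacement \<open>u\<close>
  solves an equation in which initial point and parameter of the field play the same role.
\<close>

theorem local_flow:
  fixes X :: "'e::euclidean_space \<times> 's::euclidean_space \<Rightarrow> 's"
  assumes W: "open W" "p0 \<in> W" and X: "smooth_on W X"
  obtains U T u where "open U" "p0 \<in> U" "T > 0" "smooth_on (U \<times> {-T<..<T}) u"
    "\<And>p. p \<in> U \<Longrightarrow> u (p, 0) = 0"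
    "\<And>p t. p \<in> U \<Longrightarrow> t \<in> {-T<..<T} \<Longrightarrow> (fst p, snd p + u (p, t)) \<in> W"
    "\<And>p t. p \<in> U \<Longrightarrow> t \<in> {-T<..<T} \<Longrightarrow>
       ((\<lambda>t. u (p, t)) has_vector_derivative X (fst p, snd p + u (p, t))) (at t)"
proof -
  obtain a c where ac: "cbox a c \<subseteq> W" "p0 \<in> box a c" by (rule open_contains_cbox[OF W])
  have bc: "box a c \<subseteq> cbox a c" by (rule box_subset_cbox)
  have ne: "\<And>i. i \<in> Basis \<Longrightarrow> a \<bullet> i \<le> c \<bullet> i" using ac(2) by (force simp: mem_box)
  have cl: "clamp a c y \<in> cbox a c" for y using ne by (rule clamp_in_interval)
  obtain L where L: "L \<ge> 0" "\<And>y v. y \<in> cbox a c \<Longrightarrow> norm (frechet_derivative X (at y) v) \<le> L * norm v"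
    using compact_Ck_derivative_bound[OF smooth_onD[OF X] compact_cbox ac(1)] by metis
  have X_lip: "norm (X y - X y') \<le> L * norm (y - y')" if "y \<in> cbox a c" "y' \<in> cbox a c" for y y'
  proof (rule differentiable_bound[OF convex_box(1) _ _ that])
    fix z assume z: "z \<in> cbox a c"
    then have "z \<in> W" using ac(1) by blast
    then show "(X has_derivative frechet_derivative X (at z)) (at z within cbox a c)"
      by (rule has_derivative_at_withinI[OF Ck_on_Suc_has_derivative[OF smooth_onD[OF X]]])
    show "onorm (frechet_derivative X (at z)) \<le> L" using L(2)[OF z] by (rule onorm_le)
  qed
  have X_cont: "continuous_on (cbox a c) X"
    by (rule continuous_on_subset[OF Ck_on_imp_continuous_on[OF smooth_onD[OF X, of 0]] ac(1)])
  define G where "G x = X (clamp a c (fst (fst (fst x)), snd (fst (fst x)) + snd x))"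
    for x :: "(('e \<times> 's) \<times> real) \<times> 's"
  have G_cont: "continuous_on UNIV G" unfolding G_def[abs_def]
    by (rule continuous_on_compose2[OF clamp_continuous_on[OF X_cont, of UNIV]])
      (auto intro!: continuous_intros)
  have G_lip: "norm (G (q, v) - G (q, w)) \<le> L * norm (v - w)" for q v w
  proof -
    let ?y = "\<lambda>v. (fst (fst q), snd (fst q) + v)"
    have "norm (G (q, v) - G (q, w)) \<le> L * norm (clamp a c (?y v) - clamp a c (?y w))"
      unfolding G_def fst_conv snd_conv by (rule X_lip[OF cl cl])
    also have "norm (clamp a c (?y v) - clamp a c (?y w)) \<le> norm (?y v - ?y w)"
      using dist_clamps_le_dist_args[of a c "?y v" "?y w"] by (simp add: dist_norm)
    also have "norm (?y v - ?y w) = norm (v - w)" by (simp add: norm_Pair)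
    finally show ?thesis using L(1) by (simp add: mult_left_mono)
  qed
  have "bounded (X ` cbox a c)" by (intro compact_imp_bounded compact_continuous_image X_cont compact_cbox)
  then obtain C where "\<And>y. y \<in> cbox a c \<Longrightarrow> norm (X y) \<le> C" unfolding bounded_iff by blast
  then have C: "norm (G (q, 0)) \<le> C" for q unfolding G_def using cl by blast
  \<comment> \<open>The summand \<open>1\<close> keeps the time positive and finite when \<open>L = 0\<close>.\<close>
  define T0 where "T0 = 1 / (2 * (L + 1))"
  have T0: "T0 > 0" "T0 * L < 1" using L(1) by (auto simp: T0_def field_simps)
  obtain u where u: "continuous_on UNIV u" "\<And>p. u (p, 0) = 0"
    "\<And>p t. \<bar>t\<bar> < T0 \<Longrightarrow> ((\<lambda>t. u (p, t)) has_vector_derivative G ((p, t), u (p, t))) (at t)"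
    using ODE_solution_exists[OF G_cont G_lip C T0(1) L(1) T0(2)] by blast
  define N where "N = (\<lambda>q. (fst (fst q), snd (fst q) + u q)) -` box a c"
  have "open N" unfolding N_def
    by (intro open_vimage open_box continuous_intros u(1))
  moreover have "(p0, 0) \<in> N" using ac(2) by (simp add: N_def u(2))
  ultimately obtain U I where UI: "open U" "open I" "p0 \<in> U" "0 \<in> I" "U \<times> I \<subseteq> N"
    by (auto simp: open_prod_def)
  obtain T1 where T1: "T1 > 0" "ball 0 T1 \<subseteq> I" using UI(2,4) openE by blast
  define T where "T = min T0 T1"
  have T: "T > 0" "T \<le> T0" "T * L < 1"
  proof -
    show "T > 0" "T \<le> T0" using T0 T1 by (auto simp: T_def)
    then have "T * L \<le> T0 * L" using L(1) by (intro mult_right_mono)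
    then show "T * L < 1" using T0 by linarith
  qed
  have inN: "(fst p, snd p + u (p, t)) \<in> box a c" if "p \<in> U" "t \<in> {-T<..<T}" for p t
  proof -
    have "t \<in> ball 0 T1" using that(2) by (auto simp: T_def dist_real_def)
    then have "(p, t) \<in> N" using that(1) T1(2) UI(5) by blast
    then show ?thesis by (simp add: N_def)
  qed
  have ode: "((\<lambda>t. u (p, t)) has_vector_derivative X (fst p, snd p + u (p, t))) (at t)"
    if "p \<in> U" "t \<in> {-T<..<T}" for p t
  proof -
    have "\<bar>t\<bar> < T0" using that(2) T(2) by auto
    from u(3)[OF this, of p] show ?thesis
      using inN[OF that] bc by (simp add: G_def clamp_cancel_cbox subset_iff)
  qed
  define pr where "pr x = (fst (fst (fst x)), snd (fst (fst x)) + snd x)"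
    for x :: "(('e \<times> 's) \<times> real) \<times> 's"
  have pr_lin: "bounded_linear pr" unfolding pr_def[abs_def]
    by (intro bounded_linear_Pair bounded_linear_add bounded_linear_compose[OF bounded_linear_fst]
        bounded_linear_compose[OF bounded_linear_snd] bounded_linear_fst bounded_linear_snd)
  define \<Omega> where "\<Omega> = pr -` box a c"
  have o\<Omega>: "open \<Omega>" unfolding \<Omega>_def
    by (intro open_vimage open_box linear_continuous_on pr_lin)
  have boxW: "box a c \<subseteq> W" using bc ac(1) by blast
  have X_box: "Ck_on k (box a c) X" for k by (rule Ck_on_subset[OF smooth_onD[OF X] boxW])
  let ?F = "\<lambda>x. X (pr x)"
  have F: "Ck_on k \<Omega> ?F" for k
    by (rule Ck_on_compose[OF o\<Omega> open_box _ Ck_on_bounded_linear[OF pr_lin o\<Omega>] X_box]) (auto simp: \<Omega>_def)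
  have sol: "parametrized_solution U T ?F u"
    unfolding parametrized_solution_def using u(2) ode continuous_on_subset[OF u(1)] by (auto simp: pr_def)
  have "Ck_on k (U \<times> {-T<..<T}) u" for k
  proof (rule parametrized_solution_Ck[OF UI(1) T(1,3) L(1) o\<Omega> F sol])
    fix q assume q: "q \<in> U \<times> {-T<..<T}"
    have b: "pr (q, u q) \<in> box a c" using inN[of "fst q" "snd q"] q by (auto simp: pr_def)
    then show "(q, u q) \<in> \<Omega>" by (simp add: \<Omega>_def)
    fix \<eta>
    have "(X has_derivative frechet_derivative X (at (pr (q, u q)))) (at (pr (q, u q)))"
      by (rule Ck_on_Suc_has_derivative[OF smooth_onD[OF X]]) (use b boxW in blast)
    then have "(?F has_derivative (\<lambda>x. frechet_derivative X (at (pr (q, u q))) (pr x))) (at (q, u q))"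
      by (rule has_derivative_compose[OF bounded_linear_imp_has_derivative[OF pr_lin]])
    from frechet_derivative_at[OF this, symmetric]
    have "frechet_derivative ?F (at (q, u q)) (0, \<eta>) = frechet_derivative X (at (pr (q, u q))) (pr (0, \<eta>))"
      by simp
    moreover have "norm (pr (0, \<eta>)) = norm \<eta>" by (simp add: pr_def norm_Pair)
    ultimately show "norm (frechet_derivative ?F (at (q, u q)) (0, \<eta>)) \<le> L * norm \<eta>"
      using L(2)[of "pr (q, u q)" "pr (0, \<eta>)"] b bc by auto
  qed
  then have "smooth_on (U \<times> {-T<..<T}) u" by (simp add: smooth_on_def)
  with UI T(1) show ?thesis
    by (intro that[of U T u]) (use u(2) inN boxW ode in auto)
qed

section \<open>Linear algebra in three dimensions\<close>

lemma vec3_eq_iff: "(v :: 'a^3) = w \<longleftrightarrow> v $ 1 = w $ 1 \<and> v $ 2 = w $ 2 \<and> v $ 3 = w $ 3"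
  by (auto simp: vec_eq_iff forall_3)

lemma inner3: "(v :: real^3) \<bullet> w = v $ 1 * w $ 1 + v $ 2 * w $ 2 + v $ 3 * w $ 3"
  by (simp add: inner_vec_def sum_3)

lemmas cross3_components = cross3_def inner3 vector_3

lemma bivector_components [simp]:
  "bivector a b c $ 1 $ 1 = 0" "bivector a b c $ 1 $ 2 = a" "bivector a b c $ 1 $ 3 = - c"
  "bivector a b c $ 2 $ 1 = - a" "bivector a b c $ 2 $ 2 = 0" "bivector a b c $ 2 $ 3 = b"
  "bivector a b c $ 3 $ 1 = c" "bivector a b c $ 3 $ 2 = - b" "bivector a b c $ 3 $ 3 = 0"
  by (simp_all add: bivector_def)

lemma skew_eq_bivector:
  fixes P :: "real^3^3"
  assumes "transpose P = - P"
  shows "P = bivector (P $ 1 $ 2) (P $ 2 $ 3) (P $ 3 $ 1)"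
proof -
  have "P $ i $ j = - (P $ j $ i)" for i j
    using arg_cong[OF assms, of "\<lambda>M. M $ j $ i"] by (simp add: transpose_def)
  from this[of 1 1] this[of 2 2] this[of 3 3] this[of 2 1] this[of 3 2] this[of 1 3]
  show ?thesis by (simp add: vec3_eq_iff)
qed

definition frame_matrix :: "real^3 \<Rightarrow> real^3 \<Rightarrow> real^3 \<Rightarrow> real^3^3" where
  "frame_matrix c1 c2 c3 = transpose (vector [c1, c2, c3])"

text \<open>
  Cramer's rule, with the determinants written as triple products.
\<close>

definition frame_coords :: "real^3 \<Rightarrow> real^3 \<Rightarrow> real^3 \<Rightarrow> real^3 \<Rightarrow> real^3" where
  "frame_coords c1 c2 c3 w = (1 / (c1 \<bullet> cross3 c2 c3)) *\<^sub>R
     vector [w \<bullet> cross3 c2 c3, w \<bullet> cross3 c3 c1, w \<bullet> cross3 c1 c2]"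

lemma frame_matrix_vector:
  "frame_matrix c1 c2 c3 *v v = v $ 1 *\<^sub>R c1 + v $ 2 *\<^sub>R c2 + v $ 3 *\<^sub>R c3"
  by (simp add: frame_matrix_def vec3_eq_iff matrix_vector_mult_def transpose_def sum_3 mult.commute)

lemma frame_coords_frame_matrix:
  assumes "c1 \<bullet> cross3 c2 c3 \<noteq> 0"
  shows "frame_coords c1 c2 c3 (frame_matrix c1 c2 c3 *v v) = v"
proof -
  let ?d = "c1 \<bullet> cross3 c2 c3"
  have "vector [(frame_matrix c1 c2 c3 *v v) \<bullet> cross3 c2 c3, (frame_matrix c1 c2 c3 *v v) \<bullet> cross3 c3 c1,
      (frame_matrix c1 c2 c3 *v v) \<bullet> cross3 c1 c2] = ?d *\<^sub>R v"
    by (simp add: frame_matrix_vector vec3_eq_iff cross3_components algebra_simps)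
  then show ?thesis using assms by (simp add: frame_coords_def)
qed

lemma frame_matrix_frame_coords:
  assumes "c1 \<bullet> cross3 c2 c3 \<noteq> 0"
  shows "frame_matrix c1 c2 c3 *v (frame_coords c1 c2 c3 w) = w"
proof -
  let ?d = "c1 \<bullet> cross3 c2 c3"
  have "frame_matrix c1 c2 c3 *v vector [w \<bullet> cross3 c2 c3, w \<bullet> cross3 c3 c1, w \<bullet> cross3 c1 c2] = ?d *\<^sub>R w"
    by (simp add: frame_matrix_vector vec3_eq_iff cross3_components algebra_simps)
  then show ?thesis using assms
    by (simp add: frame_coords_def matrix_vector_mult_scaleR)
qed

text \<open>
  A bivector transforms by the cofactor matrix when it is regarded as a one-form.
\<close>

lemma frame_matrix_bivector:
  "frame_matrix c1 c2 c3 ** bivector (c3 \<bullet> b) (c1 \<bullet> b) (c2 \<bullet> b) ** transpose (frame_matrix c1 c2 c3)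
    = (c1 \<bullet> cross3 c2 c3) *\<^sub>R bivector (b $ 3) (b $ 1) (b $ 2)"
  by (simp add: vec3_eq_iff frame_matrix_def matrix_matrix_mult_def transpose_def sum_3
      cross3_components algebra_simps)

text \<open>
  The derivative of a determinant along a linear flow is the trace times the determinant.
\<close>

lemma trace_frame:
  fixes A :: "real^3^3"
  shows "(A *v c1) \<bullet> cross3 c2 c3 + (A *v c2) \<bullet> cross3 c3 c1 + (A *v c3) \<bullet> cross3 c1 c2
    = trace A * (c1 \<bullet> cross3 c2 c3)"
  by (simp add: trace_def matrix_vector_mult_def cross3_components sum_3 algebra_simps)

text \<open>
  The entry \<open>B $ i $ j\<close> stands for the derivative of the \<open>i\<close>-th component in direction \<open>j\<close>.
\<close>

definition curl_matrix :: "real^3^3 \<Rightarrow> real^3" where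
  "curl_matrix B = vector [B $ 3 $ 2 - B $ 2 $ 3, B $ 1 $ 3 - B $ 3 $ 1, B $ 2 $ 1 - B $ 1 $ 2]"

text \<open>
  The antisymmetric part of a Jacobian acts as the cross product with the curl.
\<close>

lemma curl_matrix_pairing:
  "c \<bullet> (B *v d) - d \<bullet> (B *v c) = curl_matrix B \<bullet> cross3 d c"
  by (simp add: curl_matrix_def matrix_vector_mult_def cross3_components sum_3 algebra_simps)

lemma wedge_model_field:
  "wedge (axis 2 1) (model_field a b p) = bivector (- a (p $ 1) (p $ 3)) (b (p $ 1) (p $ 3)) 0"
  by (simp add: vec3_eq_iff wedge_def model_field_def axis_def)

lemma sum_mset_proots_cubic:
  assumes p: "p = [:k0, k1, t, 1 :: complex:]"
  shows "sum_mset (proots p) = - t"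
proof -
  have lead: "lead_coeff p = 1" and deg: "degree p = 3" and t: "coeff p 2 = t"
    by (simp_all add: p numeral_eq_Suc)
  have s3: "size (proots p) = Suc (Suc (Suc 0))" by (simp add: size_proots_complex deg)
  then obtain a M where 1: "proots p = add_mset a M" using size_eq_Suc_imp_eq_union by blast
  then have s2: "size M = Suc (Suc 0)" using s3 by simp
  then obtain b N where 2: "M = add_mset b N" using size_eq_Suc_imp_eq_union by blast
  then have s1: "size N = Suc 0" using s2 by simp
  then obtain c K where 3: "N = add_mset c K" using size_eq_Suc_imp_eq_union by blast
  then have abc: "proots p = {#a, b, c#}" using s1 1 2 by simp
  have "coeff (smult (lead_coeff p) (\<Prod>x\<in>#proots p. [:- x, 1:])) 2 = t"
    by (simp only: complex_poly_decompose_multiset t)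
  then have "t = - c - b - a" unfolding lead by (simp add: abc numeral_eq_Suc)
  then show ?thesis by (simp add: abc)
qed

text \<open>
  Only the two leading coefficients of the characteristic polynomial matter, so the other two are left
  unspecified.
\<close>

lemma sum_eigenvalues_eq_trace: "sum_eigenvalues (A :: real^3^3) = complex_of_real (trace A)"
proof -
  have cubic: "\<exists>k0 k1. [:- a, 1:] * [:- e, 1:] * [:- i, 1:] + [:b:] * [:f:] * [:g:] + [:c:] * [:d:] * [:h:]
      - [:- a, 1:] * [:f:] * [:h:] - [:b:] * [:d:] * [:- i, 1:] - [:c:] * [:- e, 1:] * [:g:]
    = [:k0, k1, - (a + e + i), 1 :: complex:]" for a b c d e f g h i
    by simp
  let ?a = "\<lambda>i j. complex_of_real (A $ i $ j)"
  have "charpoly A = [:- ?a 1 1, 1:] * [:- ?a 2 2, 1:] * [:- ?a 3 3, 1:]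
      + [:- ?a 1 2:] * [:- ?a 2 3:] * [:- ?a 3 1:] + [:- ?a 1 3:] * [:- ?a 2 1:] * [:- ?a 3 2:]
      - [:- ?a 1 1, 1:] * [:- ?a 2 3:] * [:- ?a 3 2:] - [:- ?a 1 2:] * [:- ?a 2 1:] * [:- ?a 3 3, 1:]
      - [:- ?a 1 3:] * [:- ?a 2 2, 1:] * [:- ?a 3 1:]"
    by (simp add: charpoly_def det_3 del: mult_pCons_left mult_pCons_right)
  then obtain k0 k1 where "charpoly A = [:k0, k1, - (?a 1 1 + ?a 2 2 + ?a 3 3), 1:]"
    using cubic[of "?a 1 1" "?a 2 2" "?a 3 3" "- ?a 1 2" "- ?a 2 3" "- ?a 3 1" "- ?a 1 3" "- ?a 2 1" "- ?a 3 2"]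
    by metis
  from sum_mset_proots_cubic[OF this] show ?thesis
    by (simp add: sum_eigenvalues_def trace_def sum_3)
qed

section \<open>Charts adapted to a vector field\<close>

lemma vector3_eq: "(vector [a, b, c] :: real^3) = a *\<^sub>R axis 1 1 + b *\<^sub>R axis 2 1 + c *\<^sub>R axis 3 1"
  by (simp add: vec3_eq_iff axis_def)

lemma Ck_on_vector3:
  assumes "open S" "Ck_on k S f" "Ck_on k S g" "Ck_on k S h"
  shows "Ck_on k S (\<lambda>x. vector [f x, g x, h x] :: real^3)"
  unfolding vector3_eq
  by (intro Ck_on_add Ck_on_compose_bounded_linear[OF bounded_linear_scaleR_left] assms)

lemma Ck_on_frame_coords:
  assumes S: "open S" and c: "Ck_on k S c1" "Ck_on k S c2" "Ck_on k S c3" "Ck_on k S w"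
    and ne: "\<And>x. x \<in> S \<Longrightarrow> c1 x \<bullet> cross3 (c2 x) (c3 x) \<noteq> 0"
  shows "Ck_on k S (\<lambda>x. frame_coords (c1 x) (c2 x) (c3 x) (w x))"
  unfolding frame_coords_def inverse_eq_divide[symmetric]
  by (rule Ck_on_bilinear[OF bounded_bilinear_scaleR S Ck_on_inverse[OF S Ck_on_inner[OF S c(1) Ck_on_cross3[OF S c(2,3)]] ne]])
    (intro Ck_on_vector3 Ck_on_inner Ck_on_cross3 S c | assumption)+

text \<open>
  The domain is a product of parameters and space; the frame consists of the derivatives of \<open>\<psi>\<close> in the
  three spatial directions, and \<open>jac\<close> has these as columns.
\<close>

definition frame :: "('e::real_normed_vector \<times> (real^3) \<Rightarrow> real^3) \<Rightarrow> 'e \<times> (real^3) \<Rightarrow> 3 \<Rightarrow> real^3" where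
  "frame \<psi> x i = frechet_derivative \<psi> (at x) (0, axis i 1)"

definition vol :: "('e::real_normed_vector \<times> (real^3) \<Rightarrow> real^3) \<Rightarrow> 'e \<times> (real^3) \<Rightarrow> real" where
  "vol \<psi> x = frame \<psi> x 1 \<bullet> cross3 (frame \<psi> x 2) (frame \<psi> x 3)"

definition jac :: "('e::real_normed_vector \<times> (real^3) \<Rightarrow> real^3) \<Rightarrow> 'e \<times> (real^3) \<Rightarrow> real^3^3" where
  "jac \<psi> x = frame_matrix (frame \<psi> x 1) (frame \<psi> x 2) (frame \<psi> x 3)"

lemma Ck_on_frame: "Ck_on (Suc k) S \<psi> \<Longrightarrow> Ck_on k S (\<lambda>x. frame \<psi> x i)"
  unfolding frame_def by (rule Ck_on_directional_derivative)

lemma Ck_on_vol: "open S \<Longrightarrow> Ck_on (Suc k) S \<psi> \<Longrightarrow> Ck_on k S (vol \<psi>)"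
  unfolding vol_def[abs_def] by (intro Ck_on_inner Ck_on_cross3 Ck_on_frame)

lemma derivative_eq_jac:
  assumes "(\<psi> has_derivative D) (at x)"
  shows "D (0, v) = jac \<psi> x *v v"
proof -
  have lin: "linear D" using assms has_derivative_linear by blast
  have D: "frechet_derivative \<psi> (at x) = D" using frechet_derivative_at[OF assms] by simp
  have "(0, v) = v $ 1 *\<^sub>R (0, axis 1 1) + v $ 2 *\<^sub>R (0, axis 2 1) + v $ 3 *\<^sub>R (0 :: 'a, axis 3 1 :: real^3)"
    by (simp add: prod_eq_iff vec3_eq_iff axis_def)
  then have "D (0, v) = v $ 1 *\<^sub>R D (0, axis 1 1) + v $ 2 *\<^sub>R D (0, axis 2 1) + v $ 3 *\<^sub>R D (0, axis 3 1)"
    by (simp only: linear_add[OF lin] linear_cmul[OF lin])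
  then show ?thesis by (simp add: jac_def frame_matrix_vector frame_def D)
qed

lemma slice_has_derivative:
  assumes "(\<psi> has_derivative D) (at (\<epsilon>, q))"
  shows "((\<lambda>q. \<psi> (\<epsilon>, q)) has_derivative (\<lambda>v. D (0, v))) (at q)"
proof -
  have "((\<lambda>q. (\<epsilon>, q)) has_derivative (\<lambda>v. (0, v))) (at q)" by (auto intro!: derivative_eq_intros)
  from has_derivative_compose[OF this assms] show ?thesis .
qed

lemma line_has_vector_derivative:
  assumes "(\<psi> has_derivative D) (at (\<epsilon>, q))"
  shows "((\<lambda>t. \<psi> (\<epsilon>, q + t *\<^sub>R v)) has_vector_derivative D (0, v)) (at 0)"
proof -
  have 1: "((\<lambda>t. q + t *\<^sub>R v) has_vector_derivative v) (at 0)" by (auto intro!: derivative_eq_intros)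
  have "((\<lambda>q. \<psi> (\<epsilon>, q)) has_derivative (\<lambda>v. D (0, v))) (at (q + 0 *\<^sub>R v))"
    using slice_has_derivative[OF assms] by simp
  from vector_derivative_diff_chain_within[OF 1 has_derivative_at_withinI[OF this]]
  show ?thesis by (simp add: o_def)
qed

lemma transversal_exists:
  assumes "v \<noteq> (0 :: real^3)"
  obtains m1 m3 where "m1 \<bullet> cross3 v m3 \<noteq> 0"
proof -
  consider "v $ 1 \<noteq> 0" | "v $ 2 \<noteq> 0" | "v $ 3 \<noteq> 0" using assms by (auto simp: vec3_eq_iff)
  then show ?thesis
  proof cases
    case 1 then show ?thesis by (intro that[of "axis 2 1" "axis 3 1"]) (simp add: cross3_components axis_def)
  next
    case 2 then show ?thesis by (intro that[of "axis 1 1" "axis 3 1"]) (simp add: cross3_components axis_def)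
  next
    case 3 then show ?thesis by (intro that[of "axis 1 1" "axis 2 1"]) (simp add: cross3_components axis_def)
  qed
qed

text \<open>
  The chart flows for time \<open>q $ 2\<close> from a point of a plane transversal to \<open>X (0, 0)\<close>.  Moving the second
  coordinate is moving along the flow, so the second frame vector is \<open>X\<close>.  At the origin the other two
  frame vectors span the plane, so the frame is nondegenerate nearby.
\<close>

lemma flow_chart:
  fixes X :: "'e::euclidean_space \<times> (real^3) \<Rightarrow> real^3"
  assumes W: "open W" "(0, 0) \<in> W" and X: "smooth_on W X" "X (0, 0) \<noteq> 0"
  obtains N \<psi> where "open N" "(0, 0) \<in> N" "smooth_on N \<psi>" "\<psi> (0, 0) = 0"
    "\<And>x. x \<in> N \<Longrightarrow> (fst x, \<psi> x) \<in> W"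
    "\<And>x. x \<in> N \<Longrightarrow> frame \<psi> x 2 = X (fst x, \<psi> x)"
    "\<And>x. x \<in> N \<Longrightarrow> vol \<psi> x \<noteq> 0"
proof -
  obtain U T u where U: "open U" "(0, 0) \<in> U" and T: "T > 0" and u: "smooth_on (U \<times> {-T<..<T}) u"
    and u0: "\<And>p. p \<in> U \<Longrightarrow> u (p, 0) = 0"
    and uW: "\<And>p t. p \<in> U \<Longrightarrow> t \<in> {-T<..<T} \<Longrightarrow> (fst p, snd p + u (p, t)) \<in> W"
    and ode: "\<And>p t. p \<in> U \<Longrightarrow> t \<in> {-T<..<T} \<Longrightarrow>
       ((\<lambda>t. u (p, t)) has_vector_derivative X (fst p, snd p + u (p, t))) (at t)"
    using local_flow[OF W X(1)] by blast
  obtain m1 m3 where m: "m1 \<bullet> cross3 (X (0, 0)) m3 \<noteq> 0" by (rule transversal_exists[OF X(2)])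
  define s :: "real^3 \<Rightarrow> real^3" where "s q = q $ 1 *\<^sub>R m1 + q $ 3 *\<^sub>R m3" for q
  define \<Lambda> where "\<Lambda> x = ((fst x, s (snd x)), snd x $ 2)" for x :: "'e \<times> (real^3)"
  define \<psi> where "\<psi> x = s (snd x) + u (\<Lambda> x)" for x
  define N0 where "N0 = \<Lambda> -` (U \<times> {-T<..<T})"
  have s_lin: "bounded_linear s" unfolding s_def[abs_def]
    by (intro bounded_linear_add bounded_linear_scaleR_const bounded_linear_vec_nth)
  have ssnd_lin: "bounded_linear (\<lambda>x. s (snd x))"
    by (rule bounded_linear_compose[OF s_lin bounded_linear_snd])
  have \<Lambda>_lin: "bounded_linear \<Lambda>" unfolding \<Lambda>_def[abs_def]
    by (intro bounded_linear_Pair bounded_linear_fst ssnd_lin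
        bounded_linear_compose[OF bounded_linear_vec_nth bounded_linear_snd])
  have oS: "open (U \<times> {-T<..<T})" using U by (intro open_Times) auto
  have oN0: "open N0" unfolding N0_def by (intro open_vimage oS linear_continuous_on \<Lambda>_lin)
  have s0: "s 0 = 0" by (simp add: s_def)
  have \<Lambda>0: "\<Lambda> (0, 0) = ((0, 0), 0)" by (simp add: \<Lambda>_def s0)
  have N00: "(0, 0) \<in> N0" using U T by (simp add: N0_def \<Lambda>0)
  have \<psi>: "Ck_on k N0 \<psi>" for k unfolding \<psi>_def[abs_def]
    by (intro Ck_on_add oN0 Ck_on_bounded_linear[OF ssnd_lin oN0]
        Ck_on_compose[OF oN0 oS _ Ck_on_bounded_linear[OF \<Lambda>_lin oN0] smooth_onD[OF u]]) (auto simp: N0_def)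
  have \<psi>W: "(fst x, \<psi> x) \<in> W" if "x \<in> N0" for x
    using uW[of "(fst x, s (snd x))" "snd x $ 2"] that by (simp add: N0_def \<Lambda>_def \<psi>_def)
  have hd: "(\<psi> has_derivative frechet_derivative \<psi> (at x)) (at x)" if "x \<in> N0" for x
    by (rule Ck_on_Suc_has_derivative[OF \<psi> that])
  have frame2: "frame \<psi> x 2 = X (fst x, \<psi> x)" if x: "x \<in> N0" for x
  proof -
    obtain \<epsilon> q where xq: "x = (\<epsilon>, q)" by force
    have 1: "((\<lambda>t. \<psi> (\<epsilon>, q + t *\<^sub>R axis 2 1)) has_vector_derivative frame \<psi> x 2) (at 0)"
      unfolding frame_def using line_has_vector_derivative[OF hd[OF x, unfolded xq]] xq by simp
    have eq: "\<psi> (\<epsilon>, q + t *\<^sub>R axis 2 1) = s q + u ((\<epsilon>, s q), q $ 2 + t)" for t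
      by (simp add: \<psi>_def \<Lambda>_def s_def axis_def)
    have "((\<lambda>t. u ((\<epsilon>, s q), t)) has_vector_derivative X (\<epsilon>, s q + u ((\<epsilon>, s q), q $ 2))) (at (q $ 2 + 0))"
      using ode[of "(\<epsilon>, s q)" "q $ 2"] x by (simp add: N0_def \<Lambda>_def xq)
    moreover have "((\<lambda>t. q $ 2 + t) has_vector_derivative 1) (at 0)" by (auto intro!: derivative_eq_intros)
    ultimately have "((\<lambda>t. u ((\<epsilon>, s q), q $ 2 + t)) has_vector_derivative X (\<epsilon>, s q + u ((\<epsilon>, s q), q $ 2))) (at 0)"
      using vector_diff_chain_at[of "\<lambda>t. q $ 2 + t" 1 0] by (force simp: o_def)
    then have "((\<lambda>t. \<psi> (\<epsilon>, q + t *\<^sub>R axis 2 1)) has_vector_derivative X (fst x, \<psi> x)) (at 0)"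
      unfolding eq by (auto intro!: derivative_eq_intros simp: xq \<psi>_def \<Lambda>_def)
    with 1 show ?thesis by (rule vector_derivative_unique_at)
  qed
  have frame0: "frame \<psi> (0, 0) i = s (axis i 1)" if "axis i 1 $ 2 = (0 :: real)" for i
  proof -
    have 1: "((\<lambda>t. \<psi> (0, 0 + t *\<^sub>R axis i 1)) has_vector_derivative frame \<psi> (0, 0) i) (at 0)"
      unfolding frame_def by (rule line_has_vector_derivative[OF hd[OF N00]])
    define I where "I = (\<lambda>t. \<Lambda> (0, t *\<^sub>R axis i 1)) -` (U \<times> {-T<..<T})"
    have oI: "open I" unfolding I_def
      by (intro open_vimage oS continuous_on_compose2[OF linear_continuous_on[OF \<Lambda>_lin, of UNIV]] continuous_intros) auto
    have I0: "0 \<in> I" using N00 by (simp add: I_def N0_def)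
    have eq: "t *\<^sub>R s (axis i 1) = \<psi> (0, 0 + t *\<^sub>R axis i 1)" if "t \<in> I" for t
      using that \<open>axis i 1 $ 2 = 0\<close> u0[of "(0, s (t *\<^sub>R axis i 1))"] linear_cmul[OF bounded_linear.linear[OF s_lin]]
      by (simp add: I_def \<psi>_def \<Lambda>_def)
    have "((\<lambda>t. t *\<^sub>R s (axis i 1)) has_vector_derivative s (axis i 1)) (at 0)"
      by (auto intro!: derivative_eq_intros)
    then have "((\<lambda>t. \<psi> (0, 0 + t *\<^sub>R axis i 1)) has_vector_derivative s (axis i 1)) (at 0)"
      by (rule has_vector_derivative_transform_within_open[OF _ oI I0 eq])
    with 1 show ?thesis by (rule vector_derivative_unique_at)
  qed
  have \<psi>0: "\<psi> (0, 0) = 0" using u0[OF U(2)] by (simp add: \<psi>_def \<Lambda>0 s0)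
  have "frame \<psi> (0, 0) 1 = m1" "frame \<psi> (0, 0) 3 = m3"
    using frame0[of 1] frame0[of 3] by (simp_all add: s_def axis_def)
  then have vol0: "vol \<psi> (0, 0) \<noteq> 0" using m frame2[OF N00] by (simp add: vol_def \<psi>0)
  \<comment> \<open>Only here is the domain shrunk to where the frame is a basis.\<close>
  define N where "N = N0 \<inter> vol \<psi> -` (- {0})"
  have "open N" unfolding N_def
    by (intro continuous_open_preimage oN0 Ck_on_imp_continuous_on[OF Ck_on_vol[OF oN0 \<psi>]]) auto
  moreover have "Ck_on k N \<psi>" for k by (rule Ck_on_subset[OF \<psi>]) (auto simp: N_def)
  then have "smooth_on N \<psi>" by (simp add: smooth_on_def)
  ultimately show ?thesis
    using N00 vol0 \<psi>0 \<psi>W frame2 by (intro that[of N \<psi>]) (auto simp: N_def)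
qed

text \<open>
  The inverse function theorem is applied to \<open>(\<epsilon>, q) \<mapsto> (\<epsilon>, \<psi> (\<epsilon>, q))\<close>, which keeps the parameter and
  so inverts all charts of the family together.  Its derivative is block triangular and is inverted by
  Cramer's rule; hence the derivative of the inverse \<open>g\<close> is a smooth expression in \<open>g\<close> and \<open>g\<close> gains one
  order of differentiability at a time.
\<close>

lemma smooth_inverse_chart:
  fixes \<psi> :: "'e::euclidean_space \<times> (real^3) \<Rightarrow> real^3"
  assumes N: "open N" "x0 \<in> N" and \<psi>: "smooth_on N \<psi>" and vol: "\<And>x. x \<in> N \<Longrightarrow> vol \<psi> x \<noteq> 0"
  obtains U V \<phi> where "open U" "U \<subseteq> N" "x0 \<in> U" "open V" "smooth_on V \<phi>"
    "\<And>x. x \<in> U \<Longrightarrow> (fst x, \<psi> x) \<in> V" "\<And>x. x \<in> U \<Longrightarrow> \<phi> (fst x, \<psi> x) = snd x"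
    "\<And>y. y \<in> V \<Longrightarrow> (fst y, \<phi> y) \<in> U" "\<And>y. y \<in> V \<Longrightarrow> \<psi> (fst y, \<phi> y) = snd y"
proof -
  let ?D = "\<lambda>x. frechet_derivative \<psi> (at x)"
  define \<Psi> where "\<Psi> x = (fst x, \<psi> x)" for x
  define L where "L x \<zeta> = (fst \<zeta>, ?D x \<zeta>)" for x \<zeta>
  define R where "R x \<zeta> = (fst \<zeta>, frame_coords (frame \<psi> x 1) (frame \<psi> x 2) (frame \<psi> x 3) (snd \<zeta> - ?D x (fst \<zeta>, 0)))"
    for x and \<zeta> :: "'e \<times> (real^3)"
  have hd: "(\<psi> has_derivative ?D x) (at x)" if "x \<in> N" for x
    by (rule Ck_on_Suc_has_derivative[OF smooth_onD[OF \<psi>] that])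
  have L: "(\<Psi> has_derivative L x) (at x)" if "x \<in> N" for x
    unfolding \<Psi>_def[abs_def] L_def[abs_def]
    by (intro has_derivative_Pair has_derivative_fst has_derivative_ident hd that)
  have split: "?D x (\<eta>, v) = ?D x (\<eta>, 0) + jac \<psi> x *v v" if "x \<in> N" for x \<eta> v
    using linear_add[OF has_derivative_linear[OF hd[OF that]], of "(\<eta>, 0)" "(0, v)"]
      derivative_eq_jac[OF hd[OF that], of v] by simp
  have LR: "L x (R x \<zeta>) = \<zeta>" if "x \<in> N" for x \<zeta>
    using frame_matrix_frame_coords vol[OF that] split[OF that, of "fst \<zeta>" "snd (R x \<zeta>)"]
    by (simp add: L_def R_def jac_def vol_def)
  have RL: "R x (L x \<zeta>) = \<zeta>" if "x \<in> N" for x \<zeta>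
    using frame_coords_frame_matrix vol[OF that] split[OF that, of "fst \<zeta>" "snd \<zeta>"]
    by (simp add: L_def R_def jac_def vol_def)
  have R_lin: "bounded_linear (R x)" if "x \<in> N" for x
  proof -
    have l: "linear (L x)" using has_derivative_linear[OF L[OF that]] .
    have "linear (R x)"
    proof (rule linearI)
      fix a b :: "'e \<times> (real^3)" and r :: real
      have "R x (a + b) = R x (L x (R x a + R x b))" by (simp only: linear_add[OF l] LR[OF that])
      then show "R x (a + b) = R x a + R x b" by (simp only: RL[OF that])
      have "R x (r *\<^sub>R a) = R x (L x (r *\<^sub>R R x a))" by (simp only: linear_cmul[OF l] LR[OF that])
      then show "R x (r *\<^sub>R a) = r *\<^sub>R R x a" by (simp only: RL[OF that])
    qed
    then show ?thesis by (simp add: linear_conv_bounded_linear)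
  qed
  have inv_L: "inv (L x) = R x" if "x \<in> N" for x
    by (rule inv_unique_comp) (simp_all add: fun_eq_iff LR[OF that] RL[OF that])
  have appl: "blinfun_apply (Blinfun (L x)) = L x" if "x \<in> N" for x
    by (rule bounded_linear_Blinfun_apply[OF has_derivative_bounded_linear[OF L[OF that]]])
  have cont: "continuous_on N (\<lambda>x. Blinfun (L x))"
  proof (rule continuous_on_blinfun_componentwise)
    fix i :: "'e \<times> (real^3)"
    have "continuous_on N (\<lambda>x. L x i)" unfolding L_def
      by (intro continuous_on_Pair continuous_on_const
          Ck_on_imp_continuous_on[OF Ck_on_directional_derivative[OF smooth_onD[OF \<psi>]]])
    then show "continuous_on N (\<lambda>x. blinfun_apply (Blinfun (L x)) i)"
      by (rule continuous_on_eq) (simp add: appl)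
  qed
  have inv0: "Blinfun (R x0) o\<^sub>L Blinfun (L x0) = id_blinfun"
    by (rule blinfun_eqI) (simp add: appl[OF N(2)] bounded_linear_Blinfun_apply[OF R_lin[OF N(2)]] RL[OF N(2)])
  have derf: "(\<Psi> has_derivative blinfun_apply (Blinfun (L x))) (at x)" if "x \<in> N" for x
    using L[OF that] by (simp add: appl[OF that])
  show ?thesis
  proof (rule inverse_function_theorem[OF N(1) derf cont N(2) inv0])
    fix U V g g'
    assume U: "open U" "U \<subseteq> N" "x0 \<in> U" "open V" and hom: "homeomorphism U V \<Psi> g"
      and g: "\<And>y. y \<in> V \<Longrightarrow> (g has_derivative (g' y)) (at y)"
        "\<And>y. y \<in> V \<Longrightarrow> g' y = inv (blinfun_apply (Blinfun (L (g y))))"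
    have gU: "g y \<in> U" "\<Psi> (g y) = y" if "y \<in> V" for y
      using hom that by (auto simp: homeomorphism_def)
    have \<Psi>V: "\<Psi> x \<in> V" "g (\<Psi> x) = x" if "x \<in> U" for x
      using hom that by (auto simp: homeomorphism_def)
    have gN: "g y \<in> N" if "y \<in> V" for y using gU(1)[OF that] U(2) by blast
    have g_der: "(g has_derivative R (g y)) (at y)" if "y \<in> V" for y
      using g(1)[OF that] g(2)[OF that] by (simp add: appl[OF gN[OF that]] inv_L[OF gN[OF that]])
    have g_Ck: "Ck_on k V g" for k
    proof (induction k)
      case 0
      show ?case using hom by (simp add: homeomorphism_def)
    next
      case (Suc k)
      show ?case
      proof (rule Ck_on_SucI[OF U(4) g_der])
        fix \<zeta>
        have sub: "g ` V \<subseteq> N" using gN by blast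
        note comp = Ck_on_compose[OF U(4) N(1) sub Suc.IH]
        have fr: "Ck_on k V (\<lambda>y. frame \<psi> (g y) i)" for i
          by (rule comp[OF Ck_on_frame[OF smooth_onD[OF \<psi>]]])
        have "Ck_on k V (\<lambda>y. frame_coords (frame \<psi> (g y) 1) (frame \<psi> (g y) 2) (frame \<psi> (g y) 3)
            (snd \<zeta> + - 1 *\<^sub>R ?D (g y) (fst \<zeta>, 0)))"
        proof (rule Ck_on_frame_coords[OF U(4) fr fr fr])
          show "Ck_on k V (\<lambda>y. snd \<zeta> + - 1 *\<^sub>R ?D (g y) (fst \<zeta>, 0))"
            by (intro Ck_on_add Ck_on_const Ck_on_scaleR_const U(4)
                comp[OF Ck_on_directional_derivative[OF smooth_onD[OF \<psi>]]])
          show "frame \<psi> (g y) 1 \<bullet> cross3 (frame \<psi> (g y) 2) (frame \<psi> (g y) 3) \<noteq> 0" if "y \<in> V" for y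
            using vol[OF gN[OF that]] by (simp add: vol_def)
        qed
        from Ck_on_Pair[OF U(4) Ck_on_const this, of "fst \<zeta>"]
        show "Ck_on k V (\<lambda>y. R (g y) \<zeta>)" by (simp add: R_def)
      qed
    qed
    have fst_g: "fst (g y) = fst y" "\<psi> (g y) = snd y" if "y \<in> V" for y
      using gU(2)[OF that] by (auto simp: \<Psi>_def prod_eq_iff)
    show ?thesis
    proof (rule that[OF U])
      show "smooth_on V (\<lambda>y. snd (g y))" by (simp add: smooth_on_def Ck_on_snd[OF U(4) g_Ck])
      show "(fst x, \<psi> x) \<in> V" "snd (g (fst x, \<psi> x)) = snd x" if "x \<in> U" for x
        using \<Psi>V[OF that] by (simp_all add: \<Psi>_def)
      show "(fst y, snd (g y)) \<in> U" "\<psi> (fst y, snd (g y)) = snd y" if "y \<in> V" for y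
        using gU(1)[OF that] fst_g[OF that] by (metis prod.collapse)+
    qed
  qed
qed

section \<open>One-forms annihilated by their curl\<close>

lemma jac_nth: "jac b x $ i $ j = frame b x j $ i"
  using exhaust_3[of j] by (auto simp: jac_def frame_matrix_def transpose_def)

definition curl :: "('e::real_normed_vector \<times> (real^3) \<Rightarrow> real^3) \<Rightarrow> 'e \<times> (real^3) \<Rightarrow> real^3" where
  "curl b x = curl_matrix (jac b x)"

lemma Ck_on_curl:
  assumes "open S" "Ck_on (Suc k) S b"
  shows "Ck_on k S (curl b)"
proof -
  have *: "Ck_on k S (\<lambda>x. frame b x i $ j + - 1 *\<^sub>R (frame b x i' $ j'))" for i j i' j'
    by (intro Ck_on_add Ck_on_scaleR_const Ck_on_nth Ck_on_frame assms)
  show ?thesis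
    using Ck_on_vector3[OF assms(1) *[of 2 3 3 2] *[of 3 1 1 3] *[of 1 2 2 1]]
    by (simp add: curl_def[abs_def] curl_matrix_def jac_nth)
qed

lemma divergence_curl:
  fixes b :: "'e::euclidean_space \<times> (real^3) \<Rightarrow> real^3"
  assumes S: "open S" "Ck_on (Suc (Suc 0)) S b" "x \<in> S"
  shows "trace (jac (curl b) x) = 0"
proof -
  define s where "s i j = frechet_derivative (\<lambda>x. frame b x i) (at x) (0, axis j 1)" for i j
  have sym: "s i j = s j i" for i j
    unfolding s_def frame_def by (rule Ck_on_second_derivative_symmetric[OF S])
  have fr: "((\<lambda>x. frame b x i) has_derivative frechet_derivative (\<lambda>x. frame b x i) (at x)) (at x)" for i
    by (rule Ck_on_Suc_has_derivative[OF Ck_on_frame[OF S(2)] S(3)])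
  have cu: "(curl b has_derivative frechet_derivative (curl b) (at x)) (at x)"
    by (rule Ck_on_Suc_has_derivative[OF Ck_on_curl[OF S(1,2)] S(3)])
  have comp: "frame (curl b) x m $ n = s i m $ j - s i' m $ j'"
    if "\<And>x. curl b x $ n = frame b x i $ j - frame b x i' $ j'" for m n i j i' j'
  proof -
    have "((\<lambda>x. curl b x $ n) has_derivative (\<lambda>v. frechet_derivative (curl b) (at x) v $ n)) (at x)"
      by (rule bounded_linear.has_derivative[OF bounded_linear_vec_nth cu])
    moreover have "((\<lambda>x. curl b x $ n) has_derivative (\<lambda>v. frechet_derivative (\<lambda>x. frame b x i) (at x) v $ j
        - frechet_derivative (\<lambda>x. frame b x i') (at x) v $ j')) (at x)"
      unfolding that by (intro has_derivative_diff bounded_linear.has_derivative[OF bounded_linear_vec_nth] fr)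
    ultimately have "(\<lambda>v. frechet_derivative (curl b) (at x) v $ n) = (\<lambda>v. frechet_derivative (\<lambda>x. frame b x i) (at x) v $ j
        - frechet_derivative (\<lambda>x. frame b x i') (at x) v $ j')"
      by (rule has_derivative_unique)
    from fun_cong[OF this, of "(0, axis m 1)"] show ?thesis by (simp add: frame_def[of "curl b"] s_def)
  qed
  have "frame (curl b) x 1 $ 1 = s 2 1 $ 3 - s 3 1 $ 2"
    "frame (curl b) x 2 $ 2 = s 3 2 $ 1 - s 1 2 $ 3"
    "frame (curl b) x 3 $ 3 = s 1 3 $ 2 - s 2 3 $ 1"
    by (rule comp, simp add: curl_def curl_matrix_def jac_nth)+
  then show ?thesis using sym[of 1 2] sym[of 1 3] sym[of 2 3] by (simp add: trace_def sum_3 jac_nth)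
qed

text \<open>
  Convexity keeps the segment between the two points inside \<open>B\<close>.
\<close>

lemma constant_along_second_axis:
  fixes h :: "'e::euclidean_space \<times> (real^3) \<Rightarrow> real"
  assumes B: "convex B" and h: "\<And>x. x \<in> B \<Longrightarrow> (h has_derivative D x) (at x)"
    and D: "\<And>x. x \<in> B \<Longrightarrow> D x (0, axis 2 1) = 0"
    and q: "(\<epsilon>, q) \<in> B" "(\<epsilon>, q + t *\<^sub>R axis 2 1) \<in> B"
  shows "h (\<epsilon>, q + t *\<^sub>R axis 2 1) = h (\<epsilon>, q)"
proof -
  let ?l = "\<lambda>s. (\<epsilon>, q + (s * t) *\<^sub>R axis 2 1)"
  have l: "?l s \<in> B" if "s \<in> {0..1}" for s
  proof -
    have "?l s = (1 - s) *\<^sub>R (\<epsilon>, q) + s *\<^sub>R (\<epsilon>, q + t *\<^sub>R axis 2 1)"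
      by (simp add: scaleR_add_right scaleR_diff_left)
    then show ?thesis using convexD[OF B q, of "1 - s" s] that by simp
  qed
  have "((\<lambda>s. h (?l s)) has_derivative (\<lambda>k. 0)) (at s within {0..1})" if s: "s \<in> {0..1}" for s
  proof -
    have ld: "(?l has_derivative (\<lambda>k. (0, (k * t) *\<^sub>R axis 2 1))) (at s within {0..1})"
      by (auto intro!: derivative_eq_intros)
    have "((\<lambda>s. h (?l s)) has_derivative (\<lambda>k. D (?l s) (0, (k * t) *\<^sub>R axis 2 1))) (at s within {0..1})"
      by (rule has_derivative_compose[OF ld h[OF l[OF s]]])
    moreover have "D (?l s) (0, r *\<^sub>R axis 2 1) = 0" for r
      using linear_cmul[OF has_derivative_linear[OF h[OF l[OF s]]], of r "(0, axis 2 1)"] D[OF l[OF s]] by simp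
    ultimately show ?thesis by simp
  qed
  from has_derivative_zero_unique[OF convex_real_interval(5) this, of 1 0] show ?thesis by simp
qed

text \<open>
  Here \<open>b\<close> is a family of one-forms on three-space with \<open>b (curl b) = 0\<close>, and \<open>\<psi>\<close> a family of charts
  in which \<open>curl b\<close> is the second coordinate field.
\<close>

locale straightened_curl =
  fixes b :: "'e::euclidean_space \<times> (real^3) \<Rightarrow> real^3" and \<psi> :: "'e \<times> (real^3) \<Rightarrow> real^3"
    and W B :: "('e \<times> (real^3)) set"
  assumes W: "open W" "smooth_on W b" and integrable: "\<And>y. y \<in> W \<Longrightarrow> b y \<bullet> curl b y = 0"
    and B: "open B" "smooth_on B \<psi>" and \<psi>W: "\<And>x. x \<in> B \<Longrightarrow> (fst x, \<psi> x) \<in> W"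
    and flow: "\<And>x. x \<in> B \<Longrightarrow> frame \<psi> x 2 = curl b (fst x, \<psi> x)"
    and vol: "\<And>x. x \<in> B \<Longrightarrow> vol \<psi> x \<noteq> 0"
begin

abbreviation \<Psi> where "\<Psi> x \<equiv> (fst x, \<psi> x)"

lemma \<Psi>_Ck: "Ck_on k B \<Psi>"
  by (intro Ck_on_Pair B Ck_on_fst Ck_on_id smooth_onD[OF B(2)])

lemma comp_Ck: "smooth_on W f \<Longrightarrow> Ck_on k B (\<lambda>x. f (\<Psi> x))"
  by (rule Ck_on_compose[OF B(1) W(1) _ \<Psi>_Ck smooth_onD]) (use \<psi>W in auto)

lemma smooth_curl: "smooth_on W (curl b)"
  unfolding smooth_on_def using Ck_on_curl[OF W(1) smooth_onD[OF W(2)]] by blast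

lemma comp_derivative:
  fixes f :: "'e \<times> (real^3) \<Rightarrow> real^3"
  assumes f: "smooth_on W f" and x: "x \<in> B"
  shows "frechet_derivative (\<lambda>x. f (\<Psi> x)) (at x) (0, axis i 1) = jac f (\<Psi> x) *v frame \<psi> x i"
proof -
  have \<psi>: "(\<psi> has_derivative frechet_derivative \<psi> (at x)) (at x)"
    by (rule Ck_on_Suc_has_derivative[OF smooth_onD[OF B(2)] x])
  have "(\<Psi> has_derivative (\<lambda>v. (fst v, frechet_derivative \<psi> (at x) v))) (at x)"
    by (intro has_derivative_Pair has_derivative_fst has_derivative_ident \<psi>)
  from has_derivative_compose[OF this Ck_on_Suc_has_derivative[OF smooth_onD[OF f] \<psi>W[OF x]]]
  have "((\<lambda>x. f (\<Psi> x)) has_derivative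
      (\<lambda>v. frechet_derivative f (at (\<Psi> x)) (fst v, frechet_derivative \<psi> (at x) v))) (at x)" .
  from fun_cong[OF frechet_derivative_at[OF this], of "(0, axis i 1)"]
  show ?thesis
    using derivative_eq_jac[OF Ck_on_Suc_has_derivative[OF smooth_onD[OF f] \<psi>W[OF x]], of "frame \<psi> x i"]
    by (simp add: frame_def)
qed

text \<open>
  The second coordinate direction is the flow of \<open>curl b\<close>, so each frame vector obeys the linearized
  flow equation.
\<close>

lemma frame_derivative:
  assumes x: "x \<in> B"
  shows "frechet_derivative (\<lambda>x. frame \<psi> x i) (at x) (0, axis 2 1) = jac (curl b) (\<Psi> x) *v frame \<psi> x i"
proof -
  have "frechet_derivative (\<lambda>x. frame \<psi> x i) (at x) (0, axis 2 1)
      = frechet_derivative (\<lambda>x. frame \<psi> x 2) (at x) (0, axis i 1)"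
    unfolding frame_def by (rule Ck_on_second_derivative_symmetric[OF B(1) smooth_onD[OF B(2)] x])
  also have "((\<lambda>x. frame \<psi> x 2) has_derivative frechet_derivative (\<lambda>x. curl b (\<Psi> x)) (at x)) (at x)"
    by (rule has_derivative_transform_within_open[OF
          Ck_on_Suc_has_derivative[OF comp_Ck[OF smooth_curl, of "Suc 0"] x] B(1) x]) (simp add: flow)
  then have "frechet_derivative (\<lambda>x. frame \<psi> x 2) (at x) = frechet_derivative (\<lambda>x. curl b (\<Psi> x)) (at x)"
    by (rule frechet_derivative_at[symmetric])
  also have "frechet_derivative (\<lambda>x. curl b (\<Psi> x)) (at x) (0, axis i 1) = jac (curl b) (\<Psi> x) *v frame \<psi> x i"
    by (rule comp_derivative[OF smooth_curl x])
  finally show ?thesis .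
qed

text \<open>
  Differentiates \<open>b (curl b) = 0\<close> in a spatial direction.
\<close>

lemma integrable_derivative:
  assumes y: "y \<in> W"
  shows "b y \<bullet> (jac (curl b) y *v v) + curl b y \<bullet> (jac b y *v v) = 0"
proof -
  have db: "(b has_derivative frechet_derivative b (at y)) (at y)"
    by (rule Ck_on_Suc_has_derivative[OF smooth_onD[OF W(2)] y])
  have dc: "(curl b has_derivative frechet_derivative (curl b) (at y)) (at y)"
    by (rule Ck_on_Suc_has_derivative[OF smooth_onD[OF smooth_curl] y])
  have "((\<lambda>y. b y \<bullet> curl b y) has_derivative
      (\<lambda>v. b y \<bullet> frechet_derivative (curl b) (at y) v + frechet_derivative b (at y) v \<bullet> curl b y)) (at y)"
    by (rule has_derivative_inner[OF db dc])
  moreover have "((\<lambda>y. b y \<bullet> curl b y) has_derivative (\<lambda>v. 0)) (at y)"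
    by (rule has_derivative_transform_within_open[OF has_derivative_const W(1) y]) (simp add: integrable)
  ultimately have "(\<lambda>v. b y \<bullet> frechet_derivative (curl b) (at y) v + frechet_derivative b (at y) v \<bullet> curl b y) = (\<lambda>v. 0)"
    by (rule has_derivative_unique)
  from fun_cong[OF this, of "(0, v)"] show ?thesis
    by (simp add: derivative_eq_jac[OF db] derivative_eq_jac[OF dc] inner_commute)
qed

text \<open>
  Liouville's theorem: the flow of a divergence-free field preserves volume.
\<close>

lemma vol_derivative:
  assumes x: "x \<in> B"
  obtains D where "(vol \<psi> has_derivative D) (at x)" "D (0, axis 2 1) = 0"
proof -
  let ?d = "\<lambda>i. frechet_derivative (\<lambda>x. frame \<psi> x i) (at x)"
  have d: "((\<lambda>x. frame \<psi> x i) has_derivative ?d i) (at x)" for i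
    by (rule Ck_on_Suc_has_derivative[OF Ck_on_frame[OF smooth_onD[OF B(2)]] x])
  let ?A = "jac (curl b) (\<Psi> x)"
  have "(vol \<psi> has_derivative (\<lambda>v. frame \<psi> x 1 \<bullet> (cross3 (frame \<psi> x 2) (?d 3 v) + cross3 (?d 2 v) (frame \<psi> x 3))
      + ?d 1 v \<bullet> cross3 (frame \<psi> x 2) (frame \<psi> x 3))) (at x)"
    unfolding vol_def[abs_def]
    by (rule has_derivative_inner[OF d bounded_bilinear.FDERIV[OF bounded_bilinear_cross3 d d]])
  moreover have "frame \<psi> x 1 \<bullet> (cross3 (frame \<psi> x 2) (?A *v frame \<psi> x 3) + cross3 (?A *v frame \<psi> x 2) (frame \<psi> x 3))
      + (?A *v frame \<psi> x 1) \<bullet> cross3 (frame \<psi> x 2) (frame \<psi> x 3) = trace ?A * vol \<psi> x"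
    unfolding vol_def trace_frame[symmetric] by (simp add: cross3_components algebra_simps)
  moreover have "trace ?A = 0" by (rule divergence_curl[OF W(1) smooth_onD[OF W(2)] \<psi>W[OF x]])
  ultimately show ?thesis using that by (simp add: frame_derivative[OF x])
qed

text \<open>
  Cartan's formula: the Lie derivative of \<open>b\<close> along \<open>X = curl b\<close> is \<open>d(b(X)) + i\<^sub>X db\<close>.  The first
  term vanishes by assumption, the second because \<open>db\<close> is \<open>i\<^sub>X vol\<close>; here this is \<open>X \<bullet> (X \<times> f) = 0\<close>.
\<close>

lemma pairing_derivative:
  assumes x: "x \<in> B"
  obtains D where "((\<lambda>x. frame \<psi> x i \<bullet> b (\<Psi> x)) has_derivative D) (at x)" "D (0, axis 2 1) = 0"
proof -
  let ?d = "frechet_derivative (\<lambda>x. frame \<psi> x i) (at x)" and ?e = "frechet_derivative (\<lambda>x. b (\<Psi> x)) (at x)"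
  have d: "((\<lambda>x. frame \<psi> x i) has_derivative ?d) (at x)"
    by (rule Ck_on_Suc_has_derivative[OF Ck_on_frame[OF smooth_onD[OF B(2)]] x])
  have e: "((\<lambda>x. b (\<Psi> x)) has_derivative ?e) (at x)"
    by (rule Ck_on_Suc_has_derivative[OF comp_Ck[OF W(2)] x])
  let ?f = "frame \<psi> x i" and ?X = "curl b (\<Psi> x)" and ?J = "jac b (\<Psi> x)"
  have "((\<lambda>x. frame \<psi> x i \<bullet> b (\<Psi> x)) has_derivative (\<lambda>v. ?f \<bullet> ?e v + ?d v \<bullet> b (\<Psi> x))) (at x)"
    by (rule has_derivative_inner[OF d e])
  moreover have "?f \<bullet> (?J *v ?X) + (jac (curl b) (\<Psi> x) *v ?f) \<bullet> b (\<Psi> x) = 0"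
  proof -
    have "?f \<bullet> (?J *v ?X) - ?X \<bullet> (?J *v ?f) = ?X \<bullet> cross3 ?X ?f"
      by (simp add: curl_matrix_pairing curl_def)
    then show ?thesis
      using integrable_derivative[OF \<psi>W[OF x], of ?f] dot_cross_self(1)[of ?X ?f] by (simp add: inner_commute)
  qed
  ultimately show ?thesis
    using that by (simp add: frame_derivative[OF x] comp_derivative[OF W(2) x] flow[OF x])
qed

text \<open>
  The one-form of the Poisson structure in the coordinates \<open>\<psi>\<close>: the pull-back of \<open>b\<close>, divided by the
  density of the volume with which bivectors are contracted.
\<close>

definition straight_covector where "straight_covector i x = frame \<psi> x i \<bullet> ((1 / vol \<psi> x) *\<^sub>R b (\<Psi> x))"

lemma straight_covector_2: "x \<in> B \<Longrightarrow> straight_covector 2 x = 0"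
  using integrable[OF \<psi>W] by (simp add: straight_covector_def flow inner_commute)

lemma straight_covector_Ck: "Ck_on k B (straight_covector i)"
  unfolding straight_covector_def[abs_def] inverse_eq_divide[symmetric]
  by (intro Ck_on_inner Ck_on_bilinear[OF bounded_bilinear_scaleR] Ck_on_inverse B(1) Ck_on_frame smooth_onD[OF B(2)]
      Ck_on_vol comp_Ck[OF W(2)] vol)

lemma straight_covector_constant:
  assumes "convex B" "(\<epsilon>, q) \<in> B" "(\<epsilon>, q + t *\<^sub>R axis 2 1) \<in> B"
  shows "straight_covector i (\<epsilon>, q + t *\<^sub>R axis 2 1) = straight_covector i (\<epsilon>, q)"
proof (rule constant_along_second_axis[OF assms(1) _ _ assms(2,3)])
  fix x assume x: "x \<in> B"
  show "(straight_covector i has_derivative frechet_derivative (straight_covector i) (at x)) (at x)"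
    by (rule Ck_on_Suc_has_derivative[OF straight_covector_Ck x])
  obtain D where D: "(vol \<psi> has_derivative D) (at x)" "D (0, axis 2 1) = 0"
    by (rule vol_derivative[OF x])
  obtain E where E: "((\<lambda>x. frame \<psi> x i \<bullet> b (\<Psi> x)) has_derivative E) (at x)" "E (0, axis 2 1) = 0"
    by (rule pairing_derivative[OF x])
  have "((\<lambda>x. inverse (vol \<psi> x) * (frame \<psi> x i \<bullet> b (\<Psi> x))) has_derivative
      (\<lambda>v. inverse (vol \<psi> x) * E v + - (inverse (vol \<psi> x) * D v * inverse (vol \<psi> x)) * (frame \<psi> x i \<bullet> b (\<Psi> x)))) (at x)"
    by (rule has_derivative_mult[OF Deriv.has_derivative_inverse[OF vol[OF x] D(1)] E(1)])
  then have "(straight_covector i has_derivative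
      (\<lambda>v. inverse (vol \<psi> x) * E v + - (inverse (vol \<psi> x) * D v * inverse (vol \<psi> x)) * (frame \<psi> x i \<bullet> b (\<Psi> x)))) (at x)"
    by (simp add: straight_covector_def[abs_def] inverse_eq_divide)
  from fun_cong[OF frechet_derivative_at[OF this], of "(0, axis 2 1)"]
  show "frechet_derivative (straight_covector i) (at x) (0, axis 2 1) = 0" by (simp add: D(2) E(2))
qed

lemma bivector_pullback:
  assumes x: "x \<in> B"
  shows "jac \<psi> x ** bivector (straight_covector 3 x) (straight_covector 1 x) 0 ** transpose (jac \<psi> x)
    = bivector (b (\<Psi> x) $ 3) (b (\<Psi> x) $ 1) (b (\<Psi> x) $ 2)"
proof -
  have "jac \<psi> x ** bivector (straight_covector 3 x) (straight_covector 1 x) (straight_covector 2 x) ** transpose (jac \<psi> x)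
    = vol \<psi> x *\<^sub>R bivector (b (\<Psi> x) $ 3 / vol \<psi> x) (b (\<Psi> x) $ 1 / vol \<psi> x) (b (\<Psi> x) $ 2 / vol \<psi> x)"
    unfolding straight_covector_def jac_def frame_matrix_bivector by (simp add: vol_def)
  then show ?thesis using vol[OF x] by (simp add: straight_covector_2[OF x] vec3_eq_iff)
qed

lemma straight_covector_derivative_at_zero:
  assumes x: "x \<in> B" and b0: "b (\<Psi> x) = 0"
  shows "frechet_derivative (straight_covector i) (at x) (0, axis j 1)
    = frame \<psi> x i \<bullet> (jac b (\<Psi> x) *v frame \<psi> x j) / vol \<psi> x"
proof -
  let ?c = "\<lambda>x. inverse (vol \<psi> x) *\<^sub>R frame \<psi> x i"
  let ?e = "frechet_derivative (\<lambda>x. b (\<Psi> x)) (at x)"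
  have c: "(?c has_derivative frechet_derivative ?c (at x)) (at x)"
    by (rule Ck_on_Suc_has_derivative[OF _ x])
      (intro Ck_on_bilinear[OF bounded_bilinear_scaleR] Ck_on_inverse B(1) Ck_on_frame smooth_onD[OF B(2)] Ck_on_vol vol)
  have e: "((\<lambda>x. b (\<Psi> x)) has_derivative ?e) (at x)"
    by (rule Ck_on_Suc_has_derivative[OF comp_Ck[OF W(2)] x])
  have "((\<lambda>x. ?c x \<bullet> b (\<Psi> x)) has_derivative (\<lambda>v. ?c x \<bullet> ?e v + frechet_derivative ?c (at x) v \<bullet> b (\<Psi> x))) (at x)"
    by (rule has_derivative_inner[OF c e])
  then have "(straight_covector i has_derivative (\<lambda>v. ?c x \<bullet> ?e v)) (at x)"
    by (simp add: straight_covector_def[abs_def] b0 inverse_eq_divide)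
  from fun_cong[OF frechet_derivative_at[OF this], of "(0, axis j 1)"]
  show ?thesis by (simp add: comp_derivative[OF W(2) x] divide_inverse mult.commute)
qed

text \<open>
  At a zero of \<open>b\<close> the curl transforms as a vector.  In the chart it is the second coordinate vector,
  whose second component is the left-hand side.
\<close>

lemma straight_covector_trace_at_zero:
  assumes x: "x \<in> B" and b0: "b (\<Psi> x) = 0"
  shows "frechet_derivative (straight_covector 1) (at x) (0, axis 3 1) - frechet_derivative (straight_covector 3) (at x) (0, axis 1 1) = 1"
proof -
  have "frame \<psi> x 1 \<bullet> (jac b (\<Psi> x) *v frame \<psi> x 3) - frame \<psi> x 3 \<bullet> (jac b (\<Psi> x) *v frame \<psi> x 1)
      = frame \<psi> x 2 \<bullet> cross3 (frame \<psi> x 3) (frame \<psi> x 1)"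
    by (simp add: curl_matrix_pairing flow[OF x] curl_def)
  also have "\<dots> = vol \<psi> x" by (simp add: vol_def cross3_components algebra_simps)
  finally show ?thesis using vol[OF x]
    by (simp add: straight_covector_derivative_at_zero[OF x b0] flip: diff_divide_distrib)
qed

end

section \<open>The modular vector of a V singularity\<close>

text \<open>
  \<open>T j\<close> is the derivative in direction \<open>j\<close> of a bivector field at a point where it vanishes, that is,
  a linear Poisson structure.  The vector is the modular character, the trace of the adjoint
  representation.
\<close>

definition modular_vector :: "(3 \<Rightarrow> real^3^3) \<Rightarrow> real^3" where
  "modular_vector T = (\<chi> i. \<Sum>j\<in>UNIV. T j $ i $ j)"

text \<open>
  The hypothesis says that \<open>E\<close> is \<open>T\<close> in the coordinates \<open>A\<close>: one factor \<open>A\<close> acts on the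
  linear argument, two act on the bivector.  Contracting the argument with one of the indices cancels
  that pair and leaves a single \<open>A\<close>.
\<close>

lemma modular_vector_transform:
  assumes AB: "A ** B = mat 1" and BA: "B ** A = mat 1"
    and E: "\<And>j. (\<Sum>n\<in>UNIV. A $ n $ j *\<^sub>R E n) = A ** T j ** transpose A"
  shows "modular_vector E = A *v modular_vector T"
proof -
  have AB': "(\<Sum>j\<in>UNIV. A $ n $ j * B $ j $ m) = (if n = m then 1 else 0)" for n m
    using arg_cong[OF AB, of "\<lambda>M. M $ n $ m"] by (simp add: matrix_matrix_mult_def mat_def)
  have BA': "(\<Sum>m\<in>UNIV. B $ j $ m * A $ m $ l) = (if j = l then 1 else 0)" for j l
    using arg_cong[OF BA, of "\<lambda>M. M $ j $ l"] by (simp add: matrix_matrix_mult_def mat_def)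
  have Em: "E m = (\<Sum>j\<in>UNIV. B $ j $ m *\<^sub>R (A ** T j ** transpose A))" for m
  proof -
    have "(\<Sum>j\<in>UNIV. B $ j $ m *\<^sub>R (A ** T j ** transpose A))
        = (\<Sum>j\<in>UNIV. \<Sum>n\<in>UNIV. (A $ n $ j * B $ j $ m) *\<^sub>R E n)"
      by (simp add: E[symmetric] scaleR_sum_right mult.commute)
    also have "\<dots> = (\<Sum>n\<in>UNIV. (\<Sum>j\<in>UNIV. A $ n $ j * B $ j $ m) *\<^sub>R E n)"
      by (subst sum.swap) (simp add: scaleR_sum_left)
    also have "\<dots> = (\<Sum>n\<in>UNIV. if n = m then E n else 0)"
      unfolding AB' by (rule sum.cong) auto
    also have "\<dots> = E m" by simp
    finally show ?thesis by simp
  qed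
  have "modular_vector E $ i = (A *v modular_vector T) $ i" for i
  proof -
    let ?a = "\<lambda>j l. \<Sum>k\<in>UNIV. A $ i $ k * T j $ k $ l"
    have ent: "(A ** T j ** transpose A) $ i $ m = (\<Sum>l\<in>UNIV. ?a j l * A $ m $ l)" for j m
      by (simp add: matrix_matrix_mult_def transpose_def)
    have "modular_vector E $ i = (\<Sum>m\<in>UNIV. \<Sum>j\<in>UNIV. B $ j $ m * (\<Sum>l\<in>UNIV. ?a j l * A $ m $ l))"
      unfolding modular_vector_def Em by (simp add: ent)
    also have "\<dots> = (\<Sum>j\<in>UNIV. \<Sum>m\<in>UNIV. \<Sum>l\<in>UNIV. ?a j l * (B $ j $ m * A $ m $ l))"
      by (subst sum.swap) (simp add: sum_distrib_left mult_ac)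
    also have "\<dots> = (\<Sum>j\<in>UNIV. \<Sum>l\<in>UNIV. ?a j l * (\<Sum>m\<in>UNIV. B $ j $ m * A $ m $ l))"
      unfolding sum_distrib_left by (rule sum.cong[OF refl], rule sum.swap)
    also have "\<dots> = (\<Sum>j\<in>UNIV. \<Sum>l\<in>UNIV. if j = l then ?a j l else 0)"
      unfolding BA' by (intro sum.cong refl) auto
    also have "\<dots> = (\<Sum>j\<in>UNIV. ?a j j)" by simp
    also have "\<dots> = (A *v modular_vector T) $ i"
      unfolding modular_vector_def matrix_vector_mult_def by (simp add: sum_distrib_left) (rule sum.swap)
    finally show ?thesis .
  qed
  then show ?thesis by (simp add: vec_eq_iff)
qed

definition lin_coeff :: "fps3 \<Rightarrow> 3 \<Rightarrow> real" where
  "lin_coeff F m = (if m = 1 then coeff3 F 1 0 0 else if m = 2 then coeff3 F 0 1 0 else coeff3 F 0 0 1)"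

abbreviation const_coeff :: "fps3 \<Rightarrow> real" where "const_coeff F \<equiv> coeff3 F 0 0 0"

lemma coeff3_mult_low:
  "const_coeff (F * G) = const_coeff F * const_coeff G"
  "lin_coeff (F * G) m = const_coeff F * lin_coeff G m + lin_coeff F m * const_coeff G"
  by (simp_all add: lin_coeff_def coeff3_def fps_mult_nth)

lemma coeff3_sum: "coeff3 (\<Sum>i\<in>I. F i) a b c = (\<Sum>i\<in>I. coeff3 (F i) a b c)"
  by (simp add: coeff3_def fps_sum_nth)

lemma coeff3_one: "coeff3 1 a b c = (if a = 0 \<and> b = 0 \<and> c = 0 then 1 else 0)"
  by (simp add: coeff3_def)

lemma lin_coeff_sum: "lin_coeff (\<Sum>i\<in>I. F i) m = (\<Sum>i\<in>I. lin_coeff (F i) m)"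
  by (simp add: lin_coeff_def coeff3_sum)

lemma coeff3_series3 [simp]: "coeff3 (series3 c) i j k = c i j k"
  by (simp add: coeff3_def series3_def)

text \<open>
  Without constant terms, only the linear part of \<open>F\<close> and of the substituted series contributes to
  the linear part.
\<close>

lemma lin_coeff_subst:
  fixes A :: "fps3^3"
  assumes "\<And>i. const_coeff (A $ i) = 0"
  shows "lin_coeff (series_subst F A) m = (\<Sum>n\<in>UNIV. lin_coeff F n * lin_coeff (A $ n) m)"
proof -
  have "lin_coeff (series_subst F A) m =
      (\<Sum>a\<le>1. \<Sum>b\<le>1. \<Sum>c\<le>1. coeff3 F a b c * lin_coeff ((A $ 1)^a * (A $ 2)^b * (A $ 3)^c) m)"
    by (simp add: lin_coeff_def series_subst_def)
  also have "\<dots> = (\<Sum>n\<in>UNIV. lin_coeff F n * lin_coeff (A $ n) m)"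
    by (simp add: atMost_Suc coeff3_mult_low assms sum_3 coeff3_one)
      (simp add: lin_coeff_def coeff3_one)
  finally show ?thesis .
qed

lemma const_coeff_series_deriv: "const_coeff (series_deriv m F) = lin_coeff F m"
  by (simp add: series_deriv_def lin_coeff_def)

lemma low_coeffs_taylor3:
  "const_coeff (taylor3 h) = h 0" "lin_coeff (taylor3 h) m = pderiv_at m h 0"
  using exhaust_3[of m] by (auto simp: lin_coeff_def taylor3_def)

text \<open>
  A formal coordinate change acts on one-jets through its linear part.
\<close>

lemma modular_vector_formal:
  fixes A :: "fps3^3" and P Q :: "fps3^3^3"
  assumes A: "formal_coordinate_change A" and push: "formally_pushes_to A P Q"
    and P0: "\<And>i j. const_coeff (P $ i $ j) = 0"
    and ne: "modular_vector (\<lambda>m. \<chi> i j. lin_coeff (Q $ i $ j) m) \<noteq> 0"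
  shows "modular_vector (\<lambda>m. \<chi> i j. lin_coeff (P $ i $ j) m) \<noteq> 0"
proof
  assume z: "modular_vector (\<lambda>m. \<chi> i j. lin_coeff (P $ i $ j) m) = 0"
  define a :: "real^3^3" where "a = (\<chi> i j. lin_coeff (A $ i) j)"
  have A0: "const_coeff (A $ i) = 0" for i using A by (simp add: formal_coordinate_change_def)
  have "invertible a"
    using A by (simp add: formal_coordinate_change_def series_jacobian_def const_coeff_series_deriv a_def)
  then obtain b where ab: "a ** b = mat 1" "b ** a = mat 1" by (auto simp: invertible_def)
  have "modular_vector (\<lambda>m. \<chi> i j. lin_coeff (Q $ i $ j) m)
      = a *v modular_vector (\<lambda>m. \<chi> i j. lin_coeff (P $ i $ j) m)"
  proof (rule modular_vector_transform[OF ab])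
    fix m
    have "(\<Sum>n\<in>UNIV. lin_coeff (Q $ i $ j) n * a $ n $ m)
        = (\<Sum>l\<in>UNIV. (\<Sum>k\<in>UNIV. a $ i $ k * lin_coeff (P $ k $ l) m) * a $ j $ l)" for i j
    proof -
      have "series_subst (Q $ i $ j) A = (series_jacobian A ** P ** transpose (series_jacobian A)) $ i $ j"
        using push by (simp add: formally_pushes_to_def vec_eq_iff)
      also have "\<dots> = (\<Sum>l\<in>UNIV. (\<Sum>k\<in>UNIV. series_deriv k (A $ i) * P $ k $ l) * series_deriv l (A $ j))"
        by (simp add: matrix_matrix_mult_def transpose_def series_jacobian_def)
      finally have "lin_coeff (series_subst (Q $ i $ j) A) m = lin_coeff \<dots> m" by simp
      then show ?thesis
        by (simp add: lin_coeff_subst[OF A0] lin_coeff_sum coeff3_sum coeff3_mult_low const_coeff_series_deriv P0 a_def)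
    qed
    then show "(\<Sum>n\<in>UNIV. a $ n $ m *\<^sub>R (\<chi> i j. lin_coeff (Q $ i $ j) n))
        = a ** (\<chi> i j. lin_coeff (P $ i $ j) m) ** transpose a"
      by (simp add: vec_eq_iff matrix_matrix_mult_def transpose_def mult.commute[of "a $ _ $ m"])
  qed
  then show False using ne z by simp
qed

lemma modular_vector_normal_form:
  assumes "normal_form_pair f g" "jet1_nonzero g"
  shows "modular_vector (\<lambda>m. \<chi> i j. lin_coeff (normal_form f g $ i $ j) m) \<noteq> 0"
proof -
  let ?v = "modular_vector (\<lambda>m. \<chi> i j. lin_coeff (normal_form f g $ i $ j) m)"
  have z: "coeff3 series_z 0 0 0 = 0" "coeff3 series_z (Suc 0) 0 0 = 0" "coeff3 series_z 0 (Suc 0) 0 = 0"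
    "coeff3 series_z 0 0 (Suc 0) = 1"
    by (simp_all add: coeff3_def series_z_def)
  have c: "coeff3 (fps_const h) i j (Suc k) = 0" "coeff3 (fps_const h) i j 0 = coeff2 h i j" for h i j k
    by (simp_all add: coeff3_def coeff2_def)
  have m: "coeff3 (- F) i j k = - coeff3 F i j k" "coeff3 (F + G) i j k = coeff3 F i j k + coeff3 G i j k"
    "coeff3 (F - G) i j k = coeff3 F i j k - coeff3 G i j k" "coeff3 0 i j k = 0" for F G i j k
    by (simp_all add: coeff3_def)
  have p: "coeff3 (series_z * G) 0 0 (Suc 0) = const_coeff G" for G
    using coeff3_mult_low(2)[of series_z G 3] by (simp add: lin_coeff_def z)
  have "?v $ 1 = - coeff2 g 0 1"
    unfolding modular_vector_def by (simp add: sum_3 lin_coeff_def normal_form_def m z p)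
      (simp add: series_deriv_def c m p)
  moreover have "?v $ 2 = coeff2 g 1 0"
    unfolding modular_vector_def by (simp add: sum_3 lin_coeff_def normal_form_def m z p)
      (simp add: series_deriv_def c m p)
  moreover have "coeff2 g 1 0 \<noteq> 0 \<or> coeff2 g 0 1 \<noteq> 0"
    using assms by (auto simp: normal_form_pair_def jet1_nonzero_def)
  ultimately show ?thesis by (metis add.inverse_neutral neg_equal_iff_equal zero_index)
qed

lemma diffeo_jacobian_inverse:
  fixes \<phi> :: "real^3 \<Rightarrow> real^3"
  assumes \<phi>: "diffeo U V \<phi>" "0 \<in> U" "\<phi> 0 = 0"
  obtains B where "jacobian \<phi> (at 0) ** B = mat 1" "B ** jacobian \<phi> (at 0) = mat 1"
    "(inv_into U \<phi> has_derivative (\<lambda>w. B *v w)) (at 0)" "inv_into U \<phi> 0 = 0" "open V" "0 \<in> V"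
    "\<And>y. y \<in> V \<Longrightarrow> inv_into U \<phi> y \<in> U \<and> \<phi> (inv_into U \<phi> y) = y"
proof -
  let ?g = "inv_into U \<phi>" and ?J = "jacobian \<phi> (at 0)"
  have U: "open U" and V: "open V" and bij: "bij_betw \<phi> U V" and s: "smooth_on U \<phi>" "smooth_on V ?g"
    using \<phi>(1) by (auto simp: diffeo_def)
  have V0: "0 \<in> V" using bij \<phi>(2,3) by (metis bij_betwE)
  have g0: "?g 0 = 0" using bij \<phi>(2,3) by (metis bij_betw_inv_into_left)
  have gV: "?g y \<in> U \<and> \<phi> (?g y) = y" if "y \<in> V" for y
    using bij that by (metis bij_betw_inv_into_right bij_betw_def inv_into_into)
  have Ck: "Ck_on (Suc 0) U \<phi>" "Ck_on (Suc 0) V ?g" using s by (auto simp only: smooth_on_def)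
  have d\<phi>: "(\<phi> has_derivative (\<lambda>v. ?J *v v)) (at 0)"
    using Ck(1) \<phi>(2) by (simp flip: jacobian_works)
  define B where "B = jacobian ?g (at 0)"
  have dg: "(?g has_derivative (\<lambda>v. B *v v)) (at 0)"
    using Ck(2) V0 by (simp add: B_def flip: jacobian_works)
  have "((\<lambda>y. \<phi> (?g y)) has_derivative (\<lambda>v. ?J *v (B *v v))) (at 0)"
    by (rule has_derivative_compose[OF dg]) (simp add: g0 d\<phi>)
  moreover have "((\<lambda>y. \<phi> (?g y)) has_derivative (\<lambda>v. v)) (at 0)"
    by (rule has_derivative_transform_within_open[OF has_derivative_ident V V0]) (simp add: gV)
  ultimately have 1: "(\<lambda>v. ?J *v (B *v v)) = (\<lambda>v. v)" by (rule has_derivative_unique)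
  have JB: "?J ** B = mat 1"
    unfolding matrix_eq using fun_cong[OF 1] by (simp add: matrix_vector_mul_assoc)
  then have BJ: "B ** ?J = mat 1" by (rule matrix_left_right_inverse[THEN iffD1])
  show ?thesis by (rule that[OF JB BJ dg g0 V V0 gV])
qed

text \<open>
  Differentiating \<open>Q \<circ> \<phi> = J P J\<^sup>T\<close> at a zero of \<open>P\<close>, the derivatives of the Jacobian \<open>J\<close> drop out,
  so the one-jets are related by the linear map \<open>J\<close> alone.
\<close>

lemma modular_vector_diffeo:
  fixes P Q :: "real^3 \<Rightarrow> real^3^3"
  assumes \<phi>: "diffeo U V \<phi>" "0 \<in> U" "\<phi> 0 = 0" and push: "pushes_to U \<phi> P Q"
    and P: "(P has_derivative D) (at 0)" "P 0 = 0"
  shows "modular_vector (\<lambda>m. \<chi> i j. pderiv_at m (\<lambda>p. Q p $ i $ j) 0)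
    = jacobian \<phi> (at 0) *v modular_vector (\<lambda>m. D (axis m 1))" and "Q 0 = 0"
proof -
  let ?g = "inv_into U \<phi>" and ?J = "jacobian \<phi> (at 0)"
  obtain B where B: "?J ** B = mat 1" "B ** ?J = mat 1"
    and dg: "(?g has_derivative (\<lambda>w. B *v w)) (at 0)" and g0: "?g 0 = 0" and V: "open V" "0 \<in> V"
    and gV: "\<And>y. y \<in> V \<Longrightarrow> ?g y \<in> U \<and> \<phi> (?g y) = y"
    using diffeo_jacobian_inverse[OF \<phi>] by metis
  have U: "open U" "smooth_on U \<phi>" using \<phi>(1) by (auto simp: diffeo_def)
  define J where "J p i j = frechet_derivative \<phi> (at p) (axis j 1) $ i" for p and i j :: 3
  have J: "J 0 i j = ?J $ i $ j" for i j by (simp add: J_def jacobian_def matrix_def)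
  define dJ where "dJ i j = frechet_derivative (\<lambda>p. J p i j) (at 0)" for i j
  have dJ: "((\<lambda>p. J p i j) has_derivative dJ i j) (at 0)" for i j
  proof -
    have "Ck_on (Suc 0) U (\<lambda>p. J p i j)" unfolding J_def
      by (rule Ck_on_nth[OF U(1) Ck_on_directional_derivative[OF smooth_onD[OF U(2)]]])
    from Ck_on_Suc_has_derivative[OF this \<phi>(2)] show ?thesis unfolding dJ_def .
  qed
  have dP: "((\<lambda>p. P p $ k $ l) has_derivative (\<lambda>v. D v $ k $ l)) (at 0)" for k l
    by (intro bounded_linear.has_derivative[OF bounded_linear_vec_nth] P)
  define G where "G i j p = (\<Sum>l\<in>UNIV. (\<Sum>k\<in>UNIV. J p i k * P p $ k $ l) * J p j l)" for i j p
  define dG where "dG i j v = (\<Sum>l\<in>UNIV. (\<Sum>k\<in>UNIV. ?J $ i $ k * D v $ k $ l) * ?J $ j $ l)" for i j v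
  have dG: "(G i j has_derivative dG i j) (at 0)" for i j
    unfolding G_def[abs_def] dG_def[abs_def]
    by (rule has_derivative_eq_rhs[OF has_derivative_sum[OF has_derivative_mult[OF has_derivative_sum[OF has_derivative_mult[OF dJ dP]] dJ]]])
      (simp add: P(2) J)
  have QG: "Q (\<phi> p) $ i $ j = G i j p" if "p \<in> U" for p i j
    using push that by (simp add: pushes_to_def G_def J_def matrix_matrix_mult_def transpose_def
        jacobian_def matrix_def)
  have dQ: "((\<lambda>p. Q p $ i $ j) has_derivative (\<lambda>w. dG i j (B *v w))) (at 0)" for i j
  proof (rule has_derivative_transform_within_open[OF _ V])
    show "((\<lambda>y. G i j (?g y)) has_derivative (\<lambda>w. dG i j (B *v w))) (at 0)"
      by (rule has_derivative_compose[OF dg]) (simp add: g0 dG)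
    show "G i j (?g y) = Q y $ i $ j" if "y \<in> V" for y
      using QG[of "?g y" i j] gV[OF that] by simp
  qed
  have pd: "pderiv_at m (\<lambda>p. Q p $ i $ j) 0 = dG i j (B *v axis m 1)" for m i j
    unfolding pderiv_at_def using frechet_derivative_at[OF dQ[of i j]] by metis
  show "Q 0 = 0"
    using QG[OF \<phi>(2)] by (simp add: \<phi>(3) vec_eq_iff G_def P(2))
  show "modular_vector (\<lambda>m. \<chi> i j. pderiv_at m (\<lambda>p. Q p $ i $ j) 0) = ?J *v modular_vector (\<lambda>m. D (axis m 1))"
  proof (rule modular_vector_transform[OF B])
    fix m
    have "(\<Sum>n\<in>UNIV. ?J $ n $ m * dG i j (B *v axis n 1)) = dG i j (axis m 1)" for i j
    proof -
      have l: "linear (\<lambda>w. dG i j (B *v w))" using dQ has_derivative_linear by blast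
      have "(\<Sum>n\<in>UNIV. ?J $ n $ m *\<^sub>R axis n 1) = ?J *v axis m (1 :: real)"
        by (simp add: vec_eq_iff axis_def matrix_vector_mult_def if_distrib cong: if_cong)
      then have "dG i j (B *v (\<Sum>n\<in>UNIV. ?J $ n $ m *\<^sub>R axis n 1)) = dG i j (axis m 1)"
        by (simp add: matrix_vector_mul_assoc B)
      then show ?thesis by (simp add: linear_sum[OF l] linear_cmul[OF l])
    qed
    then show "(\<Sum>n\<in>UNIV. ?J $ n $ m *\<^sub>R (\<chi> i j. pderiv_at n (\<lambda>p. Q p $ i $ j) 0))
        = ?J ** D (axis m 1) ** transpose ?J"
      by (simp add: vec_eq_iff pd matrix_matrix_mult_def transpose_def dG_def)
  qed
qed

lemma modular_vector_L_structure: "modular_vector (\<lambda>n. L_structure (axis n 1)) \<noteq> 0"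
proof -
  have "modular_vector (\<lambda>n. L_structure (axis n 1)) $ 3 = - 2"
    by (simp add: modular_vector_def L_structure_def sum_3 axis_def)
  then show ?thesis by auto
qed

text \<open>
  The modular vector is nonzero for both normal forms, and its vanishing is preserved by all coordinate
  changes that are allowed in reaching them.
\<close>

theorem V_singularity_modular_vector:
  assumes V: "V_singularity P" and P: "P differentiable (at 0)"
  shows "modular_vector (\<lambda>m. frechet_derivative P (at 0) (axis m 1)) \<noteq> 0"
proof
  let ?D = "frechet_derivative P (at 0)"
  assume z: "modular_vector (\<lambda>m. ?D (axis m 1)) = 0"
  have dP: "(P has_derivative ?D) (at 0)" using P frechet_derivative_works by blast
  have P0: "P 0 = 0" using V by (simp add: V_singularity_def)
  consider "linear_poisson_iso ?D L_structure" | f g where "has_normal_form P f g" "jet1_nonzero g"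
    using V by (auto simp: V_singularity_def linear_part_def)
  then show False
  proof cases
    case 1
    then obtain A where A: "invertible A" "\<And>p. L_structure (A *v p) = A ** ?D p ** transpose A"
      by (auto simp: linear_poisson_iso_def)
    obtain B where B: "A ** B = mat 1" "B ** A = mat 1" using A(1) by (auto simp: invertible_def)
    have "modular_vector (\<lambda>n. L_structure (axis n 1)) = A *v modular_vector (\<lambda>m. ?D (axis m 1))"
    proof (rule modular_vector_transform[OF B])
      fix m
      have "(\<Sum>n\<in>UNIV. A $ n $ m *\<^sub>R L_structure (axis n 1)) = L_structure (A *v axis m 1)"
        using exhaust_3[of m] by (auto simp: sum_3 vec3_eq_iff L_structure_def axis_def matrix_vector_mult_def)
      then show "(\<Sum>n\<in>UNIV. A $ n $ m *\<^sub>R L_structure (axis n 1)) = A ** ?D (axis m 1) ** transpose A"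
        by (simp add: A(2))
    qed
    then show False using z modular_vector_L_structure by simp
  next
    case 2
    then obtain U V \<phi> Q A where nf: "normal_form_pair f g" and \<phi>: "diffeo U V \<phi>" "0 \<in> U" "\<phi> 0 = 0"
      "pushes_to U \<phi> P Q" and A: "formal_coordinate_change A"
      "formally_pushes_to A (\<chi> i j. taylor3 (\<lambda>p. Q p $ i $ j)) (normal_form f g)"
      by (auto simp: has_normal_form_def)
    have Q0: "Q 0 = 0" by (rule modular_vector_diffeo(2)[OF \<phi> dP P0])
    have "modular_vector (\<lambda>m. \<chi> i j. lin_coeff ((\<chi> i j. taylor3 (\<lambda>p. Q p $ i $ j)) $ i $ j) m) \<noteq> 0"
      by (rule modular_vector_formal[OF A _ modular_vector_normal_form[OF nf 2(2)]])
        (simp add: low_coeffs_taylor3 Q0)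
    then show False
      using modular_vector_diffeo(1)[OF \<phi> dP P0] z by (simp add: low_coeffs_taylor3)
  qed
qed

section \<open>Poisson families and the normal form\<close>

text \<open>
  The contraction of the Poisson structure with the coordinate volume.
\<close>

definition covector :: "(real^'l \<Rightarrow> real^3 \<Rightarrow> real^3^3) \<Rightarrow> (real^'l) \<times> (real^3) \<Rightarrow> real^3" where
  "covector P x = vector [P (fst x) (snd x) $ 2 $ 3, P (fst x) (snd x) $ 3 $ 1, P (fst x) (snd x) $ 1 $ 2]"

lemma covector_nth [simp]:
  "covector P x $ 1 = P (fst x) (snd x) $ 2 $ 3" "covector P x $ 2 = P (fst x) (snd x) $ 3 $ 1"
  "covector P x $ 3 = P (fst x) (snd x) $ 1 $ 2"
  by (simp_all add: covector_def)

context
  fixes P :: "real^'l \<Rightarrow> real^3 \<Rightarrow> real^3^3" and W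
  assumes W: "open W" and P: "smooth_on W (\<lambda>(\<epsilon>, p). P \<epsilon> p)"
    and poisson: "\<And>x. x \<in> W \<Longrightarrow> poisson_at (P (fst x)) (snd x)"
begin

lemma smooth_covector: "smooth_on W (covector P)"
proof -
  have "Ck_on k W (\<lambda>x. P (fst x) (snd x))" for k using smooth_onD[OF P] by (simp add: split_beta')
  then have "Ck_on k W (covector P)" for k
    unfolding covector_def[abs_def] by (intro Ck_on_vector3 Ck_on_nth W)
  then show ?thesis by (simp add: smooth_on_def)
qed

lemma poisson_eq_bivector:
  assumes "x \<in> W"
  shows "P (fst x) (snd x) = bivector (covector P x $ 3) (covector P x $ 1) (covector P x $ 2)"
  using skew_eq_bivector poisson[OF assms] by (simp add: poisson_at_def)

lemma covector_slice_derivative: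
  assumes "x \<in> W"
  shows "((\<lambda>q. covector P (fst x, q) $ i) has_derivative
    (\<lambda>v. frechet_derivative (covector P) (at x) (0, v) $ i)) (at (snd x))"
proof (rule bounded_linear.has_derivative[OF bounded_linear_vec_nth slice_has_derivative])
  show "(covector P has_derivative frechet_derivative (covector P) (at x)) (at (fst x, snd x))"
    using Ck_on_Suc_has_derivative[OF smooth_onD[OF smooth_covector] assms] by simp
qed

lemma pderiv_covector:
  assumes "x \<in> W"
  shows "pderiv_at l (\<lambda>q. P (fst x) q $ 2 $ 3) (snd x) = frame (covector P) x l $ 1"
    "pderiv_at l (\<lambda>q. P (fst x) q $ 3 $ 1) (snd x) = frame (covector P) x l $ 2"
    "pderiv_at l (\<lambda>q. P (fst x) q $ 1 $ 2) (snd x) = frame (covector P) x l $ 3"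
  using covector_slice_derivative[OF assms, of 1, THEN frechet_derivative_at]
    covector_slice_derivative[OF assms, of 2, THEN frechet_derivative_at]
    covector_slice_derivative[OF assms, of 3, THEN frechet_derivative_at]
  by (simp_all add: pderiv_at_def frame_def fun_eq_iff)

text \<open>
  The Jacobi identity for the three coordinate functions.
\<close>

lemma covector_integrable:
  assumes "x \<in> W"
  shows "covector P x \<bullet> curl (covector P) x = 0"
proof -
  let ?p = "P (fst x) (snd x)" and ?b = "covector P x" and ?c = "frame (covector P) x"
  have e: "?p $ 1 $ 1 = 0" "?p $ 1 $ 2 = ?b $ 3" "?p $ 1 $ 3 = - ?b $ 2" "?p $ 2 $ 1 = - ?b $ 3"
    "?p $ 2 $ 2 = 0" "?p $ 2 $ 3 = ?b $ 1" "?p $ 3 $ 1 = ?b $ 2" "?p $ 3 $ 2 = - ?b $ 1" "?p $ 3 $ 3 = 0"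
    by (simp_all only: poisson_eq_bivector[OF assms] bivector_components)
  have "(\<Sum>l\<in>UNIV. ?p $ 1 $ l * pderiv_at l (\<lambda>q. P (fst x) q $ 2 $ 3) (snd x)
      + ?p $ 2 $ l * pderiv_at l (\<lambda>q. P (fst x) q $ 3 $ 1) (snd x)
      + ?p $ 3 $ l * pderiv_at l (\<lambda>q. P (fst x) q $ 1 $ 2) (snd x)) = 0"
    by (rule poisson[OF assms, unfolded poisson_at_def, THEN conjunct2, rule_format, of 1 2 3])
  then have "?b $ 3 * ?c 2 $ 1 - ?b $ 2 * ?c 3 $ 1 - ?b $ 3 * ?c 1 $ 2 + ?b $ 1 * ?c 3 $ 2
      + ?b $ 2 * ?c 1 $ 3 - ?b $ 1 * ?c 2 $ 3 = 0"
    unfolding pderiv_covector[OF assms] sum_3 e by (simp del: covector_nth)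
  then show ?thesis
    unfolding inner3 curl_def curl_matrix_def vector_3 jac_nth by (simp add: algebra_simps del: covector_nth)
qed

lemma curl_eq_modular_vector:
  assumes "x \<in> W"
  shows "P (fst x) differentiable (at (snd x))"
    and "curl (covector P) x = modular_vector (\<lambda>m. frechet_derivative (P (fst x)) (at (snd x)) (axis m 1))"
proof -
  have Ck1: "Ck_on (Suc 0) W (\<lambda>x. P (fst x) (snd x))" using smooth_onD[OF P] by (simp only: split_beta')
  define E where "E = frechet_derivative (\<lambda>x. P (fst x) (snd x)) (at x)"
  have E: "((\<lambda>x. P (fst x) (snd x)) has_derivative E) (at (fst x, snd x))"
    unfolding E_def prod.collapse by (rule Ck_on_Suc_has_derivative[OF Ck1 assms])
  let ?D = "\<lambda>v. E (0, v)"
  have D: "(P (fst x) has_derivative ?D) (at (snd x))"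
  proof -
    have "((\<lambda>q. (fst x, q)) has_derivative (\<lambda>v. (0, v))) (at (snd x))" by (auto intro!: derivative_eq_intros)
    from has_derivative_compose[OF this E] show ?thesis by (simp only: fst_conv snd_conv)
  qed
  then show "P (fst x) differentiable (at (snd x))" by (rule differentiableI)
  have Dn: "((\<lambda>q. P (fst x) q $ i $ j) has_derivative (\<lambda>v. ?D v $ i $ j)) (at (snd x))" for i j
    by (intro bounded_linear.has_derivative[OF bounded_linear_vec_nth] D)
  have pd: "pderiv_at l (\<lambda>q. P (fst x) q $ i $ j) (snd x) = ?D (axis l 1) $ i $ j" for l i j
    unfolding pderiv_at_def by (rule fun_cong[OF frechet_derivative_at[OF Dn, symmetric]])
  define S where "S = {q. (fst x, q) \<in> W}"
  have S: "open S" "snd x \<in> S"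
    using assms open_vimage[OF W continuous_on_Pair[OF continuous_on_const continuous_on_id], of "fst x"]
    by (simp_all add: S_def vimage_def)
  have skew: "?D v $ i $ j = - ?D v $ j $ i" for v i j
  proof -
    have "((\<lambda>q. - P (fst x) q $ j $ i) has_derivative (\<lambda>v. - ?D v $ j $ i)) (at (snd x))"
      by (intro has_derivative_minus Dn)
    then have "((\<lambda>q. P (fst x) q $ i $ j) has_derivative (\<lambda>v. - ?D v $ j $ i)) (at (snd x))"
    proof (rule has_derivative_transform_within_open[OF _ S])
      fix q assume "q \<in> S"
      then have "transpose (P (fst x) q) = - P (fst x) q"
        using poisson[of "(fst x, q)"] by (simp add: S_def poisson_at_def)
      from arg_cong[OF this, of "\<lambda>M. M $ j $ i"]
      show "- P (fst x) q $ j $ i = P (fst x) q $ i $ j" by (simp add: transpose_def)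
    qed
    from fun_cong[OF has_derivative_unique[OF Dn this], of v] show ?thesis .
  qed
  have fr: "frechet_derivative (P (fst x)) (at (snd x)) = ?D" using frechet_derivative_at[OF D] by simp
  define T where "T l i j = ?D (axis l 1) $ i $ j" for l i j
  have frame_T: "frame (covector P) x l $ 1 = T l 2 3" "frame (covector P) x l $ 2 = T l 3 1"
    "frame (covector P) x l $ 3 = T l 1 2" for l
    by (simp_all only: pderiv_covector[OF assms, symmetric] pd T_def)
  have T_skew: "T l i j = - T l j i" for l i j unfolding T_def by (rule skew)
  have T_diag: "T l i i = 0" for l i using T_skew[of l i i] by simp
  have mod: "modular_vector (\<lambda>m. ?D (axis m 1)) $ i = T 1 i 1 + T 2 i 2 + T 3 i 3" for i
    by (simp add: modular_vector_def sum_3 T_def)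
  show "curl (covector P) x = modular_vector (\<lambda>m. frechet_derivative (P (fst x)) (at (snd x)) (axis m 1))"
    unfolding fr vec3_eq_iff curl_def curl_matrix_def vector_3 jac_nth frame_T mod T_diag
    using T_skew[of 3 1 3] T_skew[of 1 2 1] T_skew[of 2 3 2] by simp
qed

end

text \<open>
  With \<open>{z,x} = 0\<close> every term of the Jacobi identity that does not cancel by skew-symmetry contains a
  derivative in \<open>y\<close>.
\<close>

lemma poisson_at_planar:
  assumes f: "(f has_derivative F) (at p)" "F (axis 2 1) = 0" and g: "(g has_derivative G) (at p)" "G (axis 2 1) = 0"
  shows "poisson_at (\<lambda>q. bivector (f q) (g q) 0) p"
proof -
  have pd: "pderiv_at l f p = F (axis l 1)" "pderiv_at l g p = G (axis l 1)"
    "pderiv_at l (\<lambda>q. - f q) p = - F (axis l 1)" "pderiv_at l (\<lambda>q. - g q) p = - G (axis l 1)"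
    "pderiv_at l (\<lambda>q. 0) p = 0" for l
    unfolding pderiv_at_def frechet_derivative_at[OF f(1), symmetric] frechet_derivative_at[OF g(1), symmetric]
      frechet_derivative_at[OF has_derivative_minus[OF f(1)], symmetric]
      frechet_derivative_at[OF has_derivative_minus[OF g(1)], symmetric]
    by simp_all
  show ?thesis
    unfolding poisson_at_def
    by (simp add: forall_3 sum_3 pd f(2) g(2) vec3_eq_iff transpose_def)
qed

definition axis_projection :: "real^3 \<Rightarrow> real^3" where
  "axis_projection q = vector [q $ 1, 0, q $ 3]"

lemma axis_projection_nth [simp]:
  "axis_projection q $ 1 = q $ 1" "axis_projection q $ 2 = 0" "axis_projection q $ 3 = q $ 3"
  by (simp_all add: axis_projection_def)

lemma axis_projection_decomp: "q = axis_projection q + q $ 2 *\<^sub>R axis 2 1"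
  by (simp add: vec3_eq_iff axis_def)

lemma bounded_linear_axis_projection: "bounded_linear axis_projection"
  unfolding axis_projection_def[abs_def] vector3_eq
  by (intro bounded_linear_add bounded_linear_scaleR_const bounded_linear_vec_nth bounded_linear_zero)

lemma norm_axis_projection: "norm (axis_projection q) \<le> norm q"
proof (rule norm_le_componentwise_cart)
  show "norm (axis_projection q $ i) \<le> norm (q $ i)" for i
    using exhaust_3[of i] by auto
qed

text \<open>
  The equivalence is the inverse \<open>\<phi>\<close> of the chart \<open>\<psi>\<close>; the relation between \<open>P\<close> and \<open>Q\<close> is given in
  terms of \<open>\<psi>\<close> because its Jacobian is the explicit one.
\<close>

lemma chart_families_equivalent:
  fixes P Q :: "real^'l \<Rightarrow> real^3 \<Rightarrow> real^3^3" and \<psi> \<phi> :: "(real^'l) \<times> (real^3) \<Rightarrow> real^3"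
  assumes U: "open U" "(0, 0) \<in> U" and V: "open V" and \<psi>: "smooth_on U \<psi>" "\<psi> (0, 0) = 0" and \<phi>: "smooth_on V \<phi>"
    and UV: "\<And>x. x \<in> U \<Longrightarrow> (fst x, \<psi> x) \<in> V" "\<And>x. x \<in> U \<Longrightarrow> \<phi> (fst x, \<psi> x) = snd x"
    and VU: "\<And>y. y \<in> V \<Longrightarrow> (fst y, \<phi> y) \<in> U" "\<And>y. y \<in> V \<Longrightarrow> \<psi> (fst y, \<phi> y) = snd y"
    and PQ: "\<And>x. x \<in> U \<Longrightarrow> P (fst x) (\<psi> x) = jac \<psi> x ** Q (fst x) (snd x) ** transpose (jac \<psi> x)"
  shows "families_equivalent P Q"
  unfolding families_equivalent_def Let_def
proof (intro exI[of _ V] exI[of _ "\<lambda>\<epsilon> p. \<phi> (\<epsilon>, p)"] conjI allI)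
  show "open V" by fact
  show "(0, 0) \<in> V" using UV(1)[OF U(2)] \<psi>(2) by simp
  show "smooth_on V (\<lambda>(\<epsilon>, p). \<phi> (\<epsilon>, p))" using \<phi> by simp
  show "\<phi> (0, 0) = 0" using UV(2)[OF U(2)] \<psi>(2) by simp
  fix \<epsilon> :: "real^'l"
  let ?V = "{p. (\<epsilon>, p) \<in> V}" and ?U = "{q. (\<epsilon>, q) \<in> U}" and ?\<phi> = "\<lambda>p. \<phi> (\<epsilon>, p)" and ?\<psi> = "\<lambda>q. \<psi> (\<epsilon>, q)"
  have o: "open {p. (\<epsilon>, p) \<in> S}" if "open S" for S :: "((real^'l) \<times> (real^3)) set"
    using open_vimage[OF that continuous_on_Pair[OF continuous_on_const continuous_on_id], of \<epsilon>]
    by (simp add: vimage_def)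
  have slice: "smooth_on {p. (\<epsilon>, p) \<in> S} (\<lambda>p. f (\<epsilon>, p))"
    if "open S" "smooth_on S f" for S and f :: "(real^'l) \<times> (real^3) \<Rightarrow> real^3"
    unfolding smooth_on_def
    by (intro allI Ck_on_compose[OF o[OF that(1)] that(1) _ Ck_on_Pair[OF o Ck_on_const Ck_on_id[OF o]] smooth_onD[OF that(2)]] that(1))
      auto
  have img: "?\<phi> ` ?V = ?U"
  proof
    show "?\<phi> ` ?V \<subseteq> ?U" using VU(1) by force
    show "?U \<subseteq> ?\<phi> ` ?V"
    proof
      fix q assume q: "q \<in> ?U"
      show "q \<in> ?\<phi> ` ?V"
        by (rule image_eqI[of _ _ "?\<psi> q"]) (use UV[of "(\<epsilon>, q)"] q in auto)
    qed
  qed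
  have \<psi>\<phi>: "?\<psi> (?\<phi> p) = p" if "p \<in> ?V" for p using VU(2)[of "(\<epsilon>, p)"] that by simp
  have inj: "inj_on ?\<phi> ?V" by (rule inj_on_inverseI[of _ ?\<psi>]) (rule \<psi>\<phi>)
  have inv: "?\<psi> q = inv_into ?V ?\<phi> q" if "q \<in> ?U" for q
    by (rule inv_into_f_eq[OF inj, symmetric]) (use UV[of "(\<epsilon>, q)"] that in auto)
  show "diffeo ?V (?\<phi> ` ?V) ?\<phi>"
    unfolding diffeo_def img
  proof (intro conjI)
    show "bij_betw ?\<phi> ?V ?U" using inj img by (simp add: bij_betw_def)
    show "smooth_on ?U (inv_into ?V ?\<phi>)"
      unfolding smooth_on_def
      by (intro allI Ck_on_cong[OF o[OF U(1)] inv smooth_onD[OF slice[OF U(1) \<psi>(1)]]])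
  qed (intro o U V slice \<phi>)+
  show "pushes_to ?V ?\<phi> (P \<epsilon>) (Q \<epsilon>)"
    unfolding pushes_to_def
  proof
    fix p assume p: "p \<in> ?V"
    let ?x = "(\<epsilon>, ?\<phi> p)" and ?K = "jacobian ?\<phi> (at p)"
    have x: "?x \<in> U" using VU(1)[of "(\<epsilon>, p)"] p by simp
    have d\<psi>: "(?\<psi> has_derivative (\<lambda>v. jac \<psi> ?x *v v)) (at (?\<phi> p))"
      using slice_has_derivative[OF Ck_on_Suc_has_derivative[OF smooth_onD[OF \<psi>(1)] x]]
      by (simp add: derivative_eq_jac[OF Ck_on_Suc_has_derivative[OF smooth_onD[OF \<psi>(1)] x]])
    have "?\<phi> differentiable (at p)"
      by (rule differentiableI[OF Ck_on_Suc_has_derivative[OF smooth_onD[OF slice[OF V \<phi>]] p]])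
    then have d\<phi>: "(?\<phi> has_derivative (\<lambda>v. ?K *v v)) (at p)" by (simp flip: jacobian_works)
    have "((\<lambda>p. ?\<psi> (?\<phi> p)) has_derivative (\<lambda>v. jac \<psi> ?x *v (?K *v v))) (at p)"
      by (rule has_derivative_compose[OF d\<phi> d\<psi>])
    moreover have "((\<lambda>p. ?\<psi> (?\<phi> p)) has_derivative (\<lambda>v. v)) (at p)"
      by (rule has_derivative_transform_within_open[OF has_derivative_ident o[OF V] p]) (simp add: \<psi>\<phi>)
    ultimately have "(\<lambda>v. jac \<psi> ?x *v (?K *v v)) = (\<lambda>v. v)" by (rule has_derivative_unique)
    then have "jac \<psi> ?x ** ?K = mat 1"
      unfolding matrix_eq by (simp add: matrix_vector_mul_assoc fun_eq_iff)
    then have KJ: "?K ** jac \<psi> ?x = mat 1" by (rule matrix_left_right_inverse[THEN iffD1])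
    have JK: "transpose (jac \<psi> ?x) ** transpose ?K = mat 1"
      by (simp add: KJ transpose_mat flip: matrix_transpose_mul)
    have "P \<epsilon> p = jac \<psi> ?x ** Q \<epsilon> (?\<phi> p) ** transpose (jac \<psi> ?x)"
      using PQ[OF x] \<psi>\<phi>[OF p] by simp
    then have "?K ** P \<epsilon> p ** transpose ?K
        = (?K ** jac \<psi> ?x) ** Q \<epsilon> (?\<phi> p) ** (transpose (jac \<psi> ?x) ** transpose ?K)"
      by (simp only: matrix_mul_assoc)
    then show "Q \<epsilon> (?\<phi> p) = ?K ** P \<epsilon> p ** transpose ?K" by (simp add: KJ JK)
  qed
qed

theorem proposition2p2:
  fixes P :: "real^'l \<Rightarrow> real^3 \<Rightarrow> real^3^3"
  assumes "local_poisson_family P"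
    and "V_singularity (P 0)"
  shows "\<exists>\<alpha> \<beta> :: real^'l \<Rightarrow> real \<Rightarrow> real \<Rightarrow> real.
    smooth_near (0, 0, 0) (\<lambda>(\<epsilon>, x, z). \<alpha> \<epsilon> x z) \<and>
    smooth_near (0, 0, 0) (\<lambda>(\<epsilon>, x, z). \<beta> \<epsilon> x z) \<and>
    (let v = (\<lambda>\<epsilon>. model_field (\<alpha> \<epsilon>) (\<beta> \<epsilon>));
         Q = (\<lambda>\<epsilon> p. wedge (axis 2 1) (v \<epsilon> p))
     in local_poisson_family Q \<and> families_equivalent P Q \<and>
        v 0 0 = 0 \<and> sum_eigenvalues (jacobian (v 0) (at 0)) \<noteq> 0)"
proof -
  obtain W where W: "open W" "(0, 0) \<in> W" and P: "smooth_on W (\<lambda>(\<epsilon>, p). P \<epsilon> p)"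
    and "\<forall>(\<epsilon>, p)\<in>W. poisson_at (P \<epsilon>) p"
    using assms(1) unfolding local_poisson_family_def by blast
  then have poisson: "\<And>x. x \<in> W \<Longrightarrow> poisson_at (P (fst x)) (snd x)" by auto
  let ?b = "covector P"
  have b: "smooth_on W ?b" by (rule smooth_covector[OF W(1) P poisson])
  have sX: "smooth_on W (curl ?b)"
    unfolding smooth_on_def using Ck_on_curl[OF W(1) smooth_onD[OF b]] by blast
  have X0: "curl ?b (0, 0) \<noteq> 0"
    using V_singularity_modular_vector[OF assms(2)] curl_eq_modular_vector[OF W(1) P poisson W(2)] by simp
  obtain N \<psi> where N: "open N" "(0, 0) \<in> N" "smooth_on N \<psi>" "\<psi> (0, 0) = 0"
    "\<And>x. x \<in> N \<Longrightarrow> (fst x, \<psi> x) \<in> W" "\<And>x. x \<in> N \<Longrightarrow> frame \<psi> x 2 = curl ?b (fst x, \<psi> x)"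
    "\<And>x. x \<in> N \<Longrightarrow> vol \<psi> x \<noteq> 0"
    using flow_chart[OF W sX X0] by blast
  \<comment> \<open>A ball is convex and stable under setting \<open>y\<close> to zero, so each point is joined inside it to its projection.\<close>
  obtain r where r: "r > 0" "ball (0, 0) r \<subseteq> N" using N(1,2) openE by blast
  define B :: "((real^'l) \<times> (real^3)) set" where "B = ball (0, 0) r"
  have BN: "x \<in> N" if "x \<in> B" for x using that r(2) unfolding B_def by blast
  have Bo: "open B" and Bc: "convex B" and B0: "(0, 0) \<in> B" using r(1) by (simp_all add: B_def)
  have \<psi>B: "smooth_on B \<psi>"
    unfolding smooth_on_def by (intro allI Ck_on_subset[OF smooth_onD[OF N(3)]]) (use BN in blast)
  interpret straightened_curl ?b \<psi> W B
    by unfold_locales (use W b Bo \<psi>B N BN covector_integrable[OF W(1) P poisson] in auto)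
  have Bproj: "(fst x, axis_projection (snd x)) \<in> B" if "x \<in> B" for x
  proof -
    have "norm (fst x, axis_projection (snd x)) \<le> norm (fst x, snd x)"
      unfolding norm_Pair using norm_axis_projection[of "snd x"] by (simp add: power_mono)
    moreover have "y \<in> B \<longleftrightarrow> norm y < r" for y by (simp add: B_def flip: zero_prod_def)
    ultimately show ?thesis using that by simp
  qed
  have hproj: "straight_covector i (fst x, axis_projection (snd x)) = straight_covector i x" if "x \<in> B" for i x
    using straight_covector_constant[OF Bc Bproj[OF that], of "snd x $ 2" i] that
    by (simp add: axis_projection_decomp[symmetric])
  define \<alpha> where "\<alpha> \<epsilon> x z = - straight_covector 3 (\<epsilon>, vector [x, 0, z])" for \<epsilon> x z
  define \<beta> where "\<beta> \<epsilon> x z = straight_covector 1 (\<epsilon>, vector [x, 0, z])" for \<epsilon> x z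
  define Q where "Q \<epsilon> p = wedge (axis 2 1) (model_field (\<alpha> \<epsilon>) (\<beta> \<epsilon>) p)" for \<epsilon> p
  have Q: "Q \<epsilon> p = bivector (straight_covector 3 (\<epsilon>, axis_projection p)) (straight_covector 1 (\<epsilon>, axis_projection p)) 0" for \<epsilon> p
    by (simp add: Q_def wedge_model_field \<alpha>_def \<beta>_def axis_projection_def)
  define \<iota> :: "(real^'l) \<times> real \<times> real \<Rightarrow> (real^'l) \<times> (real^3)"
    where "\<iota> y = (fst y, vector [fst (snd y), 0, snd (snd y)])" for y
  have \<iota>: "bounded_linear \<iota>"
    unfolding \<iota>_def[abs_def] vector3_eq
    by (intro bounded_linear_Pair bounded_linear_add bounded_linear_scaleR_const bounded_linear_fst
        bounded_linear_compose[OF bounded_linear_fst bounded_linear_snd]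
        bounded_linear_compose[OF bounded_linear_snd bounded_linear_snd] bounded_linear_zero)
  have o\<iota>: "open (\<iota> -` B)" by (intro open_vimage B(1) linear_continuous_on \<iota>)
  have \<iota>0: "(0, 0, 0) \<in> \<iota> -` B" using B0 by (simp add: \<iota>_def vector3_eq)
  have h\<iota>: "Ck_on k (\<iota> -` B) (\<lambda>y. straight_covector i (\<iota> y))" for k i
    by (rule Ck_on_compose[OF o\<iota> B(1) _ Ck_on_bounded_linear[OF \<iota> o\<iota>] straight_covector_Ck]) auto
  have sm\<alpha>: "smooth_near (0, 0, 0) (\<lambda>(\<epsilon>, x, z). \<alpha> \<epsilon> x z)"
    unfolding smooth_near_def smooth_on_def
    using o\<iota> \<iota>0 Ck_on_scaleR_const[OF o\<iota> h\<iota>, of _ "- 1" 3]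
    by (intro exI[of _ "\<iota> -` B"]) (simp add: \<alpha>_def split_beta' \<iota>_def)
  have sm\<beta>: "smooth_near (0, 0, 0) (\<lambda>(\<epsilon>, x, z). \<beta> \<epsilon> x z)"
    unfolding smooth_near_def smooth_on_def
    using o\<iota> \<iota>0 h\<iota>[of _ 1]
    by (intro exI[of _ "\<iota> -` B"]) (simp add: \<beta>_def split_beta' \<iota>_def)
  \<comment> \<open>The model family evaluates its coefficients at the projection of the point to \<open>y = 0\<close>.\<close>
  define \<rho> :: "(real^'l) \<times> (real^3) \<Rightarrow> (real^'l) \<times> (real^3)" where "\<rho> x = (fst x, axis_projection (snd x))" for x
  have \<rho>: "bounded_linear \<rho>"
    unfolding \<rho>_def[abs_def]
    by (intro bounded_linear_Pair bounded_linear_fst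
        bounded_linear_compose[OF bounded_linear_axis_projection bounded_linear_snd])
  have \<rho>B: "\<rho> x \<in> B" if "x \<in> B" for x using Bproj[OF that] by (simp add: \<rho>_def)
  have h\<rho>: "Ck_on k B (\<lambda>x. straight_covector i (\<rho> x))" for k i
    by (rule Ck_on_compose[OF B(1) B(1) _ Ck_on_bounded_linear[OF \<rho> B(1)] straight_covector_Ck]) (use \<rho>B in auto)
  have hd: "((\<lambda>p. straight_covector i (fst x, axis_projection p)) has_derivative
      (\<lambda>v. frechet_derivative (straight_covector i) (at (\<rho> x)) (0, axis_projection v))) (at (snd x))" if "x \<in> B" for i x
  proof -
    have "(straight_covector i has_derivative frechet_derivative (straight_covector i) (at (\<rho> x))) (at (\<rho> x))"
      by (rule Ck_on_Suc_has_derivative[OF straight_covector_Ck \<rho>B[OF that]])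
    moreover have "((\<lambda>p. (fst x, axis_projection p)) has_derivative (\<lambda>v. (0, axis_projection v))) (at (snd x))"
      by (intro has_derivative_Pair has_derivative_const
          bounded_linear_imp_has_derivative bounded_linear_axis_projection)
    ultimately show ?thesis unfolding \<rho>_def by (rule has_derivative_compose[rotated])
  qed
  have proj2: "axis_projection (axis 2 1) = 0" by (simp add: vec3_eq_iff axis_def)
  have local: "local_poisson_family Q"
    unfolding local_poisson_family_def
  proof (intro exI[of _ B] conjI Bo B0)
    have "Ck_on k B (\<lambda>x. straight_covector 3 (\<rho> x) *\<^sub>R bivector 1 0 0 + straight_covector 1 (\<rho> x) *\<^sub>R bivector 0 1 (0 :: real))" for k
      by (intro Ck_on_add Ck_on_compose_bounded_linear[OF bounded_linear_scaleR_left] B(1) h\<rho>)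
    moreover have "(\<lambda>(\<epsilon>, p). Q \<epsilon> p) = (\<lambda>x. straight_covector 3 (\<rho> x) *\<^sub>R bivector 1 0 0 + straight_covector 1 (\<rho> x) *\<^sub>R bivector 0 1 (0 :: real))"
      by (auto simp: fun_eq_iff Q \<rho>_def vec3_eq_iff)
    ultimately show "smooth_on B (\<lambda>(\<epsilon>, p). Q \<epsilon> p)" by (simp add: smooth_on_def)
    have zero: "frechet_derivative (straight_covector i) (at (\<rho> x)) (0, axis_projection (axis 2 1)) = 0" if "x \<in> B" for i x
      unfolding proj2
      using linear_0[OF has_derivative_linear[OF Ck_on_Suc_has_derivative[OF straight_covector_Ck \<rho>B[OF that]]]]
      by (simp add: zero_prod_def)
    show "\<forall>(\<epsilon>, p)\<in>B. poisson_at (Q \<epsilon>) p"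
    proof safe
      fix \<epsilon> p assume x: "(\<epsilon>, p) \<in> B"
      show "poisson_at (Q \<epsilon>) p"
        using poisson_at_planar[OF hd[OF x, of 3] zero[OF x] hd[OF x, of 1] zero[OF x]]
        by (simp add: Q[abs_def])
    qed
  qed
  obtain U V \<phi> where U: "open U" "U \<subseteq> B" "(0, 0) \<in> U" and V: "open V" "smooth_on V \<phi>"
    and UV: "\<And>x. x \<in> U \<Longrightarrow> (fst x, \<psi> x) \<in> V" "\<And>x. x \<in> U \<Longrightarrow> \<phi> (fst x, \<psi> x) = snd x"
    and VU: "\<And>y. y \<in> V \<Longrightarrow> (fst y, \<phi> y) \<in> U" "\<And>y. y \<in> V \<Longrightarrow> \<psi> (fst y, \<phi> y) = snd y"
    using smooth_inverse_chart[OF Bo B0 \<psi>B vol] by blast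
  have equiv: "families_equivalent P Q"
  proof (rule chart_families_equivalent[OF U(1,3) V(1) _ N(4) V(2) UV VU])
    show "smooth_on U \<psi>"
      unfolding smooth_on_def by (intro allI Ck_on_subset[OF smooth_onD[OF \<psi>B] U(2)])
    fix x assume "x \<in> U"
    then have x: "x \<in> B" using U(2) by blast
    have "Q (fst x) (snd x) = bivector (straight_covector 3 x) (straight_covector 1 x) 0" by (simp add: Q hproj[OF x])
    moreover have "P (fst x) (\<psi> x) = bivector (?b (fst x, \<psi> x) $ 3) (?b (fst x, \<psi> x) $ 1) (?b (fst x, \<psi> x) $ 2)"
      using poisson_eq_bivector[OF W(1) P poisson \<psi>W[OF x]] by (simp only: fst_conv snd_conv)
    ultimately show "P (fst x) (\<psi> x) = jac \<psi> x ** Q (fst x) (snd x) ** transpose (jac \<psi> x)"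
      by (simp only: bivector_pullback[OF x])
  qed
  have b0: "?b (fst (0, 0), \<psi> (0, 0)) = 0"
  proof -
    have "P 0 0 = 0" using assms(2) by (simp add: V_singularity_def)
    then show ?thesis by (simp add: covector_def N(4) vector3_eq)
  qed
  let ?v = "\<lambda>p. vector [- straight_covector 3 (0, axis_projection p), 0, straight_covector 1 (0, axis_projection p)] :: real^3"
  have v: "model_field (\<alpha> 0) (\<beta> 0) = ?v"
    by (simp add: fun_eq_iff model_field_def \<alpha>_def \<beta>_def axis_projection_def)
  have ap0: "axis_projection 0 = 0" by (simp add: vec3_eq_iff)
  have h0: "straight_covector i (0, 0) = 0" for i using b0 by (simp add: straight_covector_def)
  have v0: "model_field (\<alpha> 0) (\<beta> 0) 0 = 0" by (simp add: v ap0 h0 vec3_eq_iff)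
  have "sum_eigenvalues (jacobian (model_field (\<alpha> 0) (\<beta> 0)) (at 0)) = 1"
  proof -
    let ?D = "\<lambda>i v. frechet_derivative (straight_covector i) (at (0, 0)) (0, axis_projection v)"
    have hd0: "((\<lambda>p. straight_covector i (0, axis_projection p)) has_derivative ?D i) (at 0)" for i
      using hd[OF B0, of i] by (simp add: \<rho>_def ap0)
    let ?D' = "\<lambda>w. (- ?D 3 w) *\<^sub>R axis 1 1 + 0 + ?D 1 w *\<^sub>R axis 3 1 :: real^3"
    have v_der: "(?v has_derivative ?D') (at 0)"
      unfolding vector3_eq
      by (rule has_derivative_add[OF has_derivative_add[OF has_derivative_scaleR_left[OF has_derivative_minus[OF hd0]]
            has_derivative_const] has_derivative_scaleR_left[OF hd0]])
    have fd: "frechet_derivative ?v (at 0) = ?D'" by (rule frechet_derivative_at[OF v_der, symmetric])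
    have ax: "axis_projection (axis 3 1) = axis 3 1" "axis_projection (axis 2 1) = 0" "axis_projection (axis 1 1) = axis 1 1"
      by (simp_all add: vec3_eq_iff axis_def)
    have "jacobian ?v (at 0) $ i $ i = ?D' (axis i 1) $ i" for i
      unfolding jacobian_def fd by (simp add: matrix_def)
    then have "trace (jacobian ?v (at 0)) = ?D' (axis 1 1) $ 1 + ?D' (axis 2 1) $ 2 + ?D' (axis 3 1) $ 3"
      by (simp only: trace_def sum_3)
    also have "\<dots> = ?D 1 (axis 3 1) - ?D 3 (axis 1 1)" by (simp add: axis_def)
    also have "\<dots> = 1" unfolding ax by (rule straight_covector_trace_at_zero[OF B0 b0])
    finally show ?thesis unfolding v sum_eigenvalues_eq_trace by simp
  qed
  then have ev_ne: "sum_eigenvalues (jacobian (model_field (\<alpha> 0) (\<beta> 0)) (at 0)) \<noteq> 0"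
    by (simp only: one_neq_zero not_False_eq_True)
  have Q_eq: "(\<lambda>\<epsilon> p. wedge (axis 2 1) (model_field (\<alpha> \<epsilon>) (\<beta> \<epsilon>) p)) = Q"
    by (rule ext, rule ext, rule Q_def[symmetric])
  have rest: "local_poisson_family Q \<and> families_equivalent P Q \<and> model_field (\<alpha> 0) (\<beta> 0) 0 = 0
      \<and> sum_eigenvalues (jacobian (model_field (\<alpha> 0) (\<beta> 0)) (at 0)) \<noteq> 0"
    by (rule conjI[OF local conjI[OF equiv conjI[OF v0 ev_ne]]])
  show ?thesis
    unfolding Let_def
    by (rule exI[of _ \<alpha>], rule exI[of _ \<beta>], rule conjI[OF sm\<alpha> conjI[OF sm\<beta>]], unfold Q_eq, rule rest)
qed

end
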